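(* Given a sorted input $x_1 \le \dots \le x_n$ of real numbers and an integer $k \ge 1$, an optimal 1D $k$-Means clustering, i.e. centroids $\mathcal{M}=\{\mu_1,\dots,\mu_k\}\subset\mathbb{R}$ minimizing $\sum_{\ell=1}^n \min_{\mu\in\mathcal{M}} (x_\ell-\mu)^2$, can be computed in $O(kn)$ time using $O(n)$ space.
   Context: Model of computation: a real RAM in which arithmetic operations and comparisons on real numbers take constant time and each real number occupies one unit of space. *)

theory Defs
  imports Complex_Main
begin

text \<open>
  Real RAM: finitely many named registers and a random access memory, each register and each cell
  holding one real number. Every instruction takes one unit of time. There is no rounding and no
  real-to-integer conversion, and the only constants a program may mention are integers.
\<close>

type_synonym reg = nat

datatype instr =
    Const reg int
  | Move reg reg
  | Add reg reg reg
  | Sub reg reg reg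
  | Mul reg reg reg
  | Div reg reg reg
  | Load reg reg
  | Store reg reg
  | Jump nat
  | JumpLe reg reg nat
  | Output reg
  | Halt

type_synonym program = "instr list"

record config =
  pc :: nat
  regs :: "reg \<Rightarrow> real"
  mem :: "nat \<Rightarrow> real"
  out :: "real list"

definition set_reg :: "reg \<Rightarrow> real \<Rightarrow> config \<Rightarrow> config" where
  "set_reg r v c = c\<lparr>pc := Suc (pc c), regs := (regs c)(r := v)\<rparr>"

text \<open>
  A real is usable as an address into a memory of \<open>s\<close> cells only if it is one of
  \<open>0, \<dots>, s - 1\<close>.
\<close>

definition address :: "nat \<Rightarrow> real \<Rightarrow> nat option" where
  "address s v = (if v \<in> \<nat> \<and> v < real s then Some (nat \<lfloor>v\<rfloor>) else None)"

text \<open>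
  The effect of one instruction on a machine whose memory has \<open>s\<close> cells. The result \<open>None\<close> is a
  fault (division by zero, or an access outside the memory), except for \<^const>\<open>Halt\<close>. The output is
  write-only.
\<close>

fun exec :: "nat \<Rightarrow> instr \<Rightarrow> config \<Rightarrow> config option" where
  "exec s (Const r z) c = Some (set_reg r (of_int z) c)"
| "exec s (Move r a) c = Some (set_reg r (regs c a) c)"
| "exec s (Add r a b) c = Some (set_reg r (regs c a + regs c b) c)"
| "exec s (Sub r a b) c = Some (set_reg r (regs c a - regs c b) c)"
| "exec s (Mul r a b) c = Some (set_reg r (regs c a * regs c b) c)"
| "exec s (Div r a b) c =
    (if regs c b = 0 then None else Some (set_reg r (regs c a / regs c b) c))"
| "exec s (Load r a) c =
    (case address s (regs c a) of
      None \<Rightarrow> None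
    | Some i \<Rightarrow> Some (set_reg r (mem c i) c))"
| "exec s (Store a r) c =
    (case address s (regs c a) of
      None \<Rightarrow> None
    | Some i \<Rightarrow> Some (c\<lparr>pc := Suc (pc c), mem := (mem c)(i := regs c r)\<rparr>))"
| "exec s (Jump l) c = Some (c\<lparr>pc := l\<rparr>)"
| "exec s (JumpLe a b l) c =
    Some (c\<lparr>pc := (if regs c a \<le> regs c b then l else Suc (pc c))\<rparr>)"
| "exec s (Output r) c = Some (c\<lparr>pc := Suc (pc c), out := out c @ [regs c r]\<rparr>)"
| "exec s Halt c = None"

definition step :: "nat \<Rightarrow> program \<Rightarrow> config \<Rightarrow> config \<Rightarrow> bool" where
  "step s p c c' \<longleftrightarrow> pc c < length p \<and> exec s (p ! pc c) c = Some c'"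

definition halted :: "program \<Rightarrow> config \<Rightarrow> bool" where
  "halted p c \<longleftrightarrow> pc c < length p \<and> p ! pc c = Halt"

fun instr_regs :: "instr \<Rightarrow> reg set" where
  "instr_regs (Const r z) = {r}"
| "instr_regs (Move r a) = {r, a}"
| "instr_regs (Add r a b) = {r, a, b}"
| "instr_regs (Sub r a b) = {r, a, b}"
| "instr_regs (Mul r a b) = {r, a, b}"
| "instr_regs (Div r a b) = {r, a, b}"
| "instr_regs (Load r a) = {r, a}"
| "instr_regs (Store a r) = {a, r}"
| "instr_regs (Jump l) = {}"
| "instr_regs (JumpLe a b l) = {a, b}"
| "instr_regs (Output r) = {r}"
| "instr_regs Halt = {}"

definition num_regs :: "program \<Rightarrow> nat" where
  "num_regs p = card (\<Union>i \<in> set p. instr_regs i)"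

text \<open>
  Input convention: register 0 holds \<open>n\<close>, register 1 holds \<open>k\<close>, memory cells \<open>0, \<dots>, n - 1\<close> hold
  the points, and everything else is 0.
\<close>

definition init_config :: "real list \<Rightarrow> nat \<Rightarrow> config" where
  "init_config xs k =
    \<lparr>pc = 0,
     regs = (\<lambda>_. 0)(0 := real (length xs), 1 := real k),
     mem = (\<lambda>i. if i < length xs then xs ! i else 0),
     out = []\<rparr>"

text \<open>
  On input \<open>(xs, k)\<close> the program \<open>p\<close> halts with output \<open>ys\<close> after \<open>t\<close> instructions in total (the
  final \<^const>\<open>Halt\<close> included), using \<open>s\<close> units of space: its registers together with all of the
  memory, whose cells \<open>0, \<dots>, m - 1\<close> include those occupied by the input.
  The write-only output stream is not counted, as \<open>k\<close> centroids do not fit into \<open>O(n)\<close> cells when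
  \<open>k\<close> is much larger than \<open>n\<close>.
\<close>

definition computes_in :: "program \<Rightarrow> real list \<Rightarrow> nat \<Rightarrow> real list \<Rightarrow> nat \<Rightarrow> nat \<Rightarrow> bool" where
  "computes_in p xs k ys t s \<longleftrightarrow>
    (\<exists>m j c. length xs \<le> m \<and> s = num_regs p + m \<and> t = Suc j \<and>
      (step m p ^^ j) (init_config xs k) c \<and> halted p c \<and> out c = ys)"

definition kmeans_cost :: "real list \<Rightarrow> real set \<Rightarrow> real" where
  "kmeans_cost xs M = (\<Sum>x\<leftarrow>xs. MIN \<mu>\<in>M. (x - \<mu>)\<^sup>2)"

text \<open>The centroids \<open>\<mu>\<^sub>1, \<dots>, \<mu>\<^sub>k\<close> form a list and need not be distinct, so \<open>k\<close> may exceed \<open>n\<close>.\<close>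

definition optimal_kmeans :: "real list \<Rightarrow> nat \<Rightarrow> real list \<Rightarrow> bool" where
  "optimal_kmeans xs k ms \<longleftrightarrow>
    length ms = k \<and>
    (\<forall>ms'. length ms' = k \<longrightarrow> kmeans_cost xs (set ms) \<le> kmeans_cost xs (set ms'))"

end

theory Submission imports Defs begin

text \<open>
  On sorted points an optimal clustering consists of consecutive blocks, and the cost of a block,
  extended by 0 to empty ones, satisfies the Monge inequality. Hence one layer of the dynamic program
  over the number of clusters is the computation of all row minima of a Monge matrix, which the SMAWK
  method does in linear time: reduce the columns for strides 1, 2, 4, ..., then fill in the rows
  between those already solved while the stride shrinks back to 1. Only the current layer is kept,
  together with the position at which an optimal partition crosses the middle layer (Hirschberg);
  a stack of pending pieces then replaces recursion. A piece with \<open>q\<close> clusters and \<open>N\<close> points is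
  split in time \<open>O(q (N + 1))\<close>, and the potential \<open>4 q N + q\<^sup>2\<close>, summed over the stack, pays for
  all splits. If \<open>k > n\<close>, then \<open>n\<close> clusters already have cost 0 and the output is padded.
\<close>

section \<open>Structured programs for the real RAM\<close>

text \<open>The matrix of a layer is naturally triangular, since a last cluster cannot start after
  its end. Letting such reversed blocks cost 0 fills it up and keeps the Monge inequality, so the
  reduction needs no special cases at the diagonal; a minimiser found beyond the diagonal is moved
  back onto it. Row 0 then has a minimum in column 0, which survives every reduction and marks the
  beginning of each column list. Space forces the rest of the design. A table of all argmins would
  take about k n cells, hence the cut in the middle. The list for stride \<sigma> has at most
  N/\<sigma> + 1 entries, so all lists together stay linear in N. A split roughly halves the cluster
  numbers while the lengths of both parts add up to N, so the area q N shrinks geometrically; it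
  cannot pay for pieces without points, and the square in the potential can. At most n clusters are
  in use, which keeps the square below the product of both numbers. The machine cannot round:
  strides are powers of two, whose halving is exact, and q div 2 is found by counting.\<close>

datatype com =
    Block "instr list"
  | Seq com com  (infixr \<open>;;\<close> 60)
  | Cond reg reg com com
  | Loop com reg reg com

fun len :: "com \<Rightarrow> nat" where
  "len (Block is) = length is"
| "len (c1 ;; c2) = len c1 + len c2"
| "len (Cond a b c1 c2) = len c1 + len c2 + 2"
| "len (Loop c1 a b c2) = len c1 + len c2 + 2"

text \<open>Jump targets are absolute, hence the parameter \<open>l\<close>, the address at which
  the code will stand. In \<open>Cond\<close> the else branch comes first and needs a jump over the
  other branch.\<close>

fun compile :: "nat \<Rightarrow> com \<Rightarrow> program" where
  "compile l (Block is) = is"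
| "compile l (c1 ;; c2) = compile l c1 @ compile (l + len c1) c2"
| "compile l (Cond a b c1 c2) =
    JumpLe a b (l + len c2 + 2) # compile (l + 1) c2 @
    Jump (l + len c2 + 2 + len c1) # compile (l + len c2 + 2) c1"
| "compile l (Loop c1 a b c2) =
    compile l c1 @ JumpLe a b (l + len c1 + len c2 + 2) #
    compile (l + len c1 + 1) c2 @ [Jump l]"

lemma length_compile [simp]: "length (compile l c) = len c"
  by (induction c arbitrary: l) auto

definition code_at :: "program \<Rightarrow> nat \<Rightarrow> program \<Rightarrow> bool" where
  "code_at p l is \<longleftrightarrow> (\<exists>u v. p = u @ is @ v \<and> length u = l)"

lemma code_at_append:
  "code_at p l (is @ js) \<longleftrightarrow> code_at p l is \<and> code_at p (l + length is) js"
proof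
  assume "code_at p l (is @ js)"
  then obtain u v where "p = u @ (is @ js) @ v" "length u = l"
    unfolding code_at_def by blast
  then have "p = u @ is @ (js @ v)" "p = (u @ is) @ js @ v" "length (u @ is) = l + length is"
    by auto
  then show "code_at p l is \<and> code_at p (l + length is) js"
    using \<open>length u = l\<close> unfolding code_at_def by blast
next
  assume "code_at p l is \<and> code_at p (l + length is) js"
  then obtain u v u' v' where p: "p = u @ is @ v" "length u = l"
      "p = u' @ js @ v'" "length u' = l + length is"
    unfolding code_at_def by blast
  then have "(u @ is) @ v = u' @ js @ v'" "length (u @ is) = length u'" by auto
  then have "u @ is = u' \<and> v = js @ v'" by (subst (asm) append_eq_append_conv) auto
  with p have "p = u @ (is @ js) @ v'" by auto
  then show "code_at p l (is @ js)" using p(2) unfolding code_at_def by blast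
qed

lemma code_at_Cons:
  "code_at p l (i # is) \<longleftrightarrow> code_at p l [i] \<and> code_at p (Suc l) is"
  using code_at_append[of p l "[i]" "is"] by simp

lemma code_at_single: "code_at p l [i] \<Longrightarrow> l < length p \<and> p ! l = i"
  by (auto simp: code_at_def nth_append)

lemma relpowp_single: "r x y \<Longrightarrow> (r ^^ 1) x y" for r :: "'a \<Rightarrow> 'a \<Rightarrow> bool"
  unfolding One_nat_def by (rule relpowp_Suc_I[OF relpowp_0_I])

lemma relpowp_trans:
  "(r ^^ i) x y \<Longrightarrow> (r ^^ j) y z \<Longrightarrow> (r ^^ (i + j)) x z" for r :: "'a \<Rightarrow> 'a \<Rightarrow> bool"
  by (auto simp: relpowp_add)

type_synonym assertion = "(reg \<Rightarrow> real) \<Rightarrow> (nat \<Rightarrow> real) \<Rightarrow> real list \<Rightarrow> real \<Rightarrow> bool"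

definition cfg :: "nat \<Rightarrow> (reg \<Rightarrow> real) \<Rightarrow> (nat \<Rightarrow> real) \<Rightarrow> real list \<Rightarrow> config" where
  "cfg l R M Y = \<lparr>pc = l, regs = R, mem = M, out = Y\<rparr>"

text \<open>
  Time is accounted for by a real amount of fuel \<open>f\<close>, of which every instruction burns one unit; it
  may become negative. An assertion bounds the running time by bounding the remaining fuel from
  below, and a loop whose invariant implies that the fuel is nonnegative terminates.
\<close>

definition wp :: "nat \<Rightarrow> com \<Rightarrow> assertion \<Rightarrow> assertion" where
  "wp m c Q R M Y f \<longleftrightarrow> (\<exists>t R' M' Y'.
     (\<forall>p l. code_at p l (compile l c) \<longrightarrow>
       (step m p ^^ t) (cfg l R M Y) (cfg (l + len c) R' M' Y')) \<and>
     Q R' M' Y' (f - real t))"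

lemma wp_conseq:
  assumes "wp m c Q R M Y f"
    and "\<And>R' M' Y' f'. Q R' M' Y' f' \<Longrightarrow> Q' R' M' Y' f'"
  shows "wp m c Q' R M Y f"
  using assms unfolding wp_def by meson

lemma wp_Seq:
  assumes "wp m c1 (wp m c2 Q) R M Y f"
  shows "wp m (c1 ;; c2) Q R M Y f"
proof -
  obtain t1 R1 M1 Y1 where 1: "\<And>p l. code_at p l (compile l c1) \<Longrightarrow>
       (step m p ^^ t1) (cfg l R M Y) (cfg (l + len c1) R1 M1 Y1)"
      and "wp m c2 Q R1 M1 Y1 (f - real t1)"
    using assms unfolding wp_def[of m c1] by blast
  then obtain t2 R2 M2 Y2 where 2: "\<And>p l. code_at p l (compile l c2) \<Longrightarrow>
       (step m p ^^ t2) (cfg l R1 M1 Y1) (cfg (l + len c2) R2 M2 Y2)"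
      and Q: "Q R2 M2 Y2 (f - real t1 - real t2)"
    unfolding wp_def[of m c2] by blast
  have "(step m p ^^ (t1 + t2)) (cfg l R M Y) (cfg (l + len (c1 ;; c2)) R2 M2 Y2)"
    if "code_at p l (compile l (c1 ;; c2))" for p l
  proof -
    have "code_at p l (compile l c1)" "code_at p (l + len c1) (compile (l + len c1) c2)"
      using that by (auto simp: code_at_append)
    from 1[OF this(1)] 2[OF this(2)] show ?thesis
      by (auto simp: relpowp_add add.assoc)
  qed
  then show ?thesis using Q unfolding wp_def
    by (intro exI[of _ "t1 + t2"] exI[of _ R2] exI[of _ M2] exI[of _ Y2])
       (simp add: algebra_simps)
qed

text \<open>Jumps and \<open>Halt\<close> are mapped to \<open>False\<close>: inside a block control
  only moves forward, and all jumps are produced by \<open>compile\<close>.\<close>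

fun instr_wp :: "nat \<Rightarrow> instr \<Rightarrow> assertion \<Rightarrow> assertion" where
  "instr_wp m (Const r z) Q R M Y f = Q (R(r := of_int z)) M Y (f - 1)"
| "instr_wp m (Move r a) Q R M Y f = Q (R(r := R a)) M Y (f - 1)"
| "instr_wp m (Add r a b) Q R M Y f = Q (R(r := R a + R b)) M Y (f - 1)"
| "instr_wp m (Sub r a b) Q R M Y f = Q (R(r := R a - R b)) M Y (f - 1)"
| "instr_wp m (Mul r a b) Q R M Y f = Q (R(r := R a * R b)) M Y (f - 1)"
| "instr_wp m (Div r a b) Q R M Y f = (R b \<noteq> 0 \<and> Q (R(r := R a / R b)) M Y (f - 1))"
| "instr_wp m (Load r a) Q R M Y f =
    (case address m (R a) of None \<Rightarrow> False | Some i \<Rightarrow> Q (R(r := M i)) M Y (f - 1))"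
| "instr_wp m (Store a r) Q R M Y f =
    (case address m (R a) of None \<Rightarrow> False | Some i \<Rightarrow> Q R (M(i := R r)) Y (f - 1))"
| "instr_wp m (Output r) Q R M Y f = Q R M (Y @ [R r]) (f - 1)"
| "instr_wp m _ Q R M Y f = False"

fun block_wp :: "nat \<Rightarrow> instr list \<Rightarrow> assertion \<Rightarrow> assertion" where
  "block_wp m [] Q = Q"
| "block_wp m (i # is) Q = instr_wp m i (block_wp m is Q)"

lemma wp_instr:
  assumes "instr_wp m i Q R M Y f"
  shows "wp m (Block [i]) Q R M Y f"
proof -
  obtain R' M' Y' where e: "\<And>l. exec m i (cfg l R M Y) = Some (cfg (Suc l) R' M' Y')"
      and Q: "Q R' M' Y' (f - 1)"
    using assms by (cases i) (auto simp: cfg_def set_reg_def split: option.splits)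
  have "(step m p ^^ 1) (cfg l R M Y) (cfg (Suc l) R' M' Y')"
    if "code_at p l [i]" for p l
    using e[of l] code_at_single[OF that]
    by (intro relpowp_single) (simp add: cfg_def step_def)
  then show ?thesis unfolding wp_def using Q
    by (intro exI[of _ 1] exI[of _ R'] exI[of _ M'] exI[of _ Y']) simp
qed

lemma wp_Block:
  assumes "block_wp m is Q R M Y f"
  shows "wp m (Block is) Q R M Y f"
  using assms
proof (induction "is" arbitrary: R M Y f)
  case Nil
  then show ?case unfolding wp_def
    by (intro exI[of _ 0] exI[of _ R] exI[of _ M] exI[of _ Y]) simp
next
  case (Cons i "is")
  then have "instr_wp m i (block_wp m is Q) R M Y f" by simp
  then have "wp m (Block [i]) (block_wp m is Q) R M Y f" by (rule wp_instr)
  then have "wp m (Block [i]) (wp m (Block is) Q) R M Y f"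
    by (rule wp_conseq) (rule Cons.IH)
  then have "wp m (Block [i] ;; Block is) Q R M Y f" by (rule wp_Seq)
  then show ?case by (simp add: wp_def)
qed

lemma step_jump:
  "code_at p l [Jump l'] \<Longrightarrow> step m p (cfg l R M Y) (cfg l' R M Y)"
  "code_at p l [JumpLe a b l'] \<Longrightarrow>
    step m p (cfg l R M Y) (cfg (if R a \<le> R b then l' else Suc l) R M Y)"
  by (drule code_at_single, simp add: step_def cfg_def)+

text \<open>The shifted postcondition of the second branch charges the jump that skips the code of
  the first one.\<close>

lemma wp_Cond:
  assumes "R a \<le> R b \<Longrightarrow> wp m c1 Q R M Y (f - 1)"
    and "R b < R a \<Longrightarrow> wp m c2 (\<lambda>R M Y f. Q R M Y (f - 1)) R M Y (f - 1)"
  shows "wp m (Cond a b c1 c2) Q R M Y f"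
proof (cases "R a \<le> R b")
  case True
  then obtain t R' M' Y' where 1: "\<And>p l. code_at p l (compile l c1) \<Longrightarrow>
       (step m p ^^ t) (cfg l R M Y) (cfg (l + len c1) R' M' Y')"
      and Q: "Q R' M' Y' (f - 1 - real t)"
    using assms(1) unfolding wp_def by blast
  have "(step m p ^^ (1 + t)) (cfg l R M Y) (cfg (l + len (Cond a b c1 c2)) R' M' Y')"
    if "code_at p l (compile l (Cond a b c1 c2))" for p l
  proof -
    have c: "code_at p l [JumpLe a b (l + len c2 + 2)]"
        "code_at p (l + len c2 + 2) (compile (l + len c2 + 2) c1)"
      using that by (auto simp: code_at_append code_at_Cons[of p _ "_" "_ @ _"]
        code_at_Cons[of p _ "_" "compile _ _"] add.assoc)
    have "(step m p ^^ 1) (cfg l R M Y) (cfg (l + len c2 + 2) R M Y)"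
      using relpowp_single[of "step m p", OF step_jump(2)[OF c(1), of m R M Y]] True by simp
    from relpowp_trans[OF this 1[OF c(2)]] show ?thesis
      by (simp add: add_ac)
  qed
  then show ?thesis using Q unfolding wp_def
    by (intro exI[of _ "1 + t"] exI[of _ R'] exI[of _ M'] exI[of _ Y'])
       (simp add: algebra_simps)
next
  case False
  then obtain t R' M' Y' where 1: "\<And>p l. code_at p l (compile l c2) \<Longrightarrow>
       (step m p ^^ t) (cfg l R M Y) (cfg (l + len c2) R' M' Y')"
      and Q: "Q R' M' Y' (f - 1 - real t - 1)"
    using assms(2) unfolding wp_def by force
  have "(step m p ^^ (1 + t + 1)) (cfg l R M Y) (cfg (l + len (Cond a b c1 c2)) R' M' Y')"
    if "code_at p l (compile l (Cond a b c1 c2))" for p l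
  proof -
    have c: "code_at p l [JumpLe a b (l + len c2 + 2)]"
        "code_at p (Suc l) (compile (Suc l) c2)"
        "code_at p (Suc l + len c2) [Jump (l + len c2 + 2 + len c1)]"
      using that by (auto simp: code_at_append code_at_Cons[of p _ "_" "_ @ _"]
        code_at_Cons[of p _ "_" "compile _ _"] add.assoc)
    have "(step m p ^^ 1) (cfg l R M Y) (cfg (Suc l) R M Y)"
      using relpowp_single[of "step m p", OF step_jump(2)[OF c(1), of m R M Y]] False by simp
    from relpowp_trans[OF relpowp_trans[OF this 1[OF c(2)]] relpowp_single[of "step m p", OF step_jump(1)[OF c(3)]]]
    show ?thesis by (simp add: add_ac)
  qed
  then show ?thesis using Q unfolding wp_def
    by (intro exI[of _ "1 + t + 1"] exI[of _ R'] exI[of _ M'] exI[of _ Y'])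
       (simp add: algebra_simps)
qed

text \<open>Induction on the integer part of the fuel. A full round burns at least two units, for
  the test and the jump back, and the invariant keeps the fuel nonnegative afterwards, so the
  integer part strictly decreases. No separate variant is required.\<close>

lemma wp_Loop:
  assumes "I R M Y f"
    and nonneg: "\<And>R M Y f. I R M Y f \<Longrightarrow> 0 \<le> f"
    and body: "\<And>R M Y f. I R M Y f \<Longrightarrow> wp m c1 (\<lambda>R M Y f.
      (R a \<le> R b \<longrightarrow> Q R M Y (f - 1)) \<and>
      (R b < R a \<longrightarrow> wp m c2 (\<lambda>R M Y f. I R M Y (f - 1)) R M Y (f - 1))) R M Y f"
  shows "wp m (Loop c1 a b c2) Q R M Y f"
  using assms(1)
proof (induction "nat \<lfloor>f\<rfloor>" arbitrary: R M Y f rule: less_induct)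
  case less
  obtain t1 R1 M1 Y1 where 1: "\<And>p l. code_at p l (compile l c1) \<Longrightarrow>
       (step m p ^^ t1) (cfg l R M Y) (cfg (l + len c1) R1 M1 Y1)"
      and exit: "R1 a \<le> R1 b \<Longrightarrow> Q R1 M1 Y1 (f - real t1 - 1)"
      and cont: "R1 b < R1 a \<Longrightarrow>
         wp m c2 (\<lambda>R M Y f. I R M Y (f - 1)) R1 M1 Y1 (f - real t1 - 1)"
    using body[OF less.prems] unfolding wp_def[of m c1] by blast
  let ?L = "Loop c1 a b c2"
  have codeE: "code_at p l (compile l c1)"
       "code_at p (l + len c1) [JumpLe a b (l + len c1 + len c2 + 2)]"
       "code_at p (Suc (l + len c1)) (compile (Suc (l + len c1)) c2)"
       "code_at p (Suc (l + len c1) + len c2) [Jump l]"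
    if "code_at p l (compile l ?L)" for p l
    using that by (auto simp: code_at_append code_at_Cons[of p _ "_" "_ @ _"]
        code_at_Cons[of p _ "_" "compile _ _"] add.assoc)
  show ?case
  proof (cases "R1 a \<le> R1 b")
    case True
    have "(step m p ^^ (t1 + 1)) (cfg l R M Y) (cfg (l + len ?L) R1 M1 Y1)"
      if "code_at p l (compile l ?L)" for p l
    proof -
      note c = codeE[OF that]
      have "(step m p ^^ 1) (cfg (l + len c1) R1 M1 Y1) (cfg (l + len c1 + len c2 + 2) R1 M1 Y1)"
        using relpowp_single[of "step m p", OF step_jump(2)[OF c(2), of m R1 M1 Y1]] True by simp
      from relpowp_trans[OF 1[OF c(1)] this] show ?thesis by (simp add: add_ac)
    qed
    then show ?thesis using exit[OF True] unfolding wp_def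
      by (intro exI[of _ "t1 + 1"] exI[of _ R1] exI[of _ M1] exI[of _ Y1])
         (simp add: algebra_simps)
  next
    case False
    then obtain t2 R2 M2 Y2 where 2: "\<And>p l. code_at p l (compile l c2) \<Longrightarrow>
         (step m p ^^ t2) (cfg l R1 M1 Y1) (cfg (l + len c2) R2 M2 Y2)"
        and I2: "I R2 M2 Y2 (f - real t1 - 1 - real t2 - 1)"
      using cont unfolding wp_def[of m c2] by force
    let ?f = "f - real t1 - 1 - real t2 - 1"
    have "0 \<le> ?f" by (rule nonneg[OF I2])
    then have "nat \<lfloor>?f\<rfloor> < nat \<lfloor>f\<rfloor>" by linarith
    from less.hyps[OF this I2] obtain t3 R3 M3 Y3 where
        3: "\<And>p l. code_at p l (compile l ?L) \<Longrightarrow>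
         (step m p ^^ t3) (cfg l R2 M2 Y2) (cfg (l + len ?L) R3 M3 Y3)"
        and Q: "Q R3 M3 Y3 (?f - real t3)"
      unfolding wp_def by blast
    have "(step m p ^^ (t1 + 1 + t2 + 1 + t3)) (cfg l R M Y) (cfg (l + len ?L) R3 M3 Y3)"
      if "code_at p l (compile l ?L)" for p l
    proof -
      note c = codeE[OF that]
      have "(step m p ^^ 1) (cfg (l + len c1) R1 M1 Y1) (cfg (Suc (l + len c1)) R1 M1 Y1)"
        using relpowp_single[of "step m p", OF step_jump(2)[OF c(2), of m R1 M1 Y1]] False by simp
      from relpowp_trans[OF relpowp_trans[OF relpowp_trans[OF relpowp_trans[OF 1[OF c(1)] this]
          2[OF c(3)]] relpowp_single[of "step m p", OF step_jump(1)[OF c(4)]]] 3[OF that]]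
      show ?thesis by (simp add: add_ac)
    qed
    moreover have "Q R3 M3 Y3 (f - real (t1 + 1 + t2 + 1 + t3))"
      using Q by (simp add: algebra_simps)
    ultimately show ?thesis unfolding wp_def by blast
  qed
qed

lemma address_of_nat [simp]: "address m (real i) = (if i < m then Some i else None)"
  by (simp add: address_def)

section \<open>Optimal clusterings of consecutive points\<close>

definition psum :: "(nat \<Rightarrow> real) \<Rightarrow> nat \<Rightarrow> real" where
  "psum x j = (\<Sum>i<j. x i)"

text \<open>The sum of squares minus the squared sum divided by the length. In this form two arrays
  of prefix sums give every block cost in constant time.\<close>

definition sse :: "(nat \<Rightarrow> real) \<Rightarrow> nat \<Rightarrow> nat \<Rightarrow> real" where
  "sse x a b = (if b \<le> a then 0 else
     psum (\<lambda>i. (x i)\<^sup>2) b - psum (\<lambda>i. (x i)\<^sup>2) a - (psum x b - psum x a)\<^sup>2 / (real b - real a))"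

lemma psum_diff: "a \<le> b \<Longrightarrow> psum x b - psum x a = sum x {a..<b}"
  unfolding psum_def by (simp add: lessThan_atLeast0 sum_diff_nat_ivl)

text \<open>Completing the square in \<mu>: the deviation from any \<mu> is the deviation from the
  mean plus a nonnegative bias term. Hence \<open>sse\<close> is the least cost of a block, attained
  at its mean.\<close>

lemma sum_square_dev:
  fixes x :: "nat \<Rightarrow> real"
  assumes "a < b"
  defines "s \<equiv> sum x {a..<b}" and "d \<equiv> real b - real a"
  shows "(\<Sum>i=a..<b. (x i - \<mu>)\<^sup>2) = sse x a b + (s - \<mu> * d)\<^sup>2 / d"
proof -
  have d: "d > 0" "d = real (b - a)" using assms(1) by (auto simp: d_def)
  have "(\<Sum>i=a..<b. (x i - \<mu>)\<^sup>2) = (\<Sum>i=a..<b. (x i)\<^sup>2 - 2 * \<mu> * x i + \<mu>\<^sup>2)"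
    by (rule sum.cong) (auto simp: power2_eq_square algebra_simps)
  also have "\<dots> = (\<Sum>i=a..<b. (x i)\<^sup>2) - 2 * \<mu> * s + \<mu>\<^sup>2 * d"
    by (simp add: sum.distrib sum_subtractf sum_distrib_left s_def d)
  also have "\<dots> = (\<Sum>i=a..<b. (x i)\<^sup>2) - s\<^sup>2 / d + (s - \<mu> * d)\<^sup>2 / d"
    using d(1) by (simp add: field_simps power2_eq_square)
  also have "(\<Sum>i=a..<b. (x i)\<^sup>2) - s\<^sup>2 / d = sse x a b"
    using assms(1) by (simp add: sse_def psum_diff s_def d_def)
  finally show ?thesis .
qed

lemma sse_le: "sse x a b \<le> (\<Sum>i=a..<b. (x i - \<mu>)\<^sup>2)"
proof (cases "a < b")
  case True
  then show ?thesis by (simp add: sum_square_dev)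
qed (simp add: sse_def)

lemma sse_mean:
  assumes "a < b"
  shows "sse x a b = (\<Sum>i=a..<b. (x i - (psum x b - psum x a) / (real b - real a))\<^sup>2)"
  using assms by (simp add: sum_square_dev psum_diff)

lemma sse_attained: "\<exists>\<mu>. sse x a b = (\<Sum>i=a..<b. (x i - \<mu>)\<^sup>2)"
proof (cases "a < b")
  case True
  then show ?thesis using sse_mean by blast
qed (simp add: sse_def)

lemma sse_empty [simp]: "b \<le> a \<Longrightarrow> sse x a b = 0"
  by (simp add: sse_def)

lemma sse_nonneg [simp]: "0 \<le> sse x a b"
  by (metis sse_attained sum_nonneg zero_le_power2)

lemma sse_mono:
  assumes "a' \<le> a" "b \<le> b'"
  shows "sse x a b \<le> sse x a' b'"
proof -
  obtain \<mu> where "sse x a' b' = (\<Sum>i=a'..<b'. (x i - \<mu>)\<^sup>2)" using sse_attained by blast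
  moreover have "sse x a b \<le> (\<Sum>i=a..<b. (x i - \<mu>)\<^sup>2)" by (rule sse_le)
  moreover have "\<dots> \<le> (\<Sum>i=a'..<b'. (x i - \<mu>)\<^sup>2)"
    using assms by (intro sum_mono2) auto
  ultimately show ?thesis by simp
qed

text \<open>An average lies between the extreme values, which in a sorted block are its end points.
  The exchange argument compares this mean with points outside the block.\<close>

lemma sse_attained_between:
  fixes x :: "nat \<Rightarrow> real"
  assumes "a < b" and x: "\<And>i j. i \<le> j \<Longrightarrow> j < n \<Longrightarrow> x i \<le> x j" and "b \<le> n"
  obtains \<mu> where "sse x a b = (\<Sum>i=a..<b. (x i - \<mu>)\<^sup>2)" "x a \<le> \<mu>" "\<mu> \<le> x (b - 1)"
proof
  let ?\<mu> = "(psum x b - psum x a) / (real b - real a)"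
  show "sse x a b = (\<Sum>i=a..<b. (x i - ?\<mu>)\<^sup>2)" using assms(1) by (rule sse_mean)
  have d: "real b - real a > 0" using assms(1) by simp
  have card: "real (card {a..<b}) = real b - real a" using assms(1) by simp
  have "(real b - real a) * x a \<le> sum x {a..<b}"
    unfolding card[symmetric] using assms(1,3) by (intro sum_bounded_below x) auto
  then show "x a \<le> ?\<mu>" using assms(1)
    by (simp add: psum_diff pos_le_divide_eq[OF d] mult.commute)
  have "sum x {a..<b} \<le> (real b - real a) * x (b - 1)"
    unfolding card[symmetric] using assms(1,3) by (intro sum_bounded_above x) auto
  then show "?\<mu> \<le> x (b - 1)" using assms(1)
    by (simp add: psum_diff pos_divide_le_eq[OF d] mult.commute)
qed

text \<open>Exchange argument: if \<open>\<mu>\<close> and \<open>\<nu>\<close> are the means of the outer and the inner block, the smaller of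
  the two serves the left and the larger one the right of the two overlapping blocks.\<close>

lemma sse_monge:
  fixes x :: "nat \<Rightarrow> real"
  assumes x: "\<And>i j. i \<le> j \<Longrightarrow> j < n \<Longrightarrow> x i \<le> x j"
    and "a \<le> a'" "b \<le> b'" "b' \<le> n"
  shows "sse x a b + sse x a' b' \<le> sse x a' b + sse x a b'"
proof -
  obtain \<mu> where \<mu>: "sse x a b' = (\<Sum>i=a..<b'. (x i - \<mu>)\<^sup>2)" using sse_attained by blast
  show ?thesis
  proof (cases "a' < b")
    case False
    have "(\<Sum>i=a..<b. (x i - \<mu>)\<^sup>2) + (\<Sum>i=a'..<b'. (x i - \<mu>)\<^sup>2)
        = (\<Sum>i\<in>{a..<b} \<union> {a'..<b'}. (x i - \<mu>)\<^sup>2)"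
      using False by (intro sum.union_disjoint[symmetric]) auto
    also have "\<dots> \<le> (\<Sum>i=a..<b'. (x i - \<mu>)\<^sup>2)"
      using assms by (intro sum_mono2) auto
    finally show ?thesis
      using sse_le[of x a b \<mu>] sse_le[of x a' b' \<mu>] \<mu> False by simp
  next
    case True
    have "b \<le> n" using assms by simp
    obtain \<nu> where \<nu>: "sse x a' b = (\<Sum>i=a'..<b. (x i - \<nu>)\<^sup>2)" "x a' \<le> \<nu>" "\<nu> \<le> x (b - 1)"
      by (rule sse_attained_between[OF True x \<open>b \<le> n\<close>])
    have split: "(\<Sum>i=l..<m. g i) + (\<Sum>i=m..<r. g i) = (\<Sum>i=l..<r. g i)"
      if "l \<le> m" "m \<le> r" for l m r and g :: "nat \<Rightarrow> real"
      using that by (rule sum.atLeastLessThan_concat)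
    show ?thesis
    proof (cases "\<mu> \<le> \<nu>")
      case le: True
      have "(x i - \<nu>)\<^sup>2 \<le> (x i - \<mu>)\<^sup>2" if "i \<in> {b..<b'}" for i
      proof -
        have "x (b - 1) \<le> x i" using that assms True by (intro x) auto
        then show ?thesis using \<nu> le by (intro power_mono) auto
      qed
      then have "(\<Sum>i=b..<b'. (x i - \<nu>)\<^sup>2) \<le> (\<Sum>i=b..<b'. (x i - \<mu>)\<^sup>2)"
        by (rule sum_mono)
      moreover have "sse x a b \<le> (\<Sum>i=a..<b. (x i - \<mu>)\<^sup>2)"
        "sse x a' b' \<le> (\<Sum>i=a'..<b'. (x i - \<nu>)\<^sup>2)" by (rule sse_le)+
      moreover note \<mu> \<nu>(1) split[of a b b' "\<lambda>i. (x i - \<mu>)\<^sup>2"] split[of a' b b' "\<lambda>i. (x i - \<nu>)\<^sup>2"]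
      ultimately show ?thesis using assms True by simp
    next
      case ge: False
      have "(x i - \<nu>)\<^sup>2 \<le> (x i - \<mu>)\<^sup>2" if "i \<in> {a..<a'}" for i
      proof -
        have "x i \<le> x a'" using that assms True by (intro x) auto
        then have "(\<nu> - x i)\<^sup>2 \<le> (\<mu> - x i)\<^sup>2" using \<nu> ge by (intro power_mono) auto
        then show ?thesis by (simp add: power2_commute)
      qed
      then have "(\<Sum>i=a..<a'. (x i - \<nu>)\<^sup>2) \<le> (\<Sum>i=a..<a'. (x i - \<mu>)\<^sup>2)"
        by (rule sum_mono)
      moreover have "sse x a b \<le> (\<Sum>i=a..<b. (x i - \<nu>)\<^sup>2)"
        "sse x a' b' \<le> (\<Sum>i=a'..<b'. (x i - \<mu>)\<^sup>2)" by (rule sse_le)+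
      moreover note \<mu> \<nu>(1) split[of a a' b' "\<lambda>i. (x i - \<mu>)\<^sup>2"] split[of a a' b "\<lambda>i. (x i - \<nu>)\<^sup>2"]
      ultimately show ?thesis using assms True by simp
    qed
  qed
qed

text \<open>\<open>opt x q a b\<close> is the least cost of \<open>q + 1\<close> (possibly empty) consecutive clusters covering
  \<open>x a, \<dots>, x (b - 1)\<close>.\<close>

fun opt :: "(nat \<Rightarrow> real) \<Rightarrow> nat \<Rightarrow> nat \<Rightarrow> nat \<Rightarrow> real" where
  "opt x 0 a b = sse x a b"
| "opt x (Suc q) a b = (MIN j\<in>{a..b}. opt x q a j + sse x j b)"

lemma opt_Suc_le: "a \<le> j \<Longrightarrow> j \<le> b \<Longrightarrow> opt x (Suc q) a b \<le> opt x q a j + sse x j b"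
  by (auto intro!: Min_le)

lemma opt_Suc_attained:
  assumes "a \<le> b"
  obtains j where "a \<le> j" "j \<le> b" "opt x (Suc q) a b = opt x q a j + sse x j b"
proof -
  have "opt x (Suc q) a b \<in> (\<lambda>j. opt x q a j + sse x j b) ` {a..b}"
    unfolding opt.simps using assms by (intro Min_in) auto
  then show ?thesis using that by auto
qed

lemma opt_nonneg: "a \<le> b \<Longrightarrow> 0 \<le> opt x q a b"
proof (induction q arbitrary: b)
  case (Suc q)
  obtain j where "a \<le> j" "j \<le> b" "opt x (Suc q) a b = opt x q a j + sse x j b"
    using opt_Suc_attained[OF Suc.prems] .
  then show ?case using Suc.IH[of j] by simp
qed simp

lemma opt_empty: "opt x q a a = 0"
  by (induction q) auto

text \<open>An optimal partition of the longer range is truncated: its last cluster shrinks, or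
  becomes empty if it starts after \<open>b\<close>, in which case the induction hypothesis
  truncates the rest.\<close>

lemma opt_mono: "a \<le> b \<Longrightarrow> b \<le> b' \<Longrightarrow> opt x q a b \<le> opt x q a b'"
proof (induction q arbitrary: b b')
  case 0
  then show ?case by (simp add: sse_mono)
next
  case (Suc q)
  then obtain j where j: "a \<le> j" "j \<le> b'" "opt x (Suc q) a b' = opt x q a j + sse x j b'"
    using opt_Suc_attained[of a b'] by (metis le_trans)
  show ?case
  proof (cases "j \<le> b")
    case True
    have "opt x (Suc q) a b \<le> opt x q a j + sse x j b" using j True by (intro opt_Suc_le)
    also have "\<dots> \<le> opt x (Suc q) a b'" using j Suc.prems sse_mono[of j j b b' x] by simp
    finally show ?thesis .
  next
    case False
    have "opt x (Suc q) a b \<le> opt x q a b + sse x b b" using Suc.prems by (intro opt_Suc_le) auto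
    also have "\<dots> \<le> opt x q a j" using Suc.IH[of b j] Suc.prems False by simp
    also have "\<dots> \<le> opt x (Suc q) a b'" using j by simp
    finally show ?thesis .
  qed
qed

text \<open>Since the index is one less than the number of clusters, p + 1 clusters followed by q +
  1 clusters have index p + q + 1.\<close>

lemma opt_concat:
  "a \<le> b \<Longrightarrow> b \<le> c \<Longrightarrow> opt x (Suc (p + q)) a c \<le> opt x p a b + opt x q b c"
proof (induction q arbitrary: c)
  case 0
  then show ?case using opt_Suc_le[of a b c x p] by simp
next
  case (Suc q)
  obtain j where j: "b \<le> j" "j \<le> c" "opt x (Suc q) b c = opt x q b j + sse x j c"
    using opt_Suc_attained[OF Suc.prems(2)] .
  have "opt x (Suc (p + Suc q)) a c \<le> opt x (Suc (p + q)) a j + sse x j c"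
    using opt_Suc_le[of a j c x "Suc (p + q)"] j Suc.prems by simp
  also have "\<dots> \<le> opt x p a b + opt x q b j + sse x j c" using Suc.IH[of j] Suc.prems j by simp
  finally show ?case using j by simp
qed

text \<open>The difference of the two squared distances is monotone in the position of the point.
  Hence the points that prefer the larger of two centroids are closed under moving to the
  right.\<close>

lemma closer_to_larger:
  fixes u v y z :: real
  assumes "u \<le> v" "y \<le> z" "(y - v)\<^sup>2 \<le> (y - u)\<^sup>2"
  shows "(z - v)\<^sup>2 \<le> (z - u)\<^sup>2"
proof -
  have "0 \<le> (z - y) * (v - u)" using assms by simp
  moreover have "(z - u)\<^sup>2 - (z - v)\<^sup>2 = (y - u)\<^sup>2 - (y - v)\<^sup>2 + 2 * ((z - y) * (v - u))"
    by (simp add: power2_eq_square algebra_simps)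
  ultimately show ?thesis using assms(3) by simp
qed

text \<open>This is where arbitrary centroids are reduced to consecutive blocks. The points that
  prefer the largest centroid form a suffix of the sorted sequence; that suffix becomes the last
  block, and the induction hypothesis treats the points before it with one centroid less.\<close>

lemma opt_le_cost:
  fixes x :: "nat \<Rightarrow> real"
  assumes "finite S" "S \<noteq> {}" "card S \<le> Suc q" "a \<le> b" "b \<le> n"
    and x: "\<And>i j. i \<le> j \<Longrightarrow> j < n \<Longrightarrow> x i \<le> x j"
  shows "opt x q a b \<le> (\<Sum>i=a..<b. MIN \<mu>\<in>S. (x i - \<mu>)\<^sup>2)"
  using assms(1-5)
proof (induction q arbitrary: S b)
  case 0
  then have "card S = 1" by (simp add: card_gt_0_iff le_Suc_eq)
  then obtain \<mu> where "S = {\<mu>}" by (auto simp: card_1_singleton_iff)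
  then show ?case using sse_le by simp
next
  case (Suc q)
  define v where "v = Max S"
  define S' where "S' = S - {v}"
  have v: "v \<in> S" "\<And>u. u \<in> S \<Longrightarrow> u \<le> v" using Suc.prems by (auto simp: v_def)
  have S: "S = insert v S'" "finite S'" "v \<notin> S'" using v Suc.prems by (auto simp: S'_def)
  have card: "card S' \<le> Suc q" using S Suc.prems by simp
  show ?case
  proof (cases "S' = {}")
    case True
    have "opt x (Suc q) a b \<le> opt x q a a + sse x a b" using Suc.prems by (intro opt_Suc_le) auto
    also have "\<dots> \<le> (\<Sum>i=a..<b. (x i - v)\<^sup>2)" using sse_le by (simp add: opt_empty)
    finally show ?thesis using S True by simp
  next
    case False
    define g where "g i = (MIN \<mu>\<in>S'. (x i - \<mu>)\<^sup>2)" for i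
    have Smin: "(MIN \<mu>\<in>S. (x i - \<mu>)\<^sup>2) = min ((x i - v)\<^sup>2) (g i)" for i
      unfolding S(1) g_def image_insert using S(2) False by (intro Min_insert) auto
    \<comment> \<open>The alternative \<open>j = b\<close> provides a least element even if no point
      prefers \<open>v\<close>; the last block is then empty.\<close>
    define P where "P j \<longleftrightarrow> a \<le> j \<and> (j = b \<or> (x j - v)\<^sup>2 \<le> g j)" for j
    define j where "j = (LEAST j. P j)"
    have "P b" using Suc.prems by (simp add: P_def)
    then have "P j" "j \<le> b" unfolding j_def by (rule LeastI, rule Least_le)
    then have j: "a \<le> j" "j \<le> b" "j = b \<or> (x j - v)\<^sup>2 \<le> g j" by (auto simp: P_def)
    have before: "g i < (x i - v)\<^sup>2" if "a \<le> i" "i < j" for i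
      using not_less_Least[of i P] that j unfolding j_def[symmetric] by (simp add: P_def not_le)
    have after: "(x i - v)\<^sup>2 \<le> g i" if i: "j \<le> i" "i < b" for i
    proof -
      have "(x j - v)\<^sup>2 \<le> g j" using j that by auto
      moreover have "g j \<le> (x j - u)\<^sup>2" if "u \<in> S'" for u
        unfolding g_def using that S(2) by (intro Min_le) auto
      ultimately have xj: "(x j - v)\<^sup>2 \<le> (x j - u)\<^sup>2" if "u \<in> S'" for u
        using that by (meson order_trans)
      have "x j \<le> x i" using i Suc.prems by (intro x) auto
      then have "(x i - v)\<^sup>2 \<le> (x i - u)\<^sup>2" if "u \<in> S'" for u
        using closer_to_larger[OF v(2) _ xj] that by (simp add: S'_def)
      then show ?thesis unfolding g_def using False S(2) by (auto simp: Min_ge_iff)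
    qed
    have "opt x (Suc q) a b \<le> opt x q a j + sse x j b" using j by (intro opt_Suc_le)
    also have "\<dots> \<le> (\<Sum>i=a..<j. g i) + (\<Sum>i=j..<b. (x i - v)\<^sup>2)"
      unfolding g_def using Suc.IH[of S' j] S False card j Suc.prems sse_le by (intro add_mono) auto
    also have "\<dots> = (\<Sum>i=a..<j. MIN \<mu>\<in>S. (x i - \<mu>)\<^sup>2) + (\<Sum>i=j..<b. MIN \<mu>\<in>S. (x i - \<mu>)\<^sup>2)"
      unfolding Smin using before after by (intro arg_cong2[of _ _ _ _ "(+)"] sum.cong) force+
    also have "\<dots> = (\<Sum>i=a..<b. MIN \<mu>\<in>S. (x i - \<mu>)\<^sup>2)"
      using j by (intro sum.atLeastLessThan_concat)
    finally show ?thesis .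
  qed
qed

text \<open>Row \<open>r\<close> stands for the first \<open>r\<close> points of the piece, column
  \<open>c\<close> for the start of the last cluster. Columns beyond \<open>r\<close> are allowed
  and have an empty last cluster, so the matrix is full. In the Monge inequality the
  \<open>opt\<close> terms depend on the column alone and cancel.\<close>

definition row_cost :: "(nat \<Rightarrow> real) \<Rightarrow> nat \<Rightarrow> nat \<Rightarrow> nat \<Rightarrow> nat \<Rightarrow> real" where
  "row_cost x q a r c = opt x q a (a + c) + sse x (a + c) (a + r)"

lemma row_cost_monge:
  assumes "\<And>i j. i \<le> j \<Longrightarrow> j < n \<Longrightarrow> x i \<le> x j" "r \<le> r'" "c \<le> c'" "a + r' \<le> n"
  shows "row_cost x q a r c + row_cost x q a r' c' \<le> row_cost x q a r c' + row_cost x q a r' c"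
  using sse_monge[of n x, OF assms(1), of "a + c" "a + c'" "a + r" "a + r'"] assms(2-4)
  by (simp add: row_cost_def)

lemma row_cost_0: "row_cost x q a 0 0 \<le> row_cost x q a 0 c"
  by (simp add: row_cost_def opt_empty opt_nonneg)

text \<open>A minimiser beyond the diagonal costs \<open>opt x q\<close> of a longer prefix, which
  by monotonicity is no cheaper than the diagonal entry. Cutting it down to \<open>m\<close> is
  therefore harmless.\<close>

lemma opt_Suc_row_min:
  assumes "\<And>c. c \<le> N \<Longrightarrow> row_cost x q a m t \<le> row_cost x q a m c" "m \<le> N"
  shows "opt x (Suc q) a (a + m) = row_cost x q a m (min t m)"
proof (rule antisym)
  show "opt x (Suc q) a (a + m) \<le> row_cost x q a m (min t m)"
    using opt_Suc_le[of a "a + min t m" "a + m" x q] by (simp add: row_cost_def)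
  obtain j where j: "a \<le> j" "j \<le> a + m"
      "opt x (Suc q) a (a + m) = opt x q a j + sse x j (a + m)"
    using opt_Suc_attained[of a "a + m"] by auto
  have "row_cost x q a m (min t m) \<le> row_cost x q a m t"
    using opt_mono[of a "a + m" "a + t" x q] by (auto simp: row_cost_def min_def)
  also have "\<dots> \<le> row_cost x q a m (j - a)" using assms j by (intro assms(1)) auto
  finally show "row_cost x q a m (min t m) \<le> opt x (Suc q) a (a + m)"
    using j by (simp add: row_cost_def)
qed

declare opt.simps(2) [simp del]

section \<open>Memory layout and cost evaluation\<close>

lemma address_add [simp]:
  "address m (real i + real j) = (if i + j < m then Some (i + j) else None)"
  "address m (real i + real j + real k) = (if i + j + k < m then Some (i + j + k) else None)"
  "address m (real i + 1) = (if Suc i < m then Some (Suc i) else None)"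
  "address m (1 + real i) = (if Suc i < m then Some (Suc i) else None)"
  using address_of_nat[of m "i + j"] address_of_nat[of m "i + j + k"] address_of_nat[of m "Suc i"]
  by (simp_all add: add.commute)

lemma address_0 [simp]: "address m 0 = (if 0 < m then Some 0 else None)"
  using address_of_nat[of m 0] by simp

text \<open>
  Registers: 0 and 1 hold \<open>n\<close> and \<open>k\<close>, 2 and 3 the constants 1 and 0, 4 to 9 base addresses;
  10 and 11 the stack pointer and the stack base, 12 the number of clusters in use;
  15, 16, 17 the start, the number of clusters and the end of the current piece, 18 and 19 its length
  \<open>N\<close> and \<open>N + 1\<close>, 20 and 21 the addresses of the prefix sums at its start; 22 the layer of the cut,
  23 the current layer, 24 the last layer plus 1, 25 the position of the cut; 30 and 31 the strides
  \<open>2 \<sigma>\<close> and \<open>\<sigma>\<close>, 32 and 33 the bounds of the current column list. Registers from 40 on are scratch,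
  those from 50 on belong to the evaluation of matrix entries, whose result is in 50. Code run inside
  a loop thus only writes registers with higher numbers than those of the loop.
\<close>

definition sse_code :: "reg \<Rightarrow> reg \<Rightarrow> com" where
  "sse_code r c = Cond r c
     (Block [Const 50 0])
     (Block [Add 51 20 r, Load 51 51, Add 52 20 c, Load 52 52, Sub 51 51 52, Mul 51 51 51,
       Sub 52 r c, Div 51 51 52, Add 52 21 r, Load 52 52, Add 53 21 c, Load 53 53, Sub 52 52 53,
       Sub 50 52 51])"

definition row_code :: "reg \<Rightarrow> reg \<Rightarrow> com" where
  "row_code r c = sse_code r c ;; Block [Add 51 6 c, Load 51 51, Add 50 51 50]"

text \<open>
  The memory holds the points at 0, their prefix sums at \<open>W\<close>, those of the squares at \<open>bQ\<close>, the
  current layer of the dynamic program at \<open>bP\<close>, the crossing positions at \<open>bH\<close>, the row minima at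
  \<open>bT\<close>, the stack at \<open>bK\<close> (cluster numbers) and \<open>bK + W\<close> (ends), and the column lists from \<open>bC\<close> on.
\<close>

locale kmeans_ram =
  fixes x :: "nat \<Rightarrow> real" and n W bQ bP bH bT bK bC m :: nat
  assumes sorted: "\<And>i j. i \<le> j \<Longrightarrow> j < n \<Longrightarrow> x i \<le> x j"
    and layout: "n < W" "W + W \<le> bQ" "bQ + W \<le> bP" "bP + W \<le> bH" "bH + W \<le> bT"
      "bT + W \<le> bK" "bK + 2 * W \<le> bC" "bC + 5 * W \<le> m"
begin

definition glob :: "(reg \<Rightarrow> real) \<Rightarrow> (nat \<Rightarrow> real) \<Rightarrow> bool" where
  "glob R M \<longleftrightarrow> R 0 = real n \<and> R 2 = 1 \<and> R 3 = 0 \<and> R 4 = real W \<and> R 5 = real bQ \<and>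
    R 6 = real bP \<and> R 7 = real bH \<and> R 8 = real bT \<and> R 9 = real bC \<and>
    (\<forall>j<n. M j = x j) \<and> (\<forall>j\<le>n. M (W + j) = psum x j) \<and>
    (\<forall>j\<le>n. M (bQ + j) = psum (\<lambda>i. (x i)\<^sup>2) j)"

definition seg :: "nat \<Rightarrow> nat \<Rightarrow> (reg \<Rightarrow> real) \<Rightarrow> bool" where
  "seg a N R \<longleftrightarrow> R 18 = real N \<and> R 19 = real N + 1 \<and> R 20 = real W + real a \<and>
    R 21 = real bQ + real a \<and> a + N \<le> n"

definition dp :: "nat \<Rightarrow> nat \<Rightarrow> nat \<Rightarrow> (nat \<Rightarrow> real) \<Rightarrow> bool" where
  "dp q a N M \<longleftrightarrow> (\<forall>j\<le>N. M (bP + j) = opt x q a (a + j))"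

lemma glob_frame:
  assumes "glob R M" "\<forall>r<10. R' r = R r" "\<forall>i<bP. M' i = M i"
  shows "glob R' M'"
  using assms layout unfolding glob_def by auto

lemma seg_frame: "seg a N R \<Longrightarrow> \<forall>r<22. R' r = R r \<Longrightarrow> seg a N R'"
  unfolding seg_def by auto

text \<open>The bound of 16 units is the cost of the nonempty case: the test, fourteen instructions
  and the closing jump. The remaining fuel is bounded only from below because the two branches
  differ in length.\<close>

lemma wp_sse_code:
  assumes "glob R M" "seg a N R" "R rr = real r" "R rc = real c" "r \<le> N" "c \<le> N" "rr < 50" "rc < 50"
    and Q: "\<And>R' f'. \<forall>i<50. R' i = R i \<Longrightarrow> R' 50 = sse x (a + c) (a + r) \<Longrightarrow> f' \<ge> f - 16 \<Longrightarrow>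
      Q R' M Y f'"
  shows "wp m (sse_code rr rc) Q R M Y f"
proof -
  have ne: "rr \<noteq> 51" "rr \<noteq> 52" "rr \<noteq> 53" "rc \<noteq> 51" "rc \<noteq> 52" "rc \<noteq> 53" using assms by auto
  have bnd: "W + a + r < m" "W + a + c < m" "bQ + a + r < m" "bQ + a + c < m"
      "a + r \<le> n" "a + c \<le> n"
    using assms(2,5,6) layout by (auto simp: seg_def)
  note g = assms(1)[unfolded glob_def] and s = assms(2)[unfolded seg_def]
  show ?thesis unfolding sse_code_def
  proof (rule wp_Cond, goal_cases)
    case 1
    then show ?case using assms(3,4)
      by (intro wp_Block) (auto intro!: Q)
  next
    case 2
    then have "real r \<noteq> real c" "c < r" using assms(3,4) by auto
    moreover have "M (W + a + r) = psum x (a + r)" "M (W + a + c) = psum x (a + c)"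
        "M (bQ + a + r) = psum (\<lambda>i. (x i)\<^sup>2) (a + r)"
        "M (bQ + a + c) = psum (\<lambda>i. (x i)\<^sup>2) (a + c)"
      using g bnd(5,6) by (auto simp: add.assoc)
    ultimately show ?case using assms(3,4) ne bnd s
      by (intro wp_Block) (auto intro!: Q simp: sse_def power2_eq_square)
  qed
qed

lemma wp_row_code:
  assumes "glob R M" "seg a N R" "M (bP + c) = opt x q a (a + c)" "R rr = real r" "R rc = real c" "r \<le> N" "c \<le> N"
    "rr < 50" "rc < 50"
    and Q: "\<And>R' f'. \<forall>i<50. R' i = R i \<Longrightarrow> R' 50 = row_cost x q a r c \<Longrightarrow> f' \<ge> f - 19 \<Longrightarrow>
      Q R' M Y f'"
  shows "wp m (row_code rr rc) Q R M Y f"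
  unfolding row_code_def
proof (intro wp_Seq, rule wp_sse_code[OF assms(1,2,4-9)], rule wp_Block, goal_cases)
  case (1 R' f')
  have "R' 6 = real bP" "R' rc = real c" "bP + c < m" "M (bP + c) = opt x q a (a + c)" "rc \<noteq> 51"
    using assms(1-9) 1(1) layout by (auto simp: glob_def seg_def)
  then show ?case using 1 by (auto intro!: Q simp: row_cost_def)
qed

end

section \<open>Row minima of Monge matrices\<close>

locale monge =
  fixes A :: "nat \<Rightarrow> nat \<Rightarrow> real" and N :: nat
  assumes monge: "r \<le> r' \<Longrightarrow> c \<le> c' \<Longrightarrow> r' \<le> N \<Longrightarrow> A r c + A r' c' \<le> A r c' + A r' c"
    and first_row: "A 0 0 \<le> A 0 c"
begin

text \<open>Domination row by row, instead of the preservation of particular minimisers: it is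
  insensitive to ties, it is transitive, so that successive reductions compose, and it passes to
  coarser strides.\<close>

definition covers :: "nat \<Rightarrow> nat set \<Rightarrow> nat set \<Rightarrow> bool" where
  "covers \<sigma> C S \<longleftrightarrow> (\<forall>c\<in>C. \<forall>u. u * \<sigma> \<le> N \<longrightarrow> (\<exists>s\<in>S. A (u * \<sigma>) s \<le> A (u * \<sigma>) c))"

text \<open>The invariant of the column reduction of SMAWK. Entry \<open>t\<close> is tied to row
  \<open>t * \<sigma>\<close>, where it is no worse than its successor; thus there are never more
  entries than rows of this stride.\<close>

definition stack_ok :: "nat \<Rightarrow> nat list \<Rightarrow> bool" where
  "stack_ok \<sigma> st \<longleftrightarrow> st \<noteq> [] \<and> hd st = 0 \<and> sorted_wrt (<) st \<and> (length st - 1) * \<sigma> \<le> N \<and>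
    (\<forall>t. Suc t < length st \<longrightarrow> A (t * \<sigma>) (st ! t) \<le> A (t * \<sigma>) (st ! Suc t))"

lemma stack_okD:
  assumes "stack_ok \<sigma> st"
  shows "st \<noteq> []" "hd st = 0" "st ! 0 = 0" "sorted_wrt (<) st" "(length st - 1) * \<sigma> \<le> N"
    "\<And>t. Suc t < length st \<Longrightarrow> A (t * \<sigma>) (st ! t) \<le> A (t * \<sigma>) (st ! Suc t)"
proof -
  note st = assms[unfolded stack_ok_def]
  show "st \<noteq> []" "hd st = 0" "sorted_wrt (<) st" "(length st - 1) * \<sigma> \<le> N" using st by blast+
  then show "st ! 0 = 0" using hd_conv_nth[of st] by argo
  show "A (t * \<sigma>) (st ! t) \<le> A (t * \<sigma>) (st ! Suc t)" if "Suc t < length st" for t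
    using st that by blast
qed

lemma covers_mono: "covers \<sigma> C S \<Longrightarrow> S \<subseteq> S' \<Longrightarrow> covers \<sigma> C S'"
  unfolding covers_def by blast

lemma covers_double:
  assumes "covers \<sigma> C S"
  shows "covers (2 * \<sigma>) C S"
  unfolding covers_def mult.assoc[symmetric] using assms[unfolded covers_def] by blast

lemma covers_trans: "covers \<sigma> C S \<Longrightarrow> covers \<sigma> S S' \<Longrightarrow> covers \<sigma> C S'"
  unfolding covers_def by (meson order_trans)

text \<open>The popped column is beaten by \<open>c\<close> from row \<open>h * \<sigma>\<close> on and by the entry below it in the rows
  before. Column 0 is never popped, since it is optimal in row 0.\<close>

lemma stack_pop:
  assumes st: "stack_ok \<sigma> st" and cov: "covers \<sigma> C (insert c (set st))"
    and c: "\<forall>s\<in>set st. s < c"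
    and len: "length st = Suc h" and less: "A (h * \<sigma>) c < A (h * \<sigma>) (st ! h)"
  obtains h' where "h = Suc h'" "stack_ok \<sigma> (take h st)" "covers \<sigma> C (insert c (set (take h st)))"
proof -
  note st' = stack_okD[OF st]
  have hN: "h * \<sigma> \<le> N" using st'(5) len by simp
  have "h \<noteq> 0"
  proof
    assume h: "h = 0"
    show False using less first_row[of c] st'(3) unfolding h by simp
  qed
  then obtain h' where h: "h = Suc h'" by (cases h) auto
  have st_take: "st = take h st @ [st ! h]"
    using take_Suc_conv_app_nth[of h st] len by simp
  have set_st: "set st = insert (st ! h) (set (take h st))"
    by (subst st_take) simp
  have lt: "st ! h' < st ! h" "st ! h < c"
    using sorted_wrt_nth_less[OF st'(4), of h' h] len h c by auto
  have "stack_ok \<sigma> (take h st)"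
    unfolding stack_ok_def
  proof (intro conjI allI impI)
    show "take h st \<noteq> []" using len h by auto
    show "hd (take h st) = 0" using st'(2) h by simp
    show "sorted_wrt (<) (take h st)" using st'(4) by (rule sorted_wrt_take)
    show "(length (take h st) - 1) * \<sigma> \<le> N" using hN h len by simp
    fix t assume "Suc t < length (take h st)"
    then show "A (t * \<sigma>) (take h st ! t) \<le> A (t * \<sigma>) (take h st ! Suc t)"
      using st'(6)[of t] by simp
  qed
  moreover have "\<exists>s\<in>insert c (set (take h st)). A (u * \<sigma>) s \<le> A (u * \<sigma>) (st ! h)"
    if u: "u * \<sigma> \<le> N" for u
  proof (cases "h \<le> u")
    case True
    then have "h * \<sigma> \<le> u * \<sigma>" by simp
    then have "A (u * \<sigma>) c \<le> A (u * \<sigma>) (st ! h)"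
      using monge[of "h * \<sigma>" "u * \<sigma>" "st ! h" c] u less lt by simp
    then show ?thesis by blast
  next
    case False
    then have "u * \<sigma> \<le> h' * \<sigma>" using h by (intro mult_right_mono) auto
    moreover have "A (h' * \<sigma>) (st ! h') \<le> A (h' * \<sigma>) (st ! h)"
      using st'(6)[of h'] len h by simp
    moreover have "h' * \<sigma> \<le> N" using hN h by simp
    ultimately have "A (u * \<sigma>) (st ! h') \<le> A (u * \<sigma>) (st ! h)"
      using monge[of "u * \<sigma>" "h' * \<sigma>" "st ! h'" "st ! h"] lt by simp
    moreover have "st ! h' \<in> set (take h st)" using h len by (auto simp: in_set_conv_nth)
    ultimately show ?thesis by blast
  qed
  then have "covers \<sigma> (insert c (set st)) (insert c (set (take h st)))"
    unfolding covers_def set_st by blast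
  then have "covers \<sigma> C (insert c (set (take h st)))" by (rule covers_trans[OF cov])
  ultimately show ?thesis using that h by blast
qed

text \<open>The top wins in its own row, but the new column may still win further down. It is
  therefore kept and tied to the next row, which must exist.\<close>

lemma stack_push:
  assumes st: "stack_ok \<sigma> st" and cov: "covers \<sigma> C (insert c (set st))"
    and c: "\<forall>s\<in>set st. s < c"
    and len: "length st = Suc h" and le: "A (h * \<sigma>) (st ! h) \<le> A (h * \<sigma>) c"
    and room: "h * \<sigma> + \<sigma> \<le> N"
  shows "stack_ok \<sigma> (st @ [c])" "covers \<sigma> (insert c C) (set (st @ [c]))"
proof -
  have "A (t * \<sigma>) ((st @ [c]) ! t) \<le> A (t * \<sigma>) ((st @ [c]) ! Suc t)"
    if "Suc t < length (st @ [c])" for t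
  proof (cases "t = h")
    case True
    then show ?thesis using le len by (simp add: nth_append)
  next
    case False
    then show ?thesis using that stack_okD(6)[OF st, of t] len by (simp add: nth_append)
  qed
  then show "stack_ok \<sigma> (st @ [c])"
    using st c len room by (auto simp: stack_ok_def sorted_wrt_append)
  show "covers \<sigma> (insert c C) (set (st @ [c]))"
    using cov by (auto simp: covers_def)
qed

lemma stack_skip:
  assumes st: "stack_ok \<sigma> st" and cov: "covers \<sigma> C (insert c (set st))"
    and c: "\<forall>s\<in>set st. s < c"
    and len: "length st = Suc h" and le: "A (h * \<sigma>) (st ! h) \<le> A (h * \<sigma>) c"
    and full: "N < h * \<sigma> + \<sigma>"
  shows "covers \<sigma> (insert c C) (set st)"
proof -
  have hN: "h * \<sigma> \<le> N" using stack_okD(5)[OF st] len by simp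
  have in_st: "st ! h \<in> set st" using len by simp
  have "A (u * \<sigma>) (st ! h) \<le> A (u * \<sigma>) c" if u: "u * \<sigma> \<le> N" for u
  proof -
    have "u * \<sigma> < Suc h * \<sigma>" using u full by simp
    then have "u \<le> h" by (metis less_Suc_eq_le mult_less_cancel2)
    then have "u * \<sigma> \<le> h * \<sigma>" by simp
    then show ?thesis
      using monge[of "u * \<sigma>" "h * \<sigma>" "st ! h" c] hN le bspec[OF c in_st] by simp
  qed
  then have "covers \<sigma> (insert c (set st)) (set st)" "covers \<sigma> {c} (set st)"
    using in_st unfolding covers_def by blast+
  then show ?thesis using covers_trans[OF cov] unfolding covers_def by blast
qed

definition row_min :: "nat \<Rightarrow> nat \<Rightarrow> bool" where
  "row_min r t \<longleftrightarrow> t \<le> N \<and> (\<forall>c\<le>N. A r t \<le> A r c)"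

text \<open>The Monge inequality lets the minimisers of the two neighbouring rows bracket the
  search: to the left of \<open>t1\<close> nothing beats \<open>t1\<close>, and to the right of
  \<open>t2\<close> nothing beats \<open>t2\<close>. If there is no row below, \<open>t2 = N\<close>
  imposes no restriction.\<close>

lemma row_min_between:
  assumes cov: "covers \<sigma> {..N} (set cs)" and cs: "set cs \<subseteq> {..N}"
    and lo: "row_min (u * \<sigma>) t1" "t1 \<in> set cs"
    and hi: "Suc (Suc u) * \<sigma> \<le> N \<Longrightarrow> row_min (Suc (Suc u) * \<sigma>) t2 \<and> t2 \<in> set cs"
      "N < Suc (Suc u) * \<sigma> \<Longrightarrow> t2 = N"
    and t: "t1 \<le> t2" and r: "Suc u * \<sigma> \<le> N"
    and b: "b \<in> set cs" "\<And>s. s \<in> set cs \<Longrightarrow> t1 \<le> s \<Longrightarrow> s \<le> t2 \<Longrightarrow> A (Suc u * \<sigma>) b \<le> A (Suc u * \<sigma>) s"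
  shows "row_min (Suc u * \<sigma>) b"
proof -
  let ?r = "Suc u * \<sigma>"
  have best: "A ?r b \<le> A ?r s" if s: "s \<in> set cs" for s
  proof (cases "s < t1")
    case True
    have "A (u * \<sigma>) t1 \<le> A (u * \<sigma>) s" using lo(1) s cs by (auto simp: row_min_def)
    then have "A ?r t1 \<le> A ?r s" using monge[of "u * \<sigma>" ?r s t1] r True by simp
    then show ?thesis using b(2)[OF lo(2)] t by simp
  next
    case ge: False
    show ?thesis
    proof (cases "s \<le> t2")
      case True
      then show ?thesis using b(2)[OF s] ge by simp
    next
      case False
      then have r2: "Suc (Suc u) * \<sigma> \<le> N" using hi(2) s cs by (metis atMost_iff not_le subsetD)
      note m = hi(1)[OF this]
      have "A (Suc (Suc u) * \<sigma>) t2 \<le> A (Suc (Suc u) * \<sigma>) s"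
        using m s cs by (auto simp: row_min_def)
      then have "A ?r t2 \<le> A ?r s"
        using monge[of ?r "Suc (Suc u) * \<sigma>" t2 s] r2 False by simp
      then show ?thesis using b(2)[of t2] m t by simp
    qed
  qed
  have "A ?r b \<le> A ?r c" if c: "c \<le> N" for c
  proof -
    obtain s where s: "s \<in> set cs" "A ?r s \<le> A ?r c"
      using cov c r unfolding covers_def by blast
    then show ?thesis using best[OF s(1)] by simp
  qed
  then show ?thesis using b(1) cs by (auto simp: row_min_def)
qed

end

section \<open>Column reduction on the machine\<close>

definition arr :: "(nat \<Rightarrow> real) \<Rightarrow> nat \<Rightarrow> nat list \<Rightarrow> bool" where
  "arr M b cs \<longleftrightarrow> (\<forall>i<length cs. M (b + i) = real (cs ! i))"

lemma arr_take: "arr M b cs \<Longrightarrow> arr M b (take h cs)"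
  by (auto simp: arr_def)

lemma arr_append1: "arr M b cs \<Longrightarrow> arr (M(b + length cs := real c)) b (cs @ [c])"
  by (auto simp: arr_def nth_append)

lemma arr_frame: "arr M b cs \<Longrightarrow> \<forall>i. b \<le> i \<and> i < b + length cs \<longrightarrow> M' i = M i \<Longrightarrow> arr M' b cs"
  by (auto simp: arr_def)

text \<open>Register 41 holds the address of the stack top, 42 the row tied to it, 43 the column to
  be inserted.\<close>

definition pop_code :: com where
  "pop_code = Loop
     (Block [Load 48 41] ;; row_code 42 48 ;; Block [Move 47 50] ;; row_code 42 43) 47 50
     (Block [Sub 41 41 2, Sub 42 42 31])"

locale kmeans_seg = kmeans_ram +
  fixes q a N :: nat
  assumes aN: "a + N \<le> n"
begin

sublocale monge "row_cost x q a" N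
proof
  fix r r' c c' :: nat
  assume "r \<le> r'" "c \<le> c'" "r' \<le> N"
  with aN have "a + r' \<le> n" by simp
  with row_cost_monge[of n x, OF sorted \<open>r \<le> r'\<close> \<open>c \<le> c'\<close>]
  show "row_cost x q a r c + row_cost x q a r' c' \<le> row_cost x q a r c' + row_cost x q a r' c"
    by blast
qed (rule row_cost_0)

abbreviation A :: "nat \<Rightarrow> nat \<Rightarrow> real" where "A \<equiv> row_cost x q a"

definition ok :: "(reg \<Rightarrow> real) \<Rightarrow> (nat \<Rightarrow> real) \<Rightarrow> bool" where
  "ok R M \<longleftrightarrow> glob R M \<and> seg a N R \<and> dp q a N M"

lemma ok_frame:
  assumes "ok R M" "\<forall>r<22. R' r = R r" "\<forall>i<bH. M' i = M i"
  shows "ok R' M'"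
proof -
  have ok: "glob R M" "seg a N R" "dp q a N M" using assms(1) by (simp_all add: ok_def)
  have M': "M' i = M i" if "i < bP + W" for i
    using assms(3) layout(4) that by (meson less_le_trans)
  have "glob R' M'" using assms(2) M' by (intro glob_frame[OF ok(1)]) auto
  moreover have "seg a N R'" using assms(2) by (rule seg_frame[OF ok(2)])
  moreover have "bP + j < bP + W" if "j \<le> N" for j using layout(1) aN that by linarith
  then have "dp q a N M'" using ok(3) M' unfolding dp_def by metis
  ultimately show ?thesis by (simp add: ok_def)
qed

lemma wp_row:
  assumes "ok R M" "R rr = real r" "R rc = real c" "r \<le> N" "c \<le> N" "rr < 50" "rc < 50"
    and Q: "\<And>R' f'. \<forall>i<50. R' i = R i \<Longrightarrow> R' 50 = A r c \<Longrightarrow> f' \<ge> f - 19 \<Longrightarrow> Q R' M Y f'"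
  shows "wp m (row_code rr rc) Q R M Y f"
proof -
  have "glob R M" "seg a N R" "M (bP + c) = opt x q a (a + c)"
    using assms(1,5) by (simp_all add: ok_def dp_def)
  then show ?thesis by (rule wp_row_code[OF _ _ _ assms(2-7)]) (rule Q)
qed

end

context kmeans_seg begin

text \<open>One round takes 44 units: two matrix entries of 19 each, a load, a move, the test, two
  subtractions and the jump back. The factor \<open>Suc h - h'\<close> counts the removed entries
  and the final comparison, which removes nothing.\<close>

lemma wp_pop:
  assumes ok: "ok R M" and st: "stack_ok \<sigma> st" "covers \<sigma> C (insert c (set st))"
      "\<forall>s\<in>set st. s < c" "c \<le> N" "arr M b st" "b + length st \<le> m"
    and len: "length st = Suc h"
    and R: "R 41 = real b + real h" "R 42 = real (h * \<sigma>)" "R 43 = real c" "R 31 = real \<sigma>" "R 2 = 1"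
    and f: "f \<ge> 44 * real (Suc h)"
    and Q: "\<And>R' f' h'. h' \<le> h \<Longrightarrow> stack_ok \<sigma> (take (Suc h') st) \<Longrightarrow>
      covers \<sigma> C (insert c (set (take (Suc h') st))) \<Longrightarrow> A (h' * \<sigma>) (st ! h') \<le> A (h' * \<sigma>) c \<Longrightarrow>
      \<forall>r<41. R' r = R r \<Longrightarrow> R' 41 = real b + real h' \<Longrightarrow> R' 42 = real (h' * \<sigma>) \<Longrightarrow>
      R' 43 = real c \<Longrightarrow> f' \<ge> f - 44 * real (Suc h - h') \<Longrightarrow> Q R' M Y f'"
  shows "wp m pop_code Q R M Y f"
proof -
  define I where "I = (\<lambda>R' M' Y' f'. M' = M \<and> Y' = Y \<and> (\<exists>h'\<le>h. stack_ok \<sigma> (take (Suc h') st) \<and>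
      covers \<sigma> C (insert c (set (take (Suc h') st))) \<and>
      (\<forall>r<41. R' r = R r) \<and> R' 41 = real b + real h' \<and> R' 42 = real (h' * \<sigma>) \<and> R' 43 = real c \<and>
      f' \<ge> f - 44 * real (h - h')))"
  show ?thesis unfolding pop_code_def
  proof (rule wp_Loop[where I = I])
    show "I R M Y f" unfolding I_def using st len R by auto
    fix R' M' Y' f' assume I: "I R' M' Y' f'"
    then obtain h' where h': "M' = M" "Y' = Y" "h' \<le> h" "stack_ok \<sigma> (take (Suc h') st)"
        "covers \<sigma> C (insert c (set (take (Suc h') st)))"
        "\<forall>r<41. R' r = R r" "R' 41 = real b + real h'" "R' 42 = real (h' * \<sigma>)" "R' 43 = real c"
        "f' \<ge> f - 44 * real (h - h')"
      unfolding I_def by blast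
    show "0 \<le> f'" using h'(3,10) f by (simp add: of_nat_diff)
    have top: "M (b + h') = real (st ! h')" "b + h' < m" "st ! h' \<le> N" "h' * \<sigma> \<le> N" "st ! h' < c"
        "length (take (Suc h') st) = Suc h'" "take (Suc h') st ! h' = st ! h'"
    proof -
      show c: "st ! h' < c" using st(3) h'(3) len by simp
      show "st ! h' \<le> N" using c st(4) by simp
      show "h' * \<sigma> \<le> N" using stack_okD(5)[OF h'(4)] h'(3) len by simp
    qed (use st(5,6) len h'(3) in \<open>auto simp: arr_def\<close>)
    show "wp m (Block [Load 48 41] ;; row_code 42 48 ;; Block [Move 47 50] ;; row_code 42 43)
       (\<lambda>R M Y f. (R 47 \<le> R 50 \<longrightarrow> Q R M Y (f - 1)) \<and>
          (R 50 < R 47 \<longrightarrow> wp m (Block [Sub 41 41 2, Sub 42 42 31]) (\<lambda>R M Y f. I R M Y (f - 1)) R M Y (f - 1)))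
       R' M' Y' f'"
    proof (rule wp_Seq, rule wp_Block, simp add: h'(1,2,7) top, rule wp_Seq,
        rule wp_row[where r = "h' * \<sigma>" and c = "st ! h'"], goal_cases)
      case 1 show ?case by (rule ok_frame[OF ok]) (use h'(6) in auto)
    next
      case 2 show ?case using h'(8) by simp
    next
      case 3 show ?case by simp
    next
      case (8 R1 f1)
      have R1: "\<forall>r<41. R1 r = R r" "R1 41 = real b + real h'" "R1 42 = real (h' * \<sigma>)" "R1 43 = real c"
        using 8(1) h'(6-9) by auto
      show ?case
      proof (rule wp_Seq, rule wp_Block, simp, rule wp_row[where r = "h' * \<sigma>" and c = c], goal_cases)
        case 1 show ?case by (rule ok_frame[OF ok]) (use R1 in auto)
      next
        case 2 show ?case using R1(3) by simp
      next
        case 3 show ?case using R1(4) by simp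
      next
        case (8 R2 f2)
        have R2: "\<forall>r<41. R2 r = R r" "R2 41 = real b + real h'" "R2 42 = real (h' * \<sigma>)" "R2 43 = real c"
            "R2 47 = A (h' * \<sigma>) (st ! h')" "R2 50 = A (h' * \<sigma>) c"
          using 8(1,2) R1 \<open>R1 50 = _\<close> by auto
        have f2: "f2 \<ge> f' - 40" using 8(3) \<open>f1 \<ge> _\<close> by simp
        show ?case
        proof (intro conjI impI)
          assume "R2 47 \<le> R2 50"
          moreover have "f2 - 1 \<ge> f - 44 * real (Suc h - h')"
            using f2 h'(3,10) by (simp add: Suc_diff_le)
          ultimately show "Q R2 M Y (f2 - 1)" using h' R2 by (intro Q) auto
        next
          assume less: "R2 50 < R2 47"
          obtain g where g: "h' = Suc g" "stack_ok \<sigma> (take h' (take (Suc h') st))"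
              "covers \<sigma> C (insert c (set (take h' (take (Suc h') st))))"
            using stack_pop[OF h'(4,5), of h'] less R2 st(3) top by (metis in_set_takeD)
          have "I (R2(41 := real b + real g, 42 := real (g * \<sigma>))) M Y (f2 - 4)"
            unfolding I_def
          proof (intro conjI exI[of _ g])
            show "f - 44 * real (h - g) \<le> f2 - 4" using f2 h'(3,10) g(1) by simp
          qed (use h'(3) g R2 in \<open>auto simp: min_def\<close>)
          then show "wp m (Block [Sub 41 41 2, Sub 42 42 31]) (\<lambda>R M Y f. I R M Y (f - 1)) R2 M Y (f2 - 1)"
            using R2 R(4,5) g(1) by (intro wp_Block) (simp add: algebra_simps)
        qed
      qed (use top st in auto)
    qed (use top in auto)
  qed
qed

end

text \<open>The first column of a list is 0 and always stays, so it is pushed beforehand and the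
  loop starts with the second entry. The stack is itself the next column list.\<close>

definition reduce_code :: com where
  "reduce_code =
    Block [Move 41 33, Store 41 3, Const 42 0, Add 40 32 2] ;;
    Loop (Block []) 33 40
      (Block [Load 43 40] ;; pop_code ;; Block [Add 48 42 31] ;;
       Cond 48 18 (Block [Move 42 48, Add 41 41 2, Store 41 43]) (Block []) ;;
       Block [Add 40 40 2]) ;;
    Block [Move 32 33, Add 33 41 2, Add 31 31 31]"

context kmeans_seg begin

lemma ok_regs:
  assumes "ok R M"
  shows "R 2 = 1" "R 3 = 0" "R 8 = real bT" "R 9 = real bC" "R 18 = real N" "R 19 = real N + 1"
  using assms by (simp_all add: ok_def glob_def seg_def)

text \<open>The result is written behind the input list, which remains intact for the way back. One
  free cell for every row of the stride is enough room, by the height bound in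
  \<open>stack_ok\<close>.\<close>

lemma wp_reduce:
  assumes ok: "ok R M"
    and cs: "cs \<noteq> []" "hd cs = 0" "sorted_wrt (<) cs" "set cs \<subseteq> {..N}" "covers \<sigma> {..N} (set cs)"
      "arr M ps cs" and pe: "pe = ps + length cs" "bC \<le> ps"
    and room: "\<And>h. h * \<sigma> \<le> N \<Longrightarrow> pe + h < m"
    and R: "R 31 = real \<sigma>" "R 32 = real ps" "R 33 = real pe"
    and f: "f \<ge> 98 * real (length cs)"
    and Q: "\<And>R' M' f' st. st \<noteq> [] \<Longrightarrow> hd st = 0 \<Longrightarrow> sorted_wrt (<) st \<Longrightarrow> set st \<subseteq> set cs \<Longrightarrow>
      covers \<sigma> {..N} (set st) \<Longrightarrow> (length st - 1) * \<sigma> \<le> N \<Longrightarrow> arr M' pe st \<Longrightarrow>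
      \<forall>i<pe. M' i = M i \<Longrightarrow> \<forall>r<31. R' r = R r \<Longrightarrow> R' 31 = 2 * real \<sigma> \<Longrightarrow> R' 32 = real pe \<Longrightarrow>
      R' 33 = real (pe + length st) \<Longrightarrow> f' \<ge> f - 98 * real (length cs) \<Longrightarrow> Q R' M' Y f'"
  shows "wp m reduce_code Q R M Y f"
proof -
  note okr = ok_regs[OF ok]
  \<comment> \<open>Amortisation: every stack entry carries a credit of 44 units for its later
    removal. Of the 98 units of a column, 44 pay for the comparison that ends the popping, 44 become
    the credit of a pushed entry, and the remaining 10 cover the bookkeeping.\<close>
  define J where "J i st h R' M' f' \<longleftrightarrow> 0 < i \<and> i \<le> length cs \<and> stack_ok \<sigma> st \<and>
    set st \<subseteq> set (take i cs) \<and> covers \<sigma> (set (take i cs)) (set st) \<and> arr M' pe st \<and>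
    length st = Suc h \<and> (\<forall>j<pe. M' j = M j) \<and> (\<forall>r<40. R' r = R r) \<and> R' 40 = real ps + real i \<and>
    R' 41 = real pe + real h \<and> R' 42 = real (h * \<sigma>) \<and>
    f' + 98 * real i \<ge> f + 44 * real (Suc h) + 40" for i st h R' M' f'
  define I where "I = (\<lambda>R' M' Y' f'. Y' = Y \<and> (\<exists>i st h. J i st h R' M' f'))"
  have cs0: "take (Suc 0) cs = [0]" using cs(1,2) by (cases cs) auto
  have bH: "bH \<le> pe" using layout pe(2) pe(1) by linarith
  have "J 1 [0] 0 (R(41 := real pe, 42 := 0, 40 := real ps + 1)) (M(pe := 0)) (f - 4)"
    unfolding J_def
  proof (intro conjI)
    show "1 \<le> length cs" using cs(1) by (cases cs) auto
    show "stack_ok \<sigma> [0]" by (simp add: stack_ok_def)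
  qed (auto simp: cs0 covers_def arr_def)
  then have "I (R(41 := real pe, 42 := 0, 40 := real ps + 1)) (M(pe := 0)) Y (f - 4)"
    unfolding I_def by blast
  moreover have "pe < m" using room[of 0] by simp
  ultimately have init: "block_wp m [Move 41 33, Store 41 3, Const 42 0, Add 40 32 2] I R M Y f"
    using R okr by simp
  have final: "block_wp m [Move 32 33, Add 33 41 2, Add 31 31 31] Q R' M' Y' (f' - 1)"
    if I: "I R' M' Y' f'" and exit: "R' 33 \<le> R' 40" for R' M' Y' f'
  proof -
    obtain i st h where i: "Y' = Y" "i \<le> length cs" "stack_ok \<sigma> st" "set st \<subseteq> set (take i cs)"
        "covers \<sigma> (set (take i cs)) (set st)" "arr M' pe st" "length st = Suc h"
        "\<forall>j<pe. M' j = M j" "\<forall>r<40. R' r = R r" "R' 40 = real ps + real i" "R' 41 = real pe + real h"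
        "f' + 98 * real i \<ge> f + 44 * real (Suc h) + 40"
      using I unfolding I_def J_def by blast
    have "i = length cs" using exit i(2,9,10) R pe(1) by simp
    then have "covers \<sigma> {..N} (set st)" "set st \<subseteq> set cs" using covers_trans[OF cs(5)] i(4,5) by auto
    moreover have "f' - 4 \<ge> f - 98 * real (length cs)" using i(12) \<open>i = length cs\<close> by simp
    ultimately show ?thesis
      using i(1,6-11) R okr stack_okD(1,2,4,5)[OF i(3)] by (auto intro!: Q)
  qed
  have body: "wp m (Block [Load 43 40] ;; pop_code ;; Block [Add 48 42 31] ;;
       Cond 48 18 (Block [Move 42 48, Add 41 41 2, Store 41 43]) (Block []) ;;
       Block [Add 40 40 2]) (\<lambda>R M Y f. I R M Y (f - 1)) R' M' Y' (f' - 1)"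
    if I: "I R' M' Y' f'" and cont: "R' 40 < R' 33" for R' M' Y' f'
  proof -
    obtain i st h where i: "Y' = Y" "0 < i" "i \<le> length cs" "stack_ok \<sigma> st" "set st \<subseteq> set (take i cs)"
        "covers \<sigma> (set (take i cs)) (set st)" "arr M' pe st" "length st = Suc h"
        "\<forall>j<pe. M' j = M j" "\<forall>r<40. R' r = R r" "R' 40 = real ps + real i" "R' 41 = real pe + real h"
        "R' 42 = real (h * \<sigma>)" "f' + 98 * real i \<ge> f + 44 * real (Suc h) + 40"
      using I unfolding I_def J_def by blast
    have il: "i < length cs" using cont i(3,10,11) R pe(1) by simp
    define c where "c = cs ! i"
    have take_i: "take (Suc i) cs = take i cs @ [c]" "set (take (Suc i) cs) = insert c (set (take i cs))"
      using il by (auto simp: take_Suc_conv_app_nth c_def)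
    have hN: "h * \<sigma> \<le> N" using stack_okD(5)[OF i(4)] i(8) by simp
    have cN: "c \<le> N" using cs(4) nth_mem[OF il] by (auto simp: c_def)
    have lt: "\<forall>s\<in>set st. s < c"
    proof
      fix s assume "s \<in> set st"
      then have "s \<in> set (take i cs)" using i(5) by blast
      then obtain j where "j < i" "s = cs ! j" using il by (auto simp: in_set_conv_nth)
      then show "s < c" using sorted_wrt_nth_less[OF cs(3)] il by (simp add: c_def)
    qed
    have Mc: "M' (ps + i) = real c" "ps + i < m"
      using i(9) cs(6) il pe(1) room[of 0] by (auto simp: arr_def c_def)
    have ok': "ok R'' M'" if "\<forall>r<40. R'' r = R r" for R''
      using that i(9) bH by (intro ok_frame[OF ok]) auto
    show ?thesis
    proof (rule wp_Seq, rule wp_Block, simp add: i(11) Mc, rule wp_Seq,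
        rule wp_pop[where st = st and b = pe and c = c and h = h and \<sigma> = \<sigma> and C = "set (take i cs)"],
        goal_cases)
      case 1 show ?case by (rule ok') (use i(10) in auto)
    next
      case 3 show ?case using i(6) by (rule covers_mono) auto
    next
      case 7 show ?case using room[OF hN] i(8) by simp
    next
      case 14
      have "f \<ge> 98 * real i" using f il by simp
      then show ?case using i(14) by simp
    next
      case (15 R1 f1 h')
      have R1: "\<forall>r<40. R1 r = R r" "R1 40 = real ps + real i" using 15(5) i(10,11) by auto
      have len': "length (take (Suc h') st) = Suc h'" "take (Suc h') st ! h' = st ! h'"
        using i(8) 15(1) by auto
      have f1: "f1 - 7 + 98 * real (Suc i) \<ge> f + 44 * real (Suc (Suc h')) + 40"
        using 15(9) i(14) 15(1) by (simp add: of_nat_diff)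
      have lt': "\<forall>s\<in>set (take (Suc h') st). s < c" using lt by (meson in_set_takeD)
      have sub: "set (take (Suc h') st) \<subseteq> set (take (Suc i) cs)"
        using i(5) take_i(2) set_take_subset[of "Suc h'" st] by auto
      show ?case
      proof (rule wp_Seq, rule wp_Block, simp add: 15(7) R1 R(1), rule wp_Seq, rule wp_Cond, goal_cases)
        case 1
        then have rm: "h' * \<sigma> + \<sigma> \<le> N"
          using R1 okr(5) by (simp flip: of_nat_mult of_nat_add)
        note push = stack_push[OF 15(2,3) lt' len'(1) _ rm, unfolded len'(2), OF 15(4)]
        have adr: "Suc (pe + h') < m" using room[of "Suc h'"] rm by simp
        have "arr M' pe (take (Suc h') st)" using i(7) by (rule arr_take)
        from arr_append1[OF this, of c] have arr': "arr (M'(Suc (pe + h') := real c)) pe (take (Suc h') st @ [c])"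
          using len' by simp
        have "J (Suc i) (take (Suc h') st @ [c]) (Suc h') (R1(48 := real (Suc h' * \<sigma>), 42 := real (Suc h' * \<sigma>), 41 := real pe + real (Suc h'),
            40 := real ps + real (Suc i))) (M'(Suc (pe + h') := real c)) (f1 - 7)"
          unfolding J_def
          using il push arr' len' i(9) R1 f1 sub take_i(2)
          by auto
        then have "I (R1(48 := real (Suc h' * \<sigma>), 42 := real (Suc h' * \<sigma>), 41 := real pe + real (Suc h'),
            40 := real ps + real (Suc i))) (M'(Suc (pe + h') := real c)) Y (f1 - 7)"
          unfolding I_def by blast
        moreover have "address m (real pe + real h' + 1) = Some (Suc (pe + h'))"
          using address_of_nat[of m "Suc (pe + h')"] adr by (simp add: add.commute add.left_commute)
        moreover have "real h' * real \<sigma> + real \<sigma> = real (Suc h' * \<sigma>)" by (simp add: algebra_simps)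
        ultimately show ?case
          using 15(6,8) R1 okr i(1) adr
          by (intro wp_Block) (simp add: fun_upd_twist wp_Block add.commute add.left_commute)
      next
        case 2
        then have rm: "N < h' * \<sigma> + \<sigma>"
          using R1 okr(5) by (simp flip: of_nat_mult of_nat_add)
        note skip = stack_skip[OF 15(2,3) lt' len'(1) _ rm, unfolded len'(2), OF 15(4)]
        have "J (Suc i) (take (Suc h') st) h'
            (R1(48 := real h' * real \<sigma> + real \<sigma>, 40 := real ps + real i + 1)) M' f2"
            if "f2 \<ge> f1 - 7" for f2
          unfolding J_def
          using il 15(2) skip arr_take[OF i(7)] len' i(9) R1 f1 15(6,7) sub take_i(2) that
          by auto
        then have "I (R1(48 := real h' * real \<sigma> + real \<sigma>, 40 := real ps + real i + 1)) M' Y f2"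
            if "f2 \<ge> f1 - 7" for f2
          unfolding I_def using that by blast
        then show ?case
          using R1 okr i(1)
          by (intro wp_Block) (simp add: wp_Block)
      qed
    qed (use i cN lt R okr in auto)
  qed
  have nonneg: "0 \<le> f'" if I: "I R' M' Y' f'" for R' M' Y' f'
  proof -
    obtain i st h where "J i st h R' M' f'" using I unfolding I_def by blast
    then show ?thesis using f unfolding J_def by simp
  qed
  show ?thesis unfolding reduce_code_def
  proof (rule wp_Seq, rule wp_conseq[OF wp_Block[OF init]], rule wp_Seq,
      rule wp_Loop[where I = I], assumption, erule nonneg)
    fix R M Y f assume I: "I R M Y f"
    show "wp m (Block []) (\<lambda>R M Y f.
            (R 33 \<le> R 40 \<longrightarrow> wp m (Block [Move 32 33, Add 33 41 2, Add 31 31 31]) Q R M Y (f - 1)) \<and>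
            (R 40 < R 33 \<longrightarrow> wp m (Block [Load 43 40] ;; pop_code ;; Block [Add 48 42 31] ;;
       Cond 48 18 (Block [Move 42 48, Add 41 41 2, Store 41 43]) (Block []) ;;
       Block [Add 40 40 2]) (\<lambda>R M Y f. I R M Y (f - 1)) R M Y (f - 1))) R M Y f"
      using wp_Block[OF final[OF I]] body[OF I] by (intro wp_Block) simp
  qed
qed

end

section \<open>Reduced column lists for all strides\<close>

definition descend_code :: com where
  "descend_code =
    Block [Const 31 1, Move 32 9, Add 33 9 19, Const 40 0] ;;
    Loop (Block []) 19 40 (Block [Add 41 9 40, Store 41 40, Add 40 40 2]) ;;
    Loop (Block []) 19 31 reduce_code"

context kmeans_seg begin

definition seg_ok :: "nat \<Rightarrow> nat list \<Rightarrow> bool" where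
  "seg_ok \<sigma> cs \<longleftrightarrow> cs \<noteq> [] \<and> hd cs = 0 \<and> sorted_wrt (<) cs \<and> set cs \<subseteq> {..N} \<and>
    covers \<sigma> {..N} (set cs) \<and> (length cs - 1) * \<sigma> \<le> N \<and> \<sigma> \<le> N"

text \<open>The column lists of all strides are stored consecutively, ending at \<open>e\<close>, the largest stride first
  in \<open>css\<close>. Each one starts with column 0 and contains no other 0, so that its beginning can be found
  by walking back.\<close>

fun segs :: "(nat \<Rightarrow> real) \<Rightarrow> nat list list \<Rightarrow> nat \<Rightarrow> bool" where
  "segs M [] e \<longleftrightarrow> bC \<le> e"
| "segs M (cs # css) e \<longleftrightarrow> (\<exists>b. e = b + length cs \<and> arr M b cs \<and> seg_ok (2 ^ length css) cs \<and>
    (css \<noteq> [] \<longrightarrow> set cs \<subseteq> set (hd css)) \<and> segs M css b)"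

lemma segs_ge: "segs M css e \<Longrightarrow> bC \<le> e"
proof (induction css arbitrary: e)
  case (Cons cs css)
  then obtain b where "e = b + length cs" "segs M css b" by auto
  then show ?case using Cons.IH[of b] by simp
qed simp

lemma segs_frame: "segs M css e \<Longrightarrow> (\<And>i. bC \<le> i \<Longrightarrow> i < e \<Longrightarrow> M' i = M i) \<Longrightarrow> segs M' css e"
proof (induction css arbitrary: e)
  case (Cons cs css)
  then obtain b where b: "e = b + length cs" "arr M b cs" "seg_ok (2 ^ length css) cs"
      "css \<noteq> [] \<longrightarrow> set cs \<subseteq> set (hd css)" "segs M css b" by auto
  have "segs M' css b" using b(5) by (rule Cons.IH) (use Cons.prems(2) b(1) in auto)
  moreover have "arr M' b cs" using b(2)
    by (rule arr_frame) (use Cons.prems(2) b(1) segs_ge[OF b(5)] in auto)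
  ultimately show ?case using b by auto
qed simp

lemma wp_descend:
  assumes ok: "ok R M" and f: "f \<ge> 600 * real (N + 1)"
    and Q: "\<And>R' M' f' css e. segs M' css e \<Longrightarrow> e \<le> m \<Longrightarrow> N < 2 ^ length css \<Longrightarrow>
      R' 31 = 2 ^ length css \<Longrightarrow> R' 33 = real e \<Longrightarrow> \<forall>i<bC. M' i = M i \<Longrightarrow> \<forall>r<31. R' r = R r \<Longrightarrow>
      f' \<ge> f - 600 * real (N + 1) \<Longrightarrow> Q R' M' Y f'"
  shows "wp m descend_code Q R M Y f"
proof -
  note okr = ok_regs[OF ok]
  have NW: "N < W" using aN layout(1) by simp
  define I1 where "I1 = (\<lambda>R' M' Y' f'. Y' = Y \<and> (\<exists>i. i \<le> N + 1 \<and> (\<forall>r<31. R' r = R r) \<and>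
     R' 31 = 1 \<and> R' 32 = real bC \<and> R' 33 = real bC + (real N + 1) \<and> R' 40 = real i \<and>
     arr M' bC [0..<i] \<and> (\<forall>j<bC. M' j = M j) \<and> f' \<ge> f - 4 - 5 * real i))"
  \<comment> \<open>Let \<sigma> be the current stride. A list reduced for a stride \<sigma> \<le> N
    has at most N/\<sigma> + 1 \<le> 2 N/\<sigma> entries, and 4 N - 4 N/\<sigma> sums these bounds
    over the earlier strides; together with the initial list this explains the 5 W cells of the
    layout. The input of a reduction has at most 3 N/\<sigma> columns at 98 units each, which is
    covered by the drop of 592 N/\<sigma> by one half when the stride doubles.\<close>
  define J where "J css cs ps R' M' f' \<longleftrightarrow> cs \<noteq> [] \<and> hd cs = 0 \<and> sorted_wrt (<) cs \<and> set cs \<subseteq> {..N} \<and>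
     covers (2 ^ length css) {..N} (set cs) \<and> (length cs - 1) * 2 ^ length css \<le> 2 * N \<and>
     arr M' ps cs \<and> bC \<le> ps \<and> segs M' css (ps + length cs) \<and> (css \<noteq> [] \<longrightarrow> cs = hd css) \<and>
     (\<forall>r<31. R' r = R r) \<and> (\<forall>j<bC. M' j = M j) \<and> R' 31 = 2 ^ length css \<and> R' 32 = real ps \<and>
     R' 33 = real (ps + length cs) \<and>
     real (ps + length cs) \<le> real bC + real N + 1 + 4 * real N - 4 * real N / 2 ^ length css \<and>
     f' \<ge> f - 600 * real (N + 1) + 1 + 592 * real N / 2 ^ length css"
    for css cs ps R' M' f'
  define I2 where "I2 = (\<lambda>R' M' Y' f'. Y' = Y \<and> (\<exists>css cs ps. J css cs ps R' M' f'))"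
  have "I1 (R(31 := 1, 32 := real bC, 33 := real bC + (real N + 1), 40 := 0)) M Y (f - 4)"
    unfolding I1_def by (auto simp: arr_def)
  then have init: "block_wp m [Const 31 1, Move 32 9, Add 33 9 19, Const 40 0] I1 R M Y f"
    using okr by simp
  have I1_nonneg: "0 \<le> f'" if "I1 R' M' Y' f'" for R' M' Y' f'
    using that f unfolding I1_def by auto
  have I1_exit: "I2 R' M' Y' (f' - 1)" if I: "I1 R' M' Y' f'" and exit: "R' 19 \<le> R' 40" for R' M' Y' f'
  proof -
    obtain i where i: "Y' = Y" "i \<le> N + 1" "\<forall>r<31. R' r = R r" "R' 31 = 1" "R' 32 = real bC"
        "R' 33 = real bC + (real N + 1)" "R' 40 = real i" "arr M' bC [0..<i]" "\<forall>j<bC. M' j = M j"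
        "f' \<ge> f - 4 - 5 * real i"
      using I unfolding I1_def by blast
    have "i = N + 1" using exit i(2,3,7) okr by simp
    \<comment> \<open>The complete list of columns is only the input of the first reduction and is
      not recorded in \<open>css\<close>; the last element of \<open>css\<close> will be the list
      reduced for stride 1.\<close>
    have "J [] [0..<N + 1] bC R' M' (f' - 1)"
      unfolding J_def using i \<open>i = N + 1\<close>
      by (auto simp del: upt_Suc simp: covers_def sorted_wrt_upt hd_upt)
    then show ?thesis unfolding I2_def using i(1) by blast
  qed
  have I1_body: "block_wp m [Add 41 9 40, Store 41 40, Add 40 40 2] (\<lambda>R M Y f. I1 R M Y (f - 1)) R' M' Y' (f' - 1)"
    if I: "I1 R' M' Y' f'" and cont: "R' 40 < R' 19" for R' M' Y' f'
  proof -
    obtain i where i: "Y' = Y" "i \<le> N + 1" "\<forall>r<31. R' r = R r" "R' 31 = 1" "R' 32 = real bC"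
        "R' 33 = real bC + (real N + 1)" "R' 40 = real i" "arr M' bC [0..<i]" "\<forall>j<bC. M' j = M j"
        "f' \<ge> f - 4 - 5 * real i"
      using I unfolding I1_def by blast
    have iN: "i \<le> N" using cont i(3,7) okr by simp
    have adr: "bC + i < m" using iN NW layout(8) by linarith
    have "arr (M'(bC + i := real i)) bC [0..<Suc i]" using arr_append1[OF i(8), of i] by simp
    then have "I1 (R'(41 := real bC + real i, 40 := real i + 1)) (M'(bC + i := real i)) Y (f' - 5)"
      unfolding I1_def using i iN by (intro conjI refl exI[of _ "Suc i"]) auto
    then show ?thesis using i adr okr by simp
  qed
  have I2_nonneg: "0 \<le> f'" if I: "I2 R' M' Y' f'" for R' M' Y' f'
  proof -
    obtain css cs ps where "J css cs ps R' M' f'" using I unfolding I2_def by blast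
    then have "f' \<ge> f - 600 * real (N + 1) + 1 + 592 * real N / 2 ^ length css"
      unfolding J_def by blast
    moreover have "592 * real N / 2 ^ length css \<ge> 0" by simp
    ultimately show ?thesis using f by linarith
  qed
  have I2_exit: "Q R' M' Y' (f' - 1)" if I: "I2 R' M' Y' f'" and exit: "R' 19 \<le> R' 31" for R' M' Y' f'
  proof -
    obtain css cs ps where "J css cs ps R' M' f'" "Y' = Y" using I unfolding I2_def by blast
    note J = this(1)[unfolded J_def] and Y = this(2)
    have "real (N + 1) \<le> real (2 ^ length css)" using exit J okr by simp
    then have N: "N < 2 ^ length css" unfolding of_nat_le_iff by simp
    have pos: "592 * real N / 2 ^ length css \<ge> 0" "4 * real N / 2 ^ length css \<ge> 0" by auto
    have "real (ps + length cs) \<le> real bC + real N + 1 + 4 * real N" using J pos by linarith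
    also have "\<dots> \<le> real m" using NW layout(8) by linarith
    finally have "ps + length cs \<le> m" by simp
    moreover have "f' - 1 \<ge> f - 600 * real (N + 1)" using J pos by linarith
    ultimately show ?thesis unfolding Y using J N by (intro Q[of M' css "ps + length cs"]) auto
  qed
  have I2_body: "wp m reduce_code (\<lambda>R M Y f. I2 R M Y (f - 1)) R' M' Y' (f' - 1)"
    if I: "I2 R' M' Y' f'" and cont: "R' 31 < R' 19" for R' M' Y' f'
  proof -
    obtain css cs ps where "J css cs ps R' M' f'" and Y: "Y' = Y" using I unfolding I2_def by blast
    note J = this(1)[unfolded J_def]
    have Jsegs: "segs M' css (ps + length cs)" and Jhd: "css \<noteq> [] \<longrightarrow> cs = hd css"
      using J by blast+
    define \<sigma> where "\<sigma> = (2 :: nat) ^ length css"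
    have s: "real \<sigma> = 2 ^ length css" "\<sigma> > 0" by (auto simp: \<sigma>_def)
    have "real \<sigma> < real (N + 1)" using cont J okr s(1) by simp
    then have \<sigma>N: "\<sigma> \<le> N" by simp
    define w where "w = real N / real \<sigma>"
    have w1: "w \<ge> 1" using \<sigma>N s(2) by (simp add: w_def)
    have h_le: "real h \<le> w" if "h * \<sigma> \<le> N" for h
    proof -
      have "real h * real \<sigma> \<le> real N" using that by (metis of_nat_le_iff of_nat_mult)
      then show ?thesis using s(2) by (simp add: w_def pos_le_divide_eq)
    qed
    have space: "real (ps + length cs) \<le> real bC + real N + 1 + 4 * real N - 4 * w"
      and fuel: "f' \<ge> f - 600 * real (N + 1) + 1 + 592 * w"
      using J by (auto simp: w_def s)
    have "real (length cs - 1) * real \<sigma> \<le> 2 * real N"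
      using J unfolding \<sigma>_def by (metis of_nat_le_iff of_nat_mult of_nat_numeral)
    then have "real (length cs - 1) \<le> 2 * w" using s(2) by (simp add: w_def pos_le_divide_eq)
    then have len: "real (length cs) \<le> 3 * w" using w1 J by linarith
    show ?thesis
    proof (rule wp_reduce[where cs = cs and ps = ps and \<sigma> = \<sigma> and pe = "ps + length cs"], goal_cases)
      case 1 show ?case by (rule ok_frame[OF ok]) (use J layout in auto)
    next
      case (10 h)
      have "real (ps + length cs + h) \<le> real bC + real N + 1 + 4 * real N"
        using space h_le[OF 10] w1 by simp
      also have "\<dots> < real m" using NW layout(1,8) by linarith
      finally show ?case by simp
    next
      case 14
      show ?case using fuel f len w1 by linarith
    next
      case (15 R1 M1 f1 st)
      have stw: "real (length st) \<le> 2 * w" using h_le[OF 15(6)] w1 15(1) by linarith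
      have seg: "seg_ok \<sigma> st" using 15 J \<sigma>N unfolding seg_ok_def by blast
      have frame: "segs M1 css (ps + length cs)"
        using Jsegs by (rule segs_frame) (use 15(8) in blast)
      have "J (st # css) st (ps + length cs) R1 M1 (f1 - 1)"
        unfolding J_def
      proof (intro conjI)
        show "covers (2 ^ length (st # css)) {..N} (set st)"
          using covers_double[OF 15(5)] by (simp add: \<sigma>_def)
        show "(length st - 1) * 2 ^ length (st # css) \<le> 2 * N"
          using 15(6) by (simp add: \<sigma>_def algebra_simps)
        show "segs M1 (st # css) (ps + length cs + length st)"
          using frame seg 15(4,7) Jhd by (auto simp: \<sigma>_def)
        show "real (ps + length cs + length st) \<le>
            real bC + real N + 1 + 4 * real N - 4 * real N / 2 ^ length (st # css)"
        proof -
          have "4 * real N / 2 ^ length (st # css) = 2 * w" by (simp add: w_def s(1))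
          then show ?thesis using space stw by simp
        qed
        have "592 * real N / 2 ^ length (st # css) = 296 * w" by (simp add: w_def s(1))
        then show "f1 - 1 \<ge> f - 600 * real (N + 1) + 1 + 592 * real N / 2 ^ length (st # css)"
          using 15(13) fuel len w1 by linarith
      qed (use 15 J s in \<open>auto simp: \<sigma>_def\<close>)
      then show ?case unfolding I2_def using Y by blast
    qed (use J s in \<open>auto simp: \<sigma>_def\<close>)
  qed
  show ?thesis unfolding descend_code_def
    apply (rule wp_Seq, rule wp_conseq[OF wp_Block[OF init]])
    apply (rule wp_Seq, rule wp_Loop[where I = I1], assumption, erule I1_nonneg)
    apply (intro wp_Block, simp only: block_wp.simps, intro conjI impI)
     apply (rule wp_Loop[where I = I2], erule (1) I1_exit, erule I2_nonneg)
     apply (rule wp_Block, simp only: block_wp.simps, intro conjI impI)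
      apply (erule (1) I2_exit)
     apply (erule (1) I2_body)
    apply (rule wp_Block, erule (1) I1_body)
    done
qed

end

section \<open>Row minima between rows already solved\<close>

definition scan_code :: com where
  "scan_code = Loop
    (Block [Add 48 40 2] ;; Cond 33 48 (Block [Move 43 19]) (Block [Load 43 48])) 45 43
    (Block [Add 40 40 2] ;; row_code 44 43 ;; Cond 47 50 (Block []) (Block [Move 47 50, Move 46 43]))"

definition fill_row_code :: com where
  "fill_row_code =
    Block [Add 48 44 31] ;;
    Cond 19 48 (Block [Move 45 19]) (Block [Add 48 8 48, Load 45 48, Add 45 45 2]) ;;
    Block [Load 46 40] ;; row_code 44 46 ;; Block [Move 47 50] ;;
    scan_code ;;
    Block [Add 48 8 44, Store 48 46, Add 44 44 30]"

lemma sorted_wrt_nth_le_iff: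
  assumes "sorted_wrt (<) (cs :: nat list)" "i < length cs" "j < length cs"
  shows "cs ! i \<le> cs ! j \<longleftrightarrow> i \<le> j"
  using assms sorted_wrt_nth_less[of "(<)" cs i j] sorted_wrt_nth_less[of "(<)" cs j i]
  by (cases i j rule: linorder_cases) auto

text \<open>\<open>row_min_between\<close> in terms of list positions. The last conclusion is what
  makes a whole pass linear: the scan stops exactly at the minimiser of the row below, where the
  scan for the next unsolved row has to begin.\<close>

lemma (in monge) row_min_insert_row:
  assumes cs: "sorted_wrt (<) cs" "set cs \<subseteq> {..N}" "covers \<sigma> {..N} (set cs)"
    and lo: "row_min (u * \<sigma>) (cs ! p)" "p \<le> b" "b \<le> p'" "p' < length cs"
    and hi: "Suc (Suc u) * \<sigma> \<le> N \<Longrightarrow> row_min (Suc (Suc u) * \<sigma>) t2 \<and> t2 \<in> set cs"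
      "N < Suc (Suc u) * \<sigma> \<Longrightarrow> t2 = N" "cs ! p' \<le> t2" "\<forall>j<length cs. cs ! j \<le> t2 \<longrightarrow> j \<le> p'"
    and r: "Suc u * \<sigma> \<le> N"
    and b: "\<forall>j. p \<le> j \<and> j \<le> p' \<longrightarrow> A (Suc u * \<sigma>) (cs ! b) \<le> A (Suc u * \<sigma>) (cs ! j)"
  shows "row_min (Suc u * \<sigma>) (cs ! b)" "cs ! p \<le> cs ! b" "cs ! b \<le> t2"
    "Suc (Suc u) * \<sigma> \<le> N \<Longrightarrow> cs ! p' = t2"
proof -
  have le: "cs ! i \<le> cs ! j \<longleftrightarrow> i \<le> j" if "i < length cs" "j < length cs" for i j
    using sorted_wrt_nth_le_iff[OF cs(1) that] .
  show "cs ! p \<le> cs ! b" using le[of p b] lo by simp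
  show "cs ! b \<le> t2" using le[of b p'] lo hi(3) by simp
  have t12: "cs ! p \<le> t2" using le[of p p'] lo hi(3) by simp
  show "row_min (Suc u * \<sigma>) (cs ! b)"
  proof (rule row_min_between[OF cs(3,2) lo(1) _ hi(1,2) t12 r])
    show "cs ! p \<in> set cs" "cs ! b \<in> set cs" using lo by auto
    fix s assume s: "s \<in> set cs" "cs ! p \<le> s" "s \<le> t2"
    then obtain j where j: "j < length cs" "s = cs ! j" by (auto simp: in_set_conv_nth)
    then have "p \<le> j" "j \<le> p'" using s le[of p j] lo hi(4) by auto
    then show "A (Suc u * \<sigma>) (cs ! b) \<le> A (Suc u * \<sigma>) s" using b j by blast
  qed
  assume "Suc (Suc u) * \<sigma> \<le> N"
  then obtain j where j: "j < length cs" "t2 = cs ! j" using hi(1) by (auto simp: in_set_conv_nth)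
  then have "j \<le> p'" using hi(4) by blast
  then show "cs ! p' = t2" using le[of j p'] j lo(4) hi(3) by simp
qed

context kmeans_seg begin

text \<open>The bound is kept as \<open>hi + 1\<close> in register 45 because the machine only jumps
  on \<le>. At the end of the list the value N + 1 takes the place of the next column and stops the
  loop. The cost is charged to the positions passed, so that all rows of one pass together pay for
  the list only once.\<close>

lemma wp_scan:
  assumes ok: "ok R M" and cs: "sorted_wrt (<) cs" "set cs \<subseteq> {..N}" "arr M ps cs" "ps + length cs \<le> m"
    and R: "R 33 = real ps + real (length cs)" "R 40 = real ps + real p0" "R 44 = real r"
      "R 45 = real hi + 1" "R 46 = real (cs ! p0)" "R 47 = A r (cs ! p0)"
    and p0: "p0 < length cs" "cs ! p0 \<le> hi" "hi \<le> N" "r \<le> N"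
    and f: "f \<ge> 31 * (real (length cs) - real p0)"
    and Q: "\<And>R' f' p b. p0 \<le> b \<Longrightarrow> b \<le> p \<Longrightarrow> p < length cs \<Longrightarrow> cs ! p \<le> hi \<Longrightarrow>
      \<forall>j<length cs. cs ! j \<le> hi \<longrightarrow> j \<le> p \<Longrightarrow> \<forall>j. p0 \<le> j \<and> j \<le> p \<longrightarrow> A r (cs ! b) \<le> A r (cs ! j) \<Longrightarrow>
      \<forall>i<40. R' i = R i \<Longrightarrow> R' 40 = real ps + real p \<Longrightarrow> R' 44 = R 44 \<Longrightarrow> R' 46 = real (cs ! b) \<Longrightarrow>
      f' \<ge> f - 31 * (real p - real p0 + 1) \<Longrightarrow> Q R' M Y f'"
  shows "wp m scan_code Q R M Y f"
proof -
  note okr = ok_regs[OF ok]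
  define J where "J p b R' f' \<longleftrightarrow> p0 \<le> b \<and> b \<le> p \<and> p < length cs \<and> cs ! p \<le> hi \<and>
      (\<forall>j. p0 \<le> j \<and> j \<le> p \<longrightarrow> A r (cs ! b) \<le> A r (cs ! j)) \<and>
      (\<forall>i<40. R' i = R i) \<and> R' 40 = real ps + real p \<and> R' 44 = R 44 \<and> R' 45 = R 45 \<and>
      R' 46 = real (cs ! b) \<and> R' 47 = A r (cs ! b) \<and> f' \<ge> f - 31 * (real p - real p0)"
    for p b R' f'
  define I where "I = (\<lambda>R' M' Y' f'. M' = M \<and> Y' = Y \<and> (\<exists>p b. J p b R' f'))"
  show ?thesis unfolding scan_code_def
  proof (rule wp_Loop[where I = I])
    have "J p0 p0 R f" unfolding J_def using p0 R by auto
    then show "I R M Y f" unfolding I_def by blast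
  next
    fix R' M' Y' f' assume "I R' M' Y' f'"
    then obtain p b where "J p b R' f'" unfolding I_def by blast
    then have "p < length cs" "f' \<ge> f - 31 * (real p - real p0)" unfolding J_def by auto
    then show "0 \<le> f'" using f by simp
  next
    fix R' M' Y' f' assume "I R' M' Y' f'"
    then obtain p b where "J p b R' f'" and MY: "M' = M" "Y' = Y" unfolding I_def by blast
    from this(1) have J: "p0 \<le> b" "b \<le> p" "p < length cs" "cs ! p \<le> hi"
        "\<forall>j. p0 \<le> j \<and> j \<le> p \<longrightarrow> A r (cs ! b) \<le> A r (cs ! j)"
        "\<forall>i<40. R' i = R i" "R' 40 = real ps + real p" "R' 44 = R 44" "R' 45 = R 45"
        "R' 46 = real (cs ! b)" "R' 47 = A r (cs ! b)" "f' \<ge> f - 31 * (real p - real p0)"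
      unfolding J_def by blast+
    define post where "post = (\<lambda>R M Y f. (R 45 \<le> R 43 \<longrightarrow> Q R M Y (f - 1)) \<and>
             (R 43 < R 45 \<longrightarrow> wp m (Block [Add 40 40 2] ;; row_code 44 43 ;;
               Cond 47 50 (Block []) (Block [Move 47 50, Move 46 43]))
               (\<lambda>R M Y f. I R M Y (f - 1)) R M Y (f - 1)))"
    have exit: "Q R1 M Y f1"
      if "\<forall>j<length cs. cs ! j \<le> hi \<longrightarrow> j \<le> p" "\<forall>i<40. R1 i = R i" "R1 40 = real ps + real p"
        "R1 44 = R 44" "R1 46 = real (cs ! b)" "f1 \<ge> f' - 5" for R1 f1
      using J that by (intro Q[of b p]) auto
    have "wp m (Block [Add 48 40 2] ;; Cond 33 48 (Block [Move 43 19]) (Block [Load 43 48]))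
          post R' M Y f'"
    proof (rule wp_Seq, rule wp_Block, simp add: J(7), rule wp_Cond, goal_cases)
      case 1
      then have p: "Suc p = length cs" using J R okr by simp
      have "post (R'(48 := real ps + real p + R' 2, 43 := R' 19)) M Y (f' - 1 - 1 - 1)"
        unfolding post_def using J okr R p0(3) p by (auto intro!: exit)
      then show ?case by (intro wp_Block) simp
    next
      case 2
      then have "real (Suc p) < real (length cs)" using J R okr by simp
      then have p: "Suc p < length cs" by simp
      have c: "M (Suc (ps + p)) = real (cs ! Suc p)" "Suc (ps + p) < m" "cs ! Suc p \<le> N"
        using cs(3,4) p subsetD[OF cs(2) nth_mem[OF p]] by (simp_all add: arr_def flip: add_Suc_right)
      have adr: "address m (real ps + real p + 1) = Some (Suc (ps + p))"
        using address_of_nat[of m "Suc (ps + p)"] c(2) by (simp add: add.commute add.left_commute)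
      define R1 where "R1 = R'(48 := real ps + real p + 1, 43 := real (cs ! Suc p))"
      have R1: "\<forall>i<40. R1 i = R i" "R1 40 = real ps + real p" "R1 44 = real r" "R1 45 = real hi + 1"
          "R1 46 = real (cs ! b)" "R1 47 = A r (cs ! b)" "R1 43 = real (cs ! Suc p)"
        using J R by (auto simp: R1_def)
      have ok1: "ok R2 M" if "\<forall>i<40. R2 i = R i" for R2
        using that by (intro ok_frame[OF ok]) auto
      have "post R1 M Y (f' - 4)"
        unfolding post_def
      proof (intro conjI impI)
        assume "R1 45 \<le> R1 43"
        then have "hi < cs ! Suc p" using R1 by simp
        then have "\<forall>j<length cs. cs ! j \<le> hi \<longrightarrow> j \<le> p"
          using sorted_wrt_nth_le_iff[OF cs(1) p] by (metis le_trans not_less not_less_eq_eq)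
        then show "Q R1 M Y (f' - 4 - 1)" using R1 R by (intro exit) auto
      next
        assume "R1 43 < R1 45"
        then have "real (cs ! Suc p) < real (hi + 1)" using R1 by simp
        then have hi: "cs ! Suc p \<le> hi" by simp
        show "wp m (Block [Add 40 40 2] ;; row_code 44 43 ;;
               Cond 47 50 (Block []) (Block [Move 47 50, Move 46 43]))
               (\<lambda>R M Y f. I R M Y (f - 1)) R1 M Y (f' - 4 - 1)"
        proof (rule wp_Seq, rule wp_Block, simp, rule wp_Seq,
            rule wp_row[where r = r and c = "cs ! Suc p"], goal_cases)
          case 1 show ?case by (rule ok1) (use R1 in auto)
        next
          case (8 R2 f2)
          have R2: "\<forall>i<40. R2 i = R i" "R2 40 = real ps + real (Suc p)" "R2 44 = real r"
              "R2 45 = real hi + 1" "R2 46 = real (cs ! b)" "R2 47 = A r (cs ! b)"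
              "R2 43 = real (cs ! Suc p)" "R2 50 = A r (cs ! Suc p)"
            using 8(1,2) R1 okr by auto
          have f2: "f2 - 5 \<ge> f - 31 * (real (Suc p) - real p0)" using 8(3) J(12) by simp
          show ?case
          proof (rule wp_Cond, goal_cases)
            case 1
            then have "\<forall>j. p0 \<le> j \<and> j \<le> Suc p \<longrightarrow> A r (cs ! b) \<le> A r (cs ! j)"
              using J(5) R2 by (auto simp: le_Suc_eq)
            then have "J (Suc p) b R2 (f2 - 1 - 1)"
              unfolding J_def using R2 J p f2 hi R by auto
            then show ?case by (intro wp_Block) (auto simp: I_def)
          next
            case 2
            then have "\<forall>j. p0 \<le> j \<and> j \<le> Suc p \<longrightarrow> A r (cs ! Suc p) \<le> A r (cs ! j)"
              using J(5) R2 by (force simp: le_Suc_eq)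
            then have "J (Suc p) (Suc p) (R2(47 := R2 50, 46 := R2 43)) (f2 - 5)"
              unfolding J_def using R2 J p f2 hi R by auto
            then show ?case by (intro wp_Block) (auto simp: I_def)
          qed
        qed (use R1 c p0 in auto)
      qed
      then show ?case using adr c okr J by (intro wp_Block) (simp add: R1_def)
    qed
    then show "wp m (Block [Add 48 40 2] ;; Cond 33 48 (Block [Move 43 19]) (Block [Load 43 48]))
          (\<lambda>R M Y f. (R 45 \<le> R 43 \<longrightarrow> Q R M Y (f - 1)) \<and>
             (R 43 < R 45 \<longrightarrow> wp m (Block [Add 40 40 2] ;; row_code 44 43 ;;
               Cond 47 50 (Block []) (Block [Move 47 50, Move 46 43]))
               (\<lambda>R M Y f. I R M Y (f - 1)) R M Y (f - 1))) R' M' Y' f'"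
      unfolding post_def MY .
  qed
qed

lemma wp_fill_row:
  assumes ok: "ok R M" and cs: "sorted_wrt (<) cs" "set cs \<subseteq> {..N}" "covers \<sigma> {..N} (set cs)"
      "arr M ps cs" "ps + length cs \<le> m"
    and R: "R 33 = real ps + real (length cs)" "R 40 = real ps + real p" "R 44 = real (Suc u * \<sigma>)"
      "R 31 = real \<sigma>" "R 30 = 2 * real \<sigma>"
    and p: "p < length cs" "row_min (u * \<sigma>) (cs ! p)" and r: "Suc u * \<sigma> \<le> N"
    and t2: "Suc (Suc u) * \<sigma> \<le> N \<Longrightarrow> row_min (Suc (Suc u) * \<sigma>) t2 \<and> t2 \<in> set cs \<and> cs ! p \<le> t2 \<and>
      M (bT + Suc (Suc u) * \<sigma>) = real t2" "N < Suc (Suc u) * \<sigma> \<Longrightarrow> t2 = N"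
    and f: "f \<ge> 31 * (real (length cs) - real p) + 28"
    and Q: "\<And>R' f' p' b. b \<in> set cs \<Longrightarrow> row_min (Suc u * \<sigma>) b \<Longrightarrow> cs ! p \<le> b \<Longrightarrow> b \<le> t2 \<Longrightarrow>
      p \<le> p' \<Longrightarrow> p' < length cs \<Longrightarrow> (Suc (Suc u) * \<sigma> \<le> N \<Longrightarrow> cs ! p' = t2) \<Longrightarrow>
      \<forall>i<40. R' i = R i \<Longrightarrow> R' 40 = real ps + real p' \<Longrightarrow> R' 44 = real (Suc (Suc (Suc u)) * \<sigma>) \<Longrightarrow>
      f' \<ge> f - 31 * (real p' - real p) - 61 \<Longrightarrow> Q R' (M(bT + Suc u * \<sigma> := real b)) Y f'"
  shows "wp m fill_row_code Q R M Y f"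
proof -
  note okr = ok_regs[OF ok]
  have NW: "N < W" using aN layout(1) by simp
  have cp: "cs ! p \<in> set cs" "cs ! p \<le> N"
    using subsetD[OF cs(2) nth_mem[OF p(1)]] p(1) by simp_all
  have t2N: "t2 \<le> N \<and> cs ! p \<le> t2"
  proof (cases "Suc (Suc u) * \<sigma> \<le> N")
    case True
    then show ?thesis using t2(1) cs(2) by (meson atMost_iff subsetD)
  next
    case False
    then show ?thesis using t2(2) cp by simp
  qed
  have ok1: "ok R2 M" if "\<forall>i<40. R2 i = R i" for R2
    using that by (intro ok_frame[OF ok]) auto
  have rest: "wp m (Block [Load 46 40] ;; row_code 44 46 ;; Block [Move 47 50] ;;
    scan_code ;; Block [Add 48 8 44, Store 48 46, Add 44 44 30]) Q R1 M Y f1"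
    if R1: "\<forall>i<40. R1 i = R i" "R1 40 = real ps + real p" "R1 44 = real (Suc u * \<sigma>)"
      "R1 45 = real t2 + 1" and f1: "f1 \<ge> f - 6" for R1 f1
  proof -
    have Mp: "M (ps + p) = real (cs ! p)" "ps + p < m" using cs(4,5) p(1) by (auto simp: arr_def)
    show ?thesis
    proof (rule wp_Seq, rule wp_Block, simp add: R1(2) Mp, rule wp_Seq,
        rule wp_row[where r = "Suc u * \<sigma>" and c = "cs ! p"], goal_cases)
      case 1 show ?case by (rule ok1) (use R1 in auto)
    next
      case (8 R2 f2)
      have R2: "\<forall>i<40. R2 i = R i" "R2 40 = real ps + real p" "R2 44 = real (Suc u * \<sigma>)"
          "R2 45 = real t2 + 1" "R2 46 = real (cs ! p)" "R2 50 = A (Suc u * \<sigma>) (cs ! p)"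
        using 8(1,2) R1 by auto
      have f2: "f2 \<ge> f - 26" using 8(3) f1 by simp
      show ?case
      proof (rule wp_Seq, rule wp_Block, simp, rule wp_Seq,
          rule wp_scan[where r = "Suc u * \<sigma>" and hi = t2 and cs = cs and ps = ps and ?p0.0 = p], goal_cases)
        case 1 show ?case by (rule ok1) (use R2 in auto)
      next
        case 16 show ?case using f2 f by simp
      next
        case (17 R3 f3 p' b)
        note ins = row_min_insert_row[OF cs(1-3) p(2) 17(1-3) _ t2(2) 17(4,5) r 17(6)]
        have b: "row_min (Suc u * \<sigma>) (cs ! b)" "cs ! p \<le> cs ! b" "cs ! b \<le> t2"
          "Suc (Suc u) * \<sigma> \<le> N \<Longrightarrow> cs ! p' = t2"
          using ins t2(1) by blast+
        have R3: "\<forall>i<40. R3 i = R i" "R3 40 = real ps + real p'" "R3 44 = real (Suc u * \<sigma>)"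
            "R3 46 = real (cs ! b)"
          using 17(7-10) R2 by auto
        have adr: "bT + Suc u * \<sigma> < m" using r NW layout by linarith
        have "Q (R3(48 := real bT + real (Suc u * \<sigma>), 44 := real (Suc (Suc (Suc u)) * \<sigma>)))
            (M(bT + Suc u * \<sigma> := real (cs ! b))) Y (f3 - 3)"
          using b 17(1-3) R3 17(11) f2 by (intro Q[where p' = p']) auto
        moreover have "real (Suc (Suc (Suc u)) * \<sigma>) = real (Suc u * \<sigma>) + 2 * real \<sigma>"
          by (simp add: algebra_simps)
        ultimately show ?case using adr okr R3 R
          by (intro wp_Block) (simp del: of_nat_mult mult_Suc of_nat_Suc)
      qed (use R2 R cs p t2N r in auto)
    qed (use R1 cp r in auto)
  qed
  have e: "real (Suc u * \<sigma>) + real \<sigma> = real (Suc (Suc u) * \<sigma>)" by (simp add: algebra_simps)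
  show ?thesis unfolding fill_row_code_def
  proof (rule wp_Seq, rule wp_Block, simp only: block_wp.simps instr_wp.simps R e,
      rule wp_Seq, rule wp_Cond, goal_cases)
    case 1
    then have "real (N + 1) \<le> real (Suc (Suc u) * \<sigma>)" using okr by (simp del: mult_Suc of_nat_mult)
    then have "N < Suc (Suc u) * \<sigma>" unfolding of_nat_le_iff by simp
    then show ?case using t2(2) okr R
      by (intro wp_Block) (simp del: mult_Suc of_nat_mult, intro rest, auto simp del: mult_Suc of_nat_mult)
  next
    case 2
    then have "real (Suc (Suc u) * \<sigma>) < real (N + 1)" using okr by (simp del: mult_Suc of_nat_mult)
    then have N2: "Suc (Suc u) * \<sigma> \<le> N" unfolding of_nat_less_iff by simp
    then have "bT + Suc (Suc u) * \<sigma> < m" using NW layout by linarith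
    then show ?case using t2(1)[OF N2] okr R
      by (intro wp_Block) (simp del: mult_Suc of_nat_mult, intro rest, auto simp del: mult_Suc of_nat_mult)
  qed
qed

end

definition find_code :: com where
  "find_code = Loop (Block [Load 48 32]) 48 3 (Block [Sub 32 32 2])"

text \<open>Register 30 holds the stride already solved, a power of two, so the real division by 2
  yields the next integral stride. Only odd multiples of that stride remain to be filled in.\<close>

definition interp_code :: com where
  "interp_code =
    Block [Const 48 2, Div 31 30 48, Sub 32 33 2] ;; find_code ;;
    Block [Move 40 32, Move 44 31] ;; Loop (Block []) 19 44 fill_row_code ;;
    Block [Move 33 32, Move 30 31]"

context kmeans_seg begin

text \<open>Minimisers need not be unique and could be chosen in a nonmonotone way. The monotonicity
  of the chosen ones is therefore maintained explicitly; the next pass needs it to delimit its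
  scans.\<close>

definition mins :: "(nat \<Rightarrow> real) \<Rightarrow> nat \<Rightarrow> nat list \<Rightarrow> (nat \<Rightarrow> nat) \<Rightarrow> bool" where
  "mins M \<sigma> cs t \<longleftrightarrow> t 0 = 0 \<and> (\<forall>v. v * \<sigma> \<le> N \<longrightarrow> row_min (v * \<sigma>) (t v) \<and> t v \<in> set cs \<and>
    M (bT + v * \<sigma>) = real (t v) \<and> (0 < v \<longrightarrow> t (v - 1) \<le> t v))"

lemma wp_find:
  assumes cs: "cs \<noteq> []" "hd cs = 0" "sorted_wrt (<) cs" "arr M b cs" "b + length cs \<le> m"
    and R: "R 32 = real b + real (length cs) - 1" "R 2 = 1" "R 3 = 0"
    and f: "f \<ge> 4 * real (length cs)"
    and Q: "\<And>R' f'. R' 32 = real b \<Longrightarrow> \<forall>i<32. R' i = R i \<Longrightarrow> R' 33 = R 33 \<Longrightarrow>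
      f' \<ge> f - 4 * real (length cs) \<Longrightarrow> Q R' M Y f'"
  shows "wp m find_code Q R M Y f"
proof -
  define I where "I = (\<lambda>R' M' Y' f'. M' = M \<and> Y' = Y \<and> (\<exists>j<length cs. R' 32 = real b + real j \<and>
    (\<forall>i<32. R' i = R i) \<and> R' 33 = R 33 \<and> f' \<ge> f - 4 * (real (length cs) - 1 - real j)))"
  show ?thesis unfolding find_code_def
  proof (rule wp_Loop[where I = I])
    have "real (length cs - 1) = real (length cs) - 1" using cs(1) by (cases cs) auto
    then show "I R M Y f" unfolding I_def using cs(1) R
      by (intro conjI refl exI[of _ "length cs - 1"]) auto
  next
    fix R' M' Y' f' assume "I R' M' Y' f'"
    then show "0 \<le> f'" unfolding I_def using f by auto
  next
    fix R' M' Y' f' assume "I R' M' Y' f'"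
    then obtain j where MY: "M' = M" "Y' = Y" and j: "j < length cs" "R' 32 = real b + real j"
        "\<forall>i<32. R' i = R i" "R' 33 = R 33" "f' \<ge> f - 4 * (real (length cs) - 1 - real j)"
      unfolding I_def by blast
    have Mj: "M (b + j) = real (cs ! j)" "b + j < m" using cs(4,5) j(1) by (auto simp: arr_def)
    have "Q (R'(48 := real (cs ! j))) M Y (f' - 2)" if "cs ! j = 0"
    proof -
      have "j = 0"
      proof (rule ccontr)
        assume "j \<noteq> 0"
        then have "cs ! 0 < cs ! j" using sorted_wrt_nth_less[OF cs(3), of 0 j] j(1) by simp
        then show False using that by simp
      qed
      then show ?thesis using j by (intro Q) auto
    qed
    moreover have "I (R'(48 := real (cs ! j), 32 := real b + real j - 1)) M Y (f' - 4)"
      if nz: "cs ! j \<noteq> 0"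
    proof -
      obtain i where i: "j = Suc i"
        using nz cs(1,2) by (cases j) (auto simp: hd_conv_nth)
      show ?thesis unfolding I_def using i j by (intro conjI refl exI[of _ i]) auto
    qed
    ultimately show "wp m (Block [Load 48 32]) (\<lambda>R M Y f. (R 48 \<le> R 3 \<longrightarrow> Q R M Y (f - 1)) \<and>
           (R 3 < R 48 \<longrightarrow> wp m (Block [Sub 32 32 2]) (\<lambda>R M Y f. I R M Y (f - 1)) R M Y (f - 1))) R' M' Y' f'"
      using Mj j R MY by (intro wp_Block) (auto intro!: wp_Block)
  qed
qed

lemma wp_interp:
  assumes ok: "ok R M" and segs: "segs M (cs # css) e" "e \<le> m"
    and \<sigma>: "\<sigma> = 2 ^ length css" "\<sigma> \<le> N" and mins: "mins M (2 * \<sigma>) cs t"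
    and R: "R 30 = 2 * real \<sigma>" "R 33 = real e"
    and f: "f \<ge> 150 * (real N / real \<sigma>)"
    and Q: "\<And>R' M' f' t' b. segs M' css b \<Longrightarrow> b \<le> m \<Longrightarrow> mins M' \<sigma> cs t' \<Longrightarrow> R' 30 = real \<sigma> \<Longrightarrow>
      R' 33 = real b \<Longrightarrow> \<forall>r<30. R' r = R r \<Longrightarrow> \<forall>i. i < bT \<or> bK \<le> i \<longrightarrow> M' i = M i \<Longrightarrow>
      f' \<ge> f - 150 * (real N / real \<sigma>) \<Longrightarrow> Q R' M' Y f'"
  shows "wp m interp_code Q R M Y f"
proof -
  note okr = ok_regs[OF ok]
  have NW: "N < W" using aN layout(1) by simp
  obtain b where b: "e = b + length cs" "arr M b cs" "seg_ok \<sigma> cs" "segs M css b"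
    using segs(1) \<sigma>(1) by auto
  have cs: "cs \<noteq> []" "hd cs = 0" "sorted_wrt (<) cs" "set cs \<subseteq> {..N}" "covers \<sigma> {..N} (set cs)"
      "(length cs - 1) * \<sigma> \<le> N"
    using b(3) unfolding seg_ok_def by blast+
  have bC: "bC \<le> b" by (rule segs_ge[OF b(4)])
  define w where "w = real N / real \<sigma>"
  have spos: "\<sigma> > 0" using \<sigma>(1) by simp
  have w1: "w \<ge> 1" using \<sigma>(2) spos by (simp add: w_def)
  have "real (length cs - 1) * real \<sigma> \<le> real N" using cs(6) by (metis of_nat_le_iff of_nat_mult)
  then have "real (length cs - 1) \<le> w" using spos by (simp add: w_def pos_le_divide_eq)
  then have len: "real (length cs) \<le> 2 * w" using w1 by linarith
  \<comment> \<open>Rows of even index are inherited from the coarser stride, those of odd index are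
    solved below \<open>k\<close>.\<close>
  define G where "G t' M' k \<longleftrightarrow> (\<forall>v. v * \<sigma> \<le> N \<longrightarrow> even v \<or> v < k \<longrightarrow> row_min (v * \<sigma>) (t' v) \<and>
    t' v \<in> set cs \<and> M' (bT + v * \<sigma>) = real (t' v))" for t' :: "nat \<Rightarrow> nat" and M' :: "nat \<Rightarrow> real" and k
  define mono where "mono t' k \<longleftrightarrow> (\<forall>v. even v \<longrightarrow> Suc (Suc v) * \<sigma> \<le> N \<longrightarrow> t' v \<le> t' (Suc (Suc v))) \<and>
    (\<forall>v. 0 < v \<longrightarrow> v \<le> k \<longrightarrow> v * \<sigma> \<le> N \<longrightarrow> t' (v - 1) \<le> t' v)" for t' :: "nat \<Rightarrow> nat" and k
  \<comment> \<open>The list has at most 2 w entries, so walking back over it costs at most 8 w, and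
    5 w covers the five instructions around. In the invariant below, \<open>p\<close> is the
    position of the minimiser of row \<open>2 * u * \<sigma>\<close>; the scans telescope to 31
    units per position, and every filled row adds 63.\<close>
  define F where "F = f - 13 * w"
  define J where "J u p t' R' M' f' \<longleftrightarrow> p < length cs \<and> (2 * u * \<sigma> \<le> N \<longrightarrow> cs ! p = t' (2 * u)) \<and>
    t' 0 = 0 \<and> G t' M' (2 * u) \<and> mono t' (2 * u) \<and> (\<forall>i. i < bT \<or> bK \<le> i \<longrightarrow> M' i = M i) \<and>
    (\<forall>r<30. R' r = R r) \<and> R' 30 = 2 * real \<sigma> \<and> R' 31 = real \<sigma> \<and> R' 32 = real b \<and> R' 33 = real e \<and>
    R' 40 = real b + real p \<and> R' 44 = real (Suc (2 * u) * \<sigma>) \<and> real u \<le> w / 2 + 1 / 2 \<and>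
    f' \<ge> F - 31 * real p - 63 * real u" for u p t' R' M' f'
  define I where "I = (\<lambda>R' M' Y' f'. Y' = Y \<and> (\<exists>u p t'. J u p t' R' M' f'))"
  have nonneg: "0 \<le> f'" if I: "I R' M' Y' f'" for R' M' Y' f'
  proof -
    obtain u p t' where "J u p t' R' M' f'" using I unfolding I_def by blast
    then have "p < length cs" "real u \<le> w / 2 + 1 / 2" "f' \<ge> F - 31 * real p - 63 * real u"
      unfolding J_def by blast+
    then show ?thesis using f len w1 unfolding F_def w_def[symmetric] by simp
  qed
  \<comment> \<open>Row \<open>2 * k\<close> of the finer stride is row \<open>k\<close> of the
    coarser one. The values at odd indices are placeholders until these rows are filled.\<close>
  have init: "J 0 0 (\<lambda>v. t (v div 2)) R' M f'"
    if "\<forall>r<30. R' r = R r" "R' 30 = 2 * real \<sigma>" "R' 31 = real \<sigma>" "R' 32 = real b" "R' 33 = real e"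
      "R' 40 = real b" "R' 44 = real \<sigma>" "f' \<ge> F" for R' f'
  proof -
    have "G (\<lambda>v. t (v div 2)) M 0" unfolding G_def
    proof (intro allI impI)
      fix v assume "v * \<sigma> \<le> N" "even v \<or> v < 0"
      then obtain k where "v = 2 * k" by auto
      then show "row_min (v * \<sigma>) (t (v div 2)) \<and> t (v div 2) \<in> set cs \<and>
          M (bT + v * \<sigma>) = real (t (v div 2))"
        using mins \<open>v * \<sigma> \<le> N\<close> unfolding mins_def by (auto simp: ac_simps dest: spec[of _ k])
    qed
    moreover have "mono (\<lambda>v. t (v div 2)) 0" unfolding mono_def
    proof (intro conjI allI impI)
      fix v assume "even v" "Suc (Suc v) * \<sigma> \<le> N"
      then obtain k where "v = 2 * k" by auto
      then have "Suc k * (2 * \<sigma>) \<le> N" using \<open>Suc (Suc v) * \<sigma> \<le> N\<close> by (simp add: algebra_simps)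
      then show "t (v div 2) \<le> t (Suc (Suc v) div 2)"
        using mins \<open>v = 2 * k\<close> unfolding mins_def by (auto dest: spec[of _ "Suc k"])
    qed auto
    moreover have "t 0 = 0" using mins by (simp add: mins_def)
    moreover have "cs ! 0 = 0" using cs(1,2) by (simp add: hd_conv_nth)
    ultimately show ?thesis unfolding J_def using that cs(1) w1 by simp
  qed
  have final: "block_wp m [Move 33 32, Move 30 31] Q R' M' Y' (f' - 1)"
    if I: "I R' M' Y' f'" and exit: "R' 19 \<le> R' 44" for R' M' Y' f'
  proof -
    obtain u p t' where "J u p t' R' M' f'" and Y: "Y' = Y" using I unfolding I_def by blast
    then have J: "p < length cs" "t' 0 = 0" "G t' M' (2 * u)" "mono t' (2 * u)"
      "\<forall>i. i < bT \<or> bK \<le> i \<longrightarrow> M' i = M i" "\<forall>r<30. R' r = R r" "R' 30 = 2 * real \<sigma>"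
      "R' 31 = real \<sigma>" "R' 32 = real b" "R' 33 = real e" "R' 44 = real (Suc (2 * u) * \<sigma>)"
      "real u \<le> w / 2 + 1 / 2" "f' \<ge> F - 31 * real p - 63 * real u"
      unfolding J_def by blast+
    have "real (N + 1) \<le> real (Suc (2 * u) * \<sigma>)"
      using exit J(6,11) okr by (simp del: of_nat_mult mult_Suc)
    then have exN: "N < Suc (2 * u) * \<sigma>" unfolding of_nat_le_iff by simp
    have small: "v \<le> 2 * u" if "v * \<sigma> \<le> N" for v
    proof -
      have "v * \<sigma> < Suc (2 * u) * \<sigma>" using that exN by linarith
      then show ?thesis by (metis less_Suc_eq_le mult_less_cancel2)
    qed
    have "mins M' \<sigma> cs t'" unfolding mins_def
    proof (intro conjI allI impI)
      fix v assume v: "v * \<sigma> \<le> N"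
      have "even v \<or> v < 2 * u" using small[OF v] by (cases "v = 2 * u") auto
      then show "row_min (v * \<sigma>) (t' v)" "t' v \<in> set cs" "M' (bT + v * \<sigma>) = real (t' v)"
        using J(3) v unfolding G_def by blast+
      assume "0 < v"
      then show "t' (v - 1) \<le> t' v" using J(4) small[OF v] v unfolding mono_def by blast
    qed (rule J(2))
    moreover have "segs M' css b" using b(4)
      by (rule segs_frame) (use J(5) layout in auto)
    moreover have "b \<le> m" using segs(2) b(1) by simp
    moreover have "f' - 3 \<ge> f - 150 * (real N / real \<sigma>)"
      using J(1,12,13) len w1 unfolding F_def w_def[symmetric] by simp
    ultimately show ?thesis unfolding Y using J by (auto intro!: Q)
  qed
  have body: "wp m fill_row_code (\<lambda>R M Y f. I R M Y (f - 1)) R' M' Y' (f' - 1)"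
    if I: "I R' M' Y' f'" and cont: "R' 44 < R' 19" for R' M' Y' f'
  proof -
    obtain u p t' where "J u p t' R' M' f'" and Y: "Y' = Y" using I unfolding I_def by blast
    then have J: "p < length cs" "2 * u * \<sigma> \<le> N \<longrightarrow> cs ! p = t' (2 * u)"
      "t' 0 = 0" "G t' M' (2 * u)" "mono t' (2 * u)"
      "\<forall>i. i < bT \<or> bK \<le> i \<longrightarrow> M' i = M i" "\<forall>r<30. R' r = R r" "R' 30 = 2 * real \<sigma>"
      "R' 31 = real \<sigma>" "R' 32 = real b" "R' 33 = real e" "R' 40 = real b + real p"
      "R' 44 = real (Suc (2 * u) * \<sigma>)"
      "real u \<le> w / 2 + 1 / 2" "f' \<ge> F - 31 * real p - 63 * real u"
      unfolding J_def by blast+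
    have "real (Suc (2 * u) * \<sigma>) < real (N + 1)"
      using cont J(7,13) okr by (simp del: of_nat_mult mult_Suc)
    then have rN: "Suc (2 * u) * \<sigma> \<le> N" unfolding of_nat_less_iff by simp
    then have uN: "2 * u * \<sigma> \<le> N" by simp
    have u: "real u \<le> w / 2 - 1 / 2"
    proof -
      have "(2 * real u + 1) * real \<sigma> \<le> real N"
        using rN by (metis (no_types, lifting) of_nat_1 of_nat_Suc of_nat_add of_nat_le_iff
          of_nat_mult of_nat_numeral add.commute)
      then have "2 * real u + 1 \<le> w" using spos by (simp add: w_def pos_le_divide_eq)
      then show ?thesis by simp
    qed
    define t2 where "t2 = (if Suc (Suc (2 * u)) * \<sigma> \<le> N then t' (Suc (Suc (2 * u))) else N)"
    have cp: "cs ! p = t' (2 * u)" using J(2) uN by blast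
    have G2: "row_min (Suc (Suc (2 * u)) * \<sigma>) t2 \<and> t2 \<in> set cs \<and> cs ! p \<le> t2 \<and>
        M' (bT + Suc (Suc (2 * u)) * \<sigma>) = real t2" if s: "Suc (Suc (2 * u)) * \<sigma> \<le> N"
    proof -
      have "even (Suc (Suc (2 * u)))" "even (2 * u)" by auto
      moreover have "t2 = t' (Suc (Suc (2 * u)))" using s by (simp add: t2_def)
      ultimately show ?thesis using J(4,5) s unfolding G_def mono_def cp by metis
    qed
    show ?thesis
    proof (rule wp_fill_row[where cs = cs and ps = b and \<sigma> = \<sigma> and p = p and u = "2 * u" and ?t2.0 = t2],
        goal_cases)
      case 1 show ?case by (rule ok_frame[OF ok]) (use J(6,7) layout in auto)
    next
      case 5 show ?case using b(2) by (rule arr_frame) (use J(6) bC layout in auto)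
    next
      case 13
      have "even (2 * u)" by simp
      then show ?case using J(4) uN unfolding G_def cp by blast
    next
      case 15 then show ?case using G2 by blast
    next
      case 16 then show ?case by (simp add: t2_def)
    next
      case 17 show ?case using J(1,15) u f len w1 unfolding F_def w_def[symmetric] by simp
    next
      case (18 R1 f1 p' c)
      define t1 where "t1 = t'(Suc (2 * u) := c)"
      let ?M = "M'(bT + Suc (2 * u) * \<sigma> := real c)"
      have inj: "v * \<sigma> = Suc (2 * u) * \<sigma> \<longleftrightarrow> v = Suc (2 * u)" for v
        using spos by (metis mult_right_cancel not_gr_zero)
      have G': "G t1 ?M (2 * Suc u)" unfolding G_def
      proof (intro allI impI)
        fix v assume v: "v * \<sigma> \<le> N" "even v \<or> v < 2 * Suc u"
        show "row_min (v * \<sigma>) (t1 v) \<and> t1 v \<in> set cs \<and> ?M (bT + v * \<sigma>) = real (t1 v)"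
        proof (cases "v = Suc (2 * u)")
          case True
          then show ?thesis using 18(1,2) by (simp add: t1_def)
        next
          case False
          then have "bT + v * \<sigma> \<noteq> bT + Suc (2 * u) * \<sigma>" using inj[of v] by simp
          moreover have "even v \<or> v < 2 * u" using v False by (cases "v = 2 * u") auto
          then have "row_min (v * \<sigma>) (t' v) \<and> t' v \<in> set cs \<and> M' (bT + v * \<sigma>) = real (t' v)"
            using J(4) v(1) unfolding G_def by blast
          ultimately show ?thesis using False unfolding t1_def by (simp del: mult_Suc)
        qed
      qed
      have mono': "mono t1 (2 * Suc u)" unfolding mono_def
      proof (intro conjI allI impI)
        fix v assume v: "even v" "Suc (Suc v) * \<sigma> \<le> N"
        then have "v \<noteq> Suc (2 * u)" "Suc (Suc v) \<noteq> Suc (2 * u)" by presburger+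
        then show "t1 v \<le> t1 (Suc (Suc v))" using J(5) v unfolding mono_def t1_def by simp
      next
        fix v assume v: "0 < v" "v \<le> 2 * Suc u" "v * \<sigma> \<le> N"
        have "v \<le> 2 * u \<or> v = Suc (2 * u) \<or> v = Suc (Suc (2 * u))" using v(2) by (simp add: le_Suc_eq)
        then consider "v \<le> 2 * u" | "v = Suc (2 * u)" | "v = Suc (Suc (2 * u))" by blast
        then show "t1 (v - 1) \<le> t1 v"
        proof cases
          case 1
          then have "t' (v - 1) \<le> t' v" "v \<noteq> Suc (2 * u)" "v - 1 \<noteq> Suc (2 * u)"
            using J(5) v unfolding mono_def by auto
          then show ?thesis by (simp add: t1_def)
        next
          case 2
          then show ?thesis using 18(3) by (simp add: t1_def cp)
        next
          case 3
          then have "t2 = t' v" using v by (simp add: t2_def)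
          then show ?thesis using 18(4) 3 by (simp add: t1_def)
        qed
      qed
      have "J (Suc u) p' t1 R1 ?M (f1 - 1)"
        unfolding J_def
      proof (intro conjI)
        show "2 * Suc u * \<sigma> \<le> N \<longrightarrow> cs ! p' = t1 (2 * Suc u)"
          using 18(7) by (auto simp: t1_def t2_def)
        have "bT \<le> bT + Suc (2 * u) * \<sigma>" "bT + Suc (2 * u) * \<sigma> < bK"
          using rN NW layout by linarith+
        then show "\<forall>i. i < bT \<or> bK \<le> i \<longrightarrow> ?M i = M i" using J(6) by auto
        show "R1 44 = real (Suc (2 * Suc u) * \<sigma>)" using 18(10) by simp
        show "real (Suc u) \<le> w / 2 + 1 / 2" using u by simp
        show "f1 - 1 \<ge> F - 31 * real p' - 63 * real (Suc u)" using 18(11) J(15) by simp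
      qed (use 18 J G' mono' in \<open>auto simp: t1_def\<close>)
      then show ?case unfolding I_def using Y by blast
    qed (use J b cs rN segs(2) in auto)
  qed
  show ?thesis unfolding interp_code_def
  proof (rule wp_Seq, rule wp_Block, simp add: R okr, rule wp_Seq,
      rule wp_find[where cs = cs and b = b], goal_cases)
    case 9 show ?case using f len w1 unfolding w_def[symmetric] by simp
  next
    case (10 R1 f1)
    have "J 0 0 (\<lambda>v. t (v div 2)) (R1(40 := real b, 44 := real \<sigma>)) M (f1 - 2)"
    proof (rule init)
      show "f1 - 2 \<ge> F" using 10(4) len w1 by (simp add: F_def)
      show "(R1(40 := real b, 44 := real \<sigma>)) 33 = real e" using 10(3) R by simp
    qed (use 10(1,2) R in auto)
    then have I0: "I (R1(40 := real b, 44 := real \<sigma>)) M Y (f1 - 2)" unfolding I_def by blast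
    have R131: "R1 31 = real \<sigma>" using 10(2) by simp
    show ?case
      apply (rule wp_Seq, rule wp_Block, simp add: 10(1) R131)
      apply (rule wp_Seq, rule wp_Loop[where I = I], rule I0[simplified], erule nonneg)
      apply (rule wp_Block, simp only: block_wp.simps, intro conjI impI)
       apply (rule wp_Block, erule (1) final)
      apply (erule (1) body)
      done
  qed (use b cs segs(2) okr in auto)
qed

end

section \<open>One complete layer of the dynamic program\<close>

definition smawk_code :: com where
  "smawk_code = descend_code ;; Block [Move 30 31, Store 8 3] ;; Loop (Block []) 30 2 interp_code"

text \<open>The rows are treated from N down to 0, which allows the layer to be overwritten in
  place: row \<open>j\<close> reads the old layer and the old crossing positions only at some
  \<open>t \<le> j\<close>. The first conditional moves a minimiser beyond the diagonal back onto
  it; the second leaves the crossing positions alone until the middle layer has been passed.\<close>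

definition update_code :: com where
  "update_code =
    Block [Sub 40 40 2, Add 48 8 40, Load 43 48] ;;
    Cond 43 40 (Block []) (Block [Move 43 40]) ;;
    row_code 40 43 ;;
    Block [Add 48 6 40, Store 48 50] ;;
    Cond 23 22 (Block []) (Block [Add 48 7 43, Load 49 48, Add 48 7 40, Store 48 49])"

definition layer_code :: com where
  "layer_code = smawk_code ;; Block [Move 40 19] ;; Loop (Block []) 40 3 update_code"

context kmeans_seg begin

lemma wp_smawk:
  assumes ok: "ok R M" and f: "f \<ge> 1000 * real (N + 1)"
    and Q: "\<And>R' M' f' t. \<forall>v\<le>N. row_min v (t v) \<and> M' (bT + v) = real (t v) \<Longrightarrow>
      \<forall>r<30. R' r = R r \<Longrightarrow> \<forall>i. i < bT \<or> bK \<le> i \<and> i < bC \<longrightarrow> M' i = M i \<Longrightarrow>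
      f' \<ge> f - 1000 * real (N + 1) \<Longrightarrow> Q R' M' Y f'"
  shows "wp m smawk_code Q R M Y f"
proof -
  note okr = ok_regs[OF ok]
  have NW: "N < W" using aN layout(1) by simp
  define F where "F = f - 1000 * real (N + 1) + 1"
  \<comment> \<open>A pass from stride 2 \<sigma> to \<sigma> costs 150 N/\<sigma> and two units for
    test and jump, hence at most 152 N/\<sigma>, the difference between 304 N/\<sigma> and 304 N/(2
    \<sigma>).\<close>
  define J where "J css cs e t R' M' f' \<longleftrightarrow> segs M' css e \<and> e \<le> m \<and> R' 30 = 2 ^ length css \<and>
    R' 33 = real e \<and> mins M' (2 ^ length css) cs t \<and> (css \<noteq> [] \<longrightarrow> set cs \<subseteq> set (hd css)) \<and>
    (\<forall>r<30. R' r = R r) \<and> (\<forall>i. i < bT \<or> bK \<le> i \<and> i < bC \<longrightarrow> M' i = M i) \<and>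
    f' \<ge> F + 304 * real N - 304 * (real N / 2 ^ length css)"
    for css cs e t R' M' f'
  define I where "I = (\<lambda>R' M' Y' f'. Y' = Y \<and> (\<exists>css cs e t. J css cs e t R' M' f'))"
  have nonneg: "0 \<le> f'" if I: "I R' M' Y' f'" for R' M' Y' f'
  proof -
    obtain css cs e t where "J css cs e t R' M' f'" using I unfolding I_def by blast
    then have "f' \<ge> F + 304 * real N - 304 * (real N / 2 ^ length css)" unfolding J_def by blast
    moreover have "real N / 2 ^ length css \<le> real N" by (simp add: divide_le_eq mult_le_cancel_left1)
    ultimately show ?thesis using f unfolding F_def by linarith
  qed
  have exit: "Q R' M' Y' (f' - 1)" if I: "I R' M' Y' f'" and ex: "R' 30 \<le> R' 2" for R' M' Y' f'
  proof -
    obtain css cs e t where "J css cs e t R' M' f'" and Y: "Y' = Y" using I unfolding I_def by blast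
    then have J: "R' 30 = 2 ^ length css" "mins M' (2 ^ length css) cs t" "\<forall>r<30. R' r = R r"
        "\<forall>i. i < bT \<or> bK \<le> i \<and> i < bC \<longrightarrow> M' i = M i"
        "f' \<ge> F + 304 * real N - 304 * (real N / 2 ^ length css)"
      unfolding J_def by blast+
    have "(2::real) ^ length css \<le> 1" using ex J(1,3) okr by simp
    then have "\<not> 0 < length css" using one_less_power[of "2::real" "length css"] by linarith
    then have "length css = 0" by blast
    then show ?thesis unfolding Y using J by (intro Q[where t = t]) (auto simp: mins_def F_def)
  qed
  have body: "wp m interp_code (\<lambda>R M Y f. I R M Y (f - 1)) R' M' Y' (f' - 1)"
    if I: "I R' M' Y' f'" and cont: "R' 2 < R' 30" for R' M' Y' f'
  proof -
    obtain css0 cs0 e t where "J css0 cs0 e t R' M' f'" and Y: "Y' = Y" using I unfolding I_def by blast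
    then have J: "segs M' css0 e" "e \<le> m" "R' 30 = 2 ^ length css0"
        "R' 33 = real e" "mins M' (2 ^ length css0) cs0 t" "css0 \<noteq> [] \<longrightarrow> set cs0 \<subseteq> set (hd css0)"
        "\<forall>r<30. R' r = R r"  "\<forall>i. i < bT \<or> bK \<le> i \<and> i < bC \<longrightarrow> M' i = M i"
        "f' \<ge> F + 304 * real N - 304 * (real N / 2 ^ length css0)"
      unfolding J_def by blast+
    have "(2::real) ^ length css0 > 1" using cont J(3,7) okr by simp
    then obtain cs css where css: "css0 = cs # css" by (cases css0) auto
    define \<sigma> where "\<sigma> = (2::nat) ^ length css"
    have "seg_ok \<sigma> cs" and sub: "css \<noteq> [] \<longrightarrow> set cs \<subseteq> set (hd css)"
      using J(1) by (auto simp: css \<sigma>_def)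
    then have \<sigma>N: "\<sigma> \<le> N" by (simp add: seg_ok_def)
    have s: "real \<sigma> = 2 ^ length css" "\<sigma> > 0" by (auto simp: \<sigma>_def)
    \<comment> \<open>The column lists are nested, so the minimisers of the coarser stride occur in
      the list of the finer one.\<close>
    have mins': "mins M' (2 * \<sigma>) cs t"
      using J(5,6) unfolding mins_def css \<sigma>_def by auto
    define w where "w = real N / real \<sigma>"
    have w1: "w \<ge> 1" using \<sigma>N s(2) by (simp add: w_def)
    have "304 * (real N / 2 ^ length css0) = 152 * w" by (simp add: css w_def s)
    then have f': "f' \<ge> F + 304 * real N - 152 * w" using J(9) by simp
    have wN: "w \<le> real N" using s(2) by (simp add: w_def divide_le_eq mult_le_cancel_left1)
    show ?thesis
    proof (rule wp_interp[where cs = cs and css = css and e = e and \<sigma> = \<sigma> and t = t], goal_cases)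
      case 1 show ?case by (rule ok_frame[OF ok]) (use J(7,8) layout in auto)
    next
      case 9 show ?case using f' f w1 wN unfolding w_def[symmetric] F_def by simp
    next
      case (10 R1 M1 f1 t1 b)
      have "J css cs b t1 R1 M1 (f1 - 1)"
        unfolding J_def
      proof (intro conjI)
        have "real N / 2 ^ length css = w" by (simp add: w_def s)
        then show "f1 - 1 \<ge> F + 304 * real N - 304 * (real N / 2 ^ length css)"
          using 10(8) f' w1 unfolding w_def[symmetric] by simp
        show "\<forall>i. i < bT \<or> bK \<le> i \<and> i < bC \<longrightarrow> M1 i = M i" using 10(7) J(8) by simp
      qed (use 10 J sub s in \<open>auto simp: \<sigma>_def\<close>)
      then show ?case unfolding I_def using Y by blast
    qed (use J css mins' s \<sigma>N in \<open>auto simp: \<sigma>_def\<close>)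
  qed
  show ?thesis unfolding smawk_code_def
  proof (rule wp_Seq, rule wp_descend[OF ok], goal_cases)
    case 1 show ?case using f by simp
  next
    case (2 R1 M1 f1 css e)
    have bT: "bT < m" "bT < bC" "\<not> bT < bT" "\<not> bK \<le> bT" using layout by linarith+
    \<comment> \<open>The stride now exceeds N, so row 0 is its only row and column 0 minimises it.
      The list \<open>[0]\<close>, which is not stored, plays the part of a column list for this
      stride.\<close>
    have "J css [0] e (\<lambda>_. 0) (R1(30 := 2 ^ length css)) (M1(bT := 0)) (f1 - 2)"
      unfolding J_def
    proof (intro conjI)
      show "segs (M1(bT := 0)) css e" using 2(1) by (rule segs_frame) (use bT in auto)
      show "mins (M1(bT := 0)) (2 ^ length css) [0] (\<lambda>_. 0)"
        unfolding mins_def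
      proof (intro conjI allI impI)
        fix v assume "v * 2 ^ length css \<le> N"
        then have "v = 0" using 2(3) by (cases v) auto
        then show "row_min (v * 2 ^ length css) 0" "(M1(bT := 0)) (bT + v * 2 ^ length css) = real 0"
          using first_row by (auto simp: row_min_def)
      qed auto
      show "css \<noteq> [] \<longrightarrow> set [0] \<subseteq> set (hd css)"
      proof
        assume "css \<noteq> []"
        then obtain cs css' where "css = cs # css'" by (cases css) auto
        then have "cs \<noteq> []" "hd cs = 0" "hd css = cs" using 2(1) by (auto simp: seg_ok_def)
        then show "set [0] \<subseteq> set (hd css)" using hd_in_set[of cs] by simp
      qed
      define z where "z = real N / 2 ^ length css"
      have "z \<ge> 0" by (simp add: z_def)
      then show "f1 - 2 \<ge> F + 304 * real N - 304 * (real N / 2 ^ length css)"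
        using 2(8) unfolding F_def z_def[symmetric] by simp
      show "\<forall>i. i < bT \<or> bK \<le> i \<and> i < bC \<longrightarrow> (M1(bT := 0)) i = M i"
        using 2(6) bT by auto
    qed (use 2 in auto)
    then have I0: "I (R1(30 := 2 ^ length css)) (M1(bT := 0)) Y (f1 - 2)"
      unfolding I_def by blast
    have "R1 8 = real bT" "R1 3 = 0" using 2(7) okr by auto
    then show ?case
      apply (intro wp_Seq wp_Block)
      apply (simp add: 2(4) bT)
      apply (rule wp_Loop[where I = I], rule I0[simplified], erule nonneg)
      apply (rule wp_Block, simp only: block_wp.simps, intro conjI impI)
       apply (erule (1) exit)
      apply (erule (1) body)
      done
  qed
qed

lemma wp_layer:
  assumes ok: "ok R M" and H: "\<forall>j\<le>N. M (bH + j) = real (H j)"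
    and R: "R 22 = real h" "R 23 = real i"
    and f: "f \<ge> 1040 * real (N + 1)"
    and Q: "\<And>R' M' f' t. dp (Suc q) a N M' \<Longrightarrow> \<forall>j\<le>N. t j \<le> j \<and>
        opt x (Suc q) a (a + j) = opt x q a (a + t j) + sse x (a + t j) (a + j) \<and>
        M' (bH + j) = real (if i \<le> h then H j else H (t j)) \<Longrightarrow>
      \<forall>r<30. R' r = R r \<Longrightarrow> \<forall>i. i < bP \<or> bK \<le> i \<and> i < bC \<longrightarrow> M' i = M i \<Longrightarrow>
      f' \<ge> f - 1040 * real (N + 1) \<Longrightarrow> Q R' M' Y f'"
  shows "wp m layer_code Q R M Y f"
proof -
  note okr = ok_regs[OF ok]
  have NW: "N < W" using aN layout(1) by simp
  have gl: "glob R M" "seg a N R" "dp q a N M" using ok by (auto simp: ok_def)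
  have R67: "R 6 = real bP" "R 7 = real bH" using gl(1) by (auto simp: glob_def)
  show ?thesis unfolding layer_code_def
  proof (rule wp_Seq, rule wp_smawk[OF ok], goal_cases)
    case 1 show ?case using f by simp
  next
    case (2 R1 M1 f1 t0)
    \<comment> \<open>The minimiser cut down to the diagonal; \<open>t j \<le> j\<close> is what
      makes the update in place safe.\<close>
    define t where "t j = min (t0 j) j" for j
    have t: "opt x (Suc q) a (a + j) = row_cost x q a j (t j)" "t j \<le> j" if "j \<le> N" for j
    proof -
      have "row_min j (t0 j)" using 2(1) that by blast
      then show "opt x (Suc q) a (a + j) = row_cost x q a j (t j)"
        unfolding t_def row_min_def by (intro opt_Suc_row_min[of N]) (use that in auto)
      show "t j \<le> j" by (simp add: t_def)
    qed
    define newH where "newH j = (if i \<le> h then H j else H (t j))" for j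
    define J where "J k R' M' f' \<longleftrightarrow> k \<le> N + 1 \<and> (\<forall>r<30. R' r = R r) \<and> R' 40 = real k \<and>
      (\<forall>j\<le>N. M' (bP + j) = opt x (if j < k then q else Suc q) a (a + j)) \<and>
      (\<forall>j\<le>N. M' (bH + j) = real (if j < k then H j else newH j)) \<and>
      (\<forall>j\<le>N. M' (bT + j) = real (t0 j)) \<and>
      (\<forall>i. i < bP \<or> bK \<le> i \<and> i < bC \<longrightarrow> M' i = M i) \<and>
      f' \<ge> f - 1040 * real (N + 1) + 1 + 38 * real k" for k R' M' f'
    define I where "I = (\<lambda>R' M' Y' f'. Y' = Y \<and> (\<exists>k. J k R' M' f'))"
    have nonneg: "0 \<le> f'" if "I R' M' Y' f'" for R' M' Y' f'
      using that f unfolding I_def J_def by auto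
    have exit: "Q R' M' Y' (f' - 1)" if I: "I R' M' Y' f'" and ex: "R' 40 \<le> R' 3" for R' M' Y' f'
    proof -
      obtain k where J: "J k R' M' f'" and Y: "Y' = Y" using I unfolding I_def by blast
      have "k = 0" using J ex okr unfolding J_def by simp
      then show ?thesis unfolding Y using J t
        by (intro Q[where t = t]) (auto simp: J_def dp_def row_cost_def newH_def)
    qed
    have body: "wp m update_code (\<lambda>R M Y f. I R M Y (f - 1)) R' M' Y' (f' - 1)"
      if I: "I R' M' Y' f'" and cont: "R' 3 < R' 40" for R' M' Y' f'
    proof -
      obtain k0 where "J k0 R' M' f'" and Y: "Y' = Y" using I unfolding I_def by blast
      then have J: "k0 \<le> N + 1" "\<forall>r<30. R' r = R r" "R' 40 = real k0"
        "\<forall>j\<le>N. M' (bP + j) = opt x (if j < k0 then q else Suc q) a (a + j)"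
        "\<forall>j\<le>N. M' (bH + j) = real (if j < k0 then H j else newH j)"
        "\<forall>j\<le>N. M' (bT + j) = real (t0 j)"
        "\<forall>i. i < bP \<or> bK \<le> i \<and> i < bC \<longrightarrow> M' i = M i"
        "f' \<ge> f - 1040 * real (N + 1) + 1 + 38 * real k0"
        unfolding J_def by blast+
      have "k0 \<noteq> 0" using cont J(2,3) okr by auto
      then obtain k where k: "k0 = Suc k" "k \<le> N" using J(1) by (cases k0) auto
      have R40: "R' 40 - R' 2 = real k" using J(2,3) okr k by simp
      have adr: "bT + k < m" "bP + k < m" "bH + k < m" "bH + t k < m" "t k \<le> N"
        using k t(2)[OF k(2)] NW layout by linarith+
      have rest: "wp m (row_code 40 43 ;; Block [Add 48 6 40, Store 48 50] ;;
          Cond 23 22 (Block []) (Block [Add 48 7 43, Load 49 48, Add 48 7 40, Store 48 49]))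
          (\<lambda>R M Y f. I R M Y (f - 1)) R2 M' Y f2"
        if R2: "\<forall>r<30. R2 r = R r" "R2 40 = real k" "R2 43 = real (t k)" and f2: "f2 \<ge> f' - 7" for R2 f2
      proof (rule wp_Seq, rule wp_row_code[where a = a and N = N and q = q and r = k and c = "t k"], goal_cases)
        case 1 show ?case by (rule glob_frame[OF gl(1)]) (use R2 J(7) in auto)
      next
        case 2 show ?case by (rule seg_frame[OF gl(2)]) (use R2 in auto)
      next
        case 3 show ?case using J(4) adr(5) t(2)[OF k(2)] k(1) by auto
      next
        case (10 R3 f3)
        have R3: "\<forall>r<30. R3 r = R r" "R3 40 = real k" "R3 43 = real (t k)"
            "R3 50 = opt x (Suc q) a (a + k)"
          using 10(1,2) R2 t(1)[OF k(2)] by auto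
        define M2 where "M2 = M'(bP + k := opt x (Suc q) a (a + k))"
        have disj: "bP + k < bH" "bH + k < bT" "bP \<le> bP + k" using k(2) NW layout by linarith+
        have M2H: "M2 (bH + j) = real (if j < Suc k then H j else newH j)"
            "M2 (bT + j) = real (t0 j)" "M2 (bP + j) = opt x (if j < k then q else Suc q) a (a + j)"
          if "j \<le> N" for j
          using J(4-6) that disj k by (auto simp: M2_def)
        have M2f: "\<forall>i. i < bP \<or> bK \<le> i \<and> i < bC \<longrightarrow> M2 i = M i"
          using J(7) disj layout by (auto simp: M2_def)
        have J': "J k R4 (M2(bH + k := real (newH k))) f4"
          if "\<forall>r<30. R4 r = R r" "R4 40 = real k" "f4 \<ge> f3 - 9" for R4 f4
          unfolding J_def
        proof (intro conjI)
          show "f4 \<ge> f - 1040 * real (N + 1) + 1 + 38 * real k"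
            using that(3) 10(3) f2 J(8) k(1) by simp
          show "\<forall>j\<le>N. (M2(bH + k := real (newH k))) (bP + j) = opt x (if j < k then q else Suc q) a (a + j)"
            "\<forall>j\<le>N. (M2(bH + k := real (newH k))) (bT + j) = real (t0 j)"
            "\<forall>j\<le>N. (M2(bH + k := real (newH k))) (bH + j) = real (if j < k then H j else newH j)"
            "\<forall>i. i < bP \<or> bK \<le> i \<and> i < bC \<longrightarrow> (M2(bH + k := real (newH k))) i = M i"
            using M2H M2f NW layout disj k(2) by auto
        qed (use that k in auto)
        have HtK: "M2 (bH + t k) = real (H (t k))" using M2H(1)[OF adr(5)] t(2)[OF k(2)] by simp
        have R3': "R3 6 = real bP" "R3 7 = real bH" "R3 22 = real h" "R3 23 = real i"
          using R3(1) R67 R by auto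
        show ?case
        proof (rule wp_Seq, rule wp_Block, simp add: R3 R3' adr, fold M2_def, rule wp_Cond, goal_cases)
          case 1
          then have "newH k = H k" using R3' by (simp add: newH_def)
          moreover have "M2 (bH + k) = real (H k)" using M2H(1)[OF k(2)] by simp
          ultimately have M2id: "M2(bH + k := real (newH k)) = M2" by auto
          have "I (R3(48 := real bP + real k)) M2 Y (f3 - 1 - 1 - 1 - 1)"
            unfolding I_def using J'[of "R3(48 := real bP + real k)" "f3 - 1 - 1 - 1 - 1"] R3
            by (auto simp: M2id)
          then show ?case by (intro wp_Block) simp
        next
          case 2
          then have "newH k = H (t k)" using R3' by (simp add: newH_def)
          then show ?case using R3 R3' adr HtK
            J'[of "R3(48 := real bH + real k, 49 := real (H (t k)))" "f3 - 9"]
            by (intro wp_Block) (auto simp: I_def fun_upd_twist)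
        qed
      qed (use R2 k adr in auto)
      show ?thesis unfolding update_code_def Y
      proof (rule wp_Seq, rule wp_Block, simp add: R40, goal_cases)
        case 1
        have R8: "R' 8 = real bT" using J(2) okr by simp
        have T: "M' (bT + k) = real (t0 k)" using J(6) k(2) by blast
        show ?case
          apply (simp add: R8 adr T)
          apply (rule wp_Seq, rule wp_Cond)
           apply (rule wp_Block, simp, rule rest)
              apply (use J(2) in \<open>auto simp: t_def\<close>)[4]
          apply (rule wp_Block, simp, rule rest)
             apply (use J(2) in \<open>auto simp: t_def\<close>)[4]
          done
      qed
    qed
    have "J (N + 1) (R1(40 := real N + 1)) M1 (f1 - 1)"
      unfolding J_def
    proof (intro conjI)
      have "bP + j < bT" "bH + j < bT" if "j \<le> N" for j using that NW layout by linarith+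
      then show "\<forall>j\<le>N. M1 (bP + j) = opt x (if j < N + 1 then q else Suc q) a (a + j)"
        "\<forall>j\<le>N. M1 (bH + j) = real (if j < N + 1 then H j else newH j)"
        using 2(3) gl(3) H by (auto simp: dp_def)
      show "\<forall>i. i < bP \<or> bK \<le> i \<and> i < bC \<longrightarrow> M1 i = M i" using 2(3) layout by auto
      show "f1 - 1 \<ge> f - 1040 * real (N + 1) + 1 + 38 * real (N + 1)" using 2(4) by simp
    qed (use 2 in auto)
    then have I0: "I (R1(40 := real N + 1)) M1 Y (f1 - 1)" unfolding I_def by blast
    have "R1 19 = real N + 1" using 2(2) okr by simp
    then show ?case
      apply (intro wp_Seq wp_Block)
      apply simp
      apply (rule wp_Loop[where I = I], rule I0, erule nonneg)
      apply (rule wp_Block, simp only: block_wp.simps, intro conjI impI)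
       apply (erule (1) exit)
      apply (erule (1) body)
      done
  qed
qed

end

section \<open>Splitting a clustering in the middle\<close>

text \<open>\<open>c\<close> is where some optimal partition of the first \<open>j\<close> points into \<open>k + 1\<close> clusters has placed
  its first \<open>h\<close> clusters; before layer \<open>h\<close> is reached, it is the identity.\<close>

definition cut :: "(nat \<Rightarrow> real) \<Rightarrow> nat \<Rightarrow> nat \<Rightarrow> nat \<Rightarrow> nat \<Rightarrow> nat \<Rightarrow> bool" where
  "cut x h k a j c \<longleftrightarrow> c \<le> j \<and> (if k < h then c = j else
     opt x k a (a + j) = opt x (h - 1) a (a + c) + opt x (k - h) (a + c) (a + j))"

text \<open>Appending the last cluster to the part right of \<open>c\<close> gives a sum that is at
  least the sum of the two optima, and by \<open>opt_concat\<close> this is at least the optimum for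
  the whole. As the appended partition is optimal, equality holds throughout. If layer
  \<open>h\<close> is just being reached, the crossing position is the start of the last
  cluster.\<close>

lemma cut_Suc:
  assumes "0 < h" "cut x h k a t c" "t \<le> j" "\<not> Suc k < h"
    and eq: "opt x (Suc k) a (a + j) = opt x k a (a + t) + sse x (a + t) (a + j)"
  shows "cut x h (Suc k) a j c"
proof (cases "k < h")
  case True
  then have "h = Suc k" "c = t" using assms by (auto simp: cut_def)
  then show ?thesis using assms by (simp add: cut_def)
next
  case False
  then have c: "c \<le> t" "opt x k a (a + t) = opt x (h - 1) a (a + c) + opt x (k - h) (a + c) (a + t)"
    using assms(2) by (auto simp: cut_def)
  have "opt x (Suc (k - h)) (a + c) (a + j) \<le> opt x (k - h) (a + c) (a + t) + sse x (a + t) (a + j)"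
    using c assms(3) by (intro opt_Suc_le) auto
  moreover have "opt x (Suc ((h - 1) + Suc (k - h))) a (a + j)
      \<le> opt x (h - 1) a (a + c) + opt x (Suc (k - h)) (a + c) (a + j)"
    using c(1) assms(3) by (intro opt_concat) auto
  moreover have "Suc ((h - 1) + Suc (k - h)) = Suc k" "Suc k - h = Suc (k - h)"
    using False assms(1) by auto
  ultimately show ?thesis using c assms(3,4) eq by (simp add: cut_def)
qed

text \<open>Rounding is impossible, so q div 2 is found by increasing a counter until 2 h + 1
  reaches q. The time of order q is within the budget of a split.\<close>

definition half_code :: com where
  "half_code = Loop (Block [Add 48 22 22, Add 48 48 2]) 16 48 (Block [Add 22 22 2])"

definition first_layer_code :: com where
  "first_layer_code = Loop (Block []) 19 40 (sse_code 40 3 ;;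
     Block [Add 48 6 40, Store 48 50, Add 48 7 40, Store 48 40, Add 40 40 2])"

text \<open>Register 23 is the number of clusters in the layer about to be computed. It is two ahead
  of the index of the stored layer, because that index is one less than its number of
  clusters.\<close>

definition layers_code :: com where
  "layers_code = Loop (Block []) 24 23 (layer_code ;; Block [Add 23 23 2])"

definition split_code :: com where
  "split_code =
    Block [Sub 18 17 15, Add 19 18 2, Add 20 4 15, Add 21 5 15, Add 24 16 2, Const 22 1] ;;
    half_code ;; Block [Const 40 0] ;; first_layer_code ;; Block [Const 23 2] ;; layers_code ;;
    Block [Add 48 7 18, Load 25 48]"

context kmeans_ram begin

lemma wp_half:
  assumes R: "R 16 = real q" "R 22 = 1" "R 2 = 1" "2 \<le> q" and f: "f \<ge> 5 * real q"
    and Q: "\<And>R' f'. R' 22 = real (q div 2) \<Longrightarrow> \<forall>r<22. R' r = R r \<Longrightarrow> R' 24 = R 24 \<Longrightarrow>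
      f' \<ge> f - 5 * real q \<Longrightarrow> Q R' M Y f'"
  shows "wp m half_code Q R M Y f"
proof -
  define I where "I = (\<lambda>R' M' Y' f'. M' = M \<and> Y' = Y \<and> (\<exists>h. 0 < h \<and> 2 * h \<le> q \<and> R' 22 = real h \<and>
    (\<forall>r<22. R' r = R r) \<and> R' 24 = R 24 \<and> f' \<ge> f - 5 * (real h - 1)))"
  show ?thesis unfolding half_code_def
  proof (rule wp_Loop[where I = I])
    show "I R M Y f" unfolding I_def using R by (intro conjI refl exI[of _ 1]) auto
  next
    fix R' M' Y' f' assume "I R' M' Y' f'"
    then obtain h where "2 * h \<le> q" "f' \<ge> f - 5 * (real h - 1)" unfolding I_def by blast
    then show "0 \<le> f'" using f by simp
  next
    fix R' M' Y' f' assume "I R' M' Y' f'"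
    then obtain h where MY: "M' = M" "Y' = Y" and h: "0 < h" "2 * h \<le> q" "R' 22 = real h"
        "\<forall>r<22. R' r = R r" "R' 24 = R 24" "f' \<ge> f - 5 * (real h - 1)"
      unfolding I_def by blast
    have "Q (R'(48 := real h + real h + 1)) M Y (f' - 3)" if "real q \<le> real h + real h + 1"
    proof -
      have "q = 2 * h \<or> q = 2 * h + 1" using that h(2) by linarith
      then have "h = q div 2" by auto
      then show ?thesis using h by (intro Q) auto
    qed
    moreover have "I (R'(48 := real h + real h + 1, 22 := real h + 1)) M Y (f' - 5)"
      if "real h + real h + 1 < real q"
      unfolding I_def using h that by (intro conjI refl exI[of _ "Suc h"]) auto
    ultimately show "wp m (Block [Add 48 22 22, Add 48 48 2]) (\<lambda>R M Y f. (R 16 \<le> R 48 \<longrightarrow> Q R M Y (f - 1)) \<and>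
           (R 48 < R 16 \<longrightarrow> wp m (Block [Add 22 22 2]) (\<lambda>R M Y f. I R M Y (f - 1)) R M Y (f - 1))) R' M' Y' f'"
      using h R MY by (intro wp_Block) (auto intro!: wp_Block)
  qed
qed

lemma wp_first_layer:
  assumes gl: "glob R M" "seg a N R" and R: "R 40 = 0" and f: "f \<ge> 24 * real (N + 1)"
    and Q: "\<And>R' M' f'. dp 0 a N M' \<Longrightarrow> \<forall>j\<le>N. M' (bH + j) = real j \<Longrightarrow> \<forall>r<30. R' r = R r \<Longrightarrow>
      \<forall>i. i < bP \<or> bK \<le> i \<longrightarrow> M' i = M i \<Longrightarrow> f' \<ge> f - 24 * real (N + 1) \<Longrightarrow> Q R' M' Y f'"
  shows "wp m first_layer_code Q R M Y f"
proof -
  have NW: "N < W" using gl(2) layout(1) by (simp add: seg_def)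
  have gr: "R 2 = 1" "R 3 = 0" "R 6 = real bP" "R 7 = real bH" "R 19 = real N + 1"
    using gl by (auto simp: glob_def seg_def)
  define J where "J k R' M' f' \<longleftrightarrow> k \<le> N + 1 \<and> (\<forall>j<k. M' (bP + j) = sse x a (a + j)) \<and>
    (\<forall>j<k. M' (bH + j) = real j) \<and> (\<forall>r<40. R' r = R r) \<and> R' 40 = real k \<and>
    (\<forall>i. i < bP \<or> bK \<le> i \<longrightarrow> M' i = M i) \<and> f' \<ge> f - 23 * real k" for k R' M' f'
  define I where "I = (\<lambda>R' M' Y' f'. Y' = Y \<and> (\<exists>k. J k R' M' f'))"
  show ?thesis unfolding first_layer_code_def
  proof (rule wp_Loop[where I = I])
    have "J 0 R M f" unfolding J_def using R by auto
    then show "I R M Y f" unfolding I_def by blast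
  next
    fix R' M' Y' f' assume "I R' M' Y' f'"
    then obtain k where "k \<le> N + 1" "f' \<ge> f - 23 * real k" unfolding I_def J_def by blast
    then show "0 \<le> f'" using f by simp
  next
    fix R' M' Y' f' assume "I R' M' Y' f'"
    then obtain k where "J k R' M' f'" and Y: "Y' = Y" unfolding I_def by blast
    then have J: "k \<le> N + 1" "\<forall>j<k. M' (bP + j) = sse x a (a + j)" "\<forall>j<k. M' (bH + j) = real j"
      "\<forall>r<40. R' r = R r" "R' 40 = real k" "\<forall>i. i < bP \<or> bK \<le> i \<longrightarrow> M' i = M i" "f' \<ge> f - 23 * real k"
      unfolding J_def by blast+
    have "Q R' M' Y (f' - 1)" if "R' 19 \<le> R' 40"
    proof -
      have "k = N + 1" using that J gr by simp
      then show ?thesis using J by (intro Q) (auto simp: dp_def)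
    qed
    moreover have "wp m (sse_code 40 3 ;;
       Block [Add 48 6 40, Store 48 50, Add 48 7 40, Store 48 40, Add 40 40 2])
       (\<lambda>R M Y f. I R M Y (f - 1)) R' M' Y (f' - 1)" if "R' 40 < R' 19"
    proof -
      have k: "k \<le> N" using that J gr by simp
      show ?thesis
      proof (rule wp_Seq, rule wp_sse_code[where a = a and N = N and r = k and c = 0], goal_cases)
        case 1 show ?case by (rule glob_frame[OF gl(1)]) (use J(4,6) in auto)
      next
        case 2 show ?case by (rule seg_frame[OF gl(2)]) (use J(4) in auto)
      next
        case (9 R1 f1)
        define M2 where "M2 = M'(bP + k := sse x a (a + k), bH + k := real k)"
        have adr: "bP + k < m" "bH + k < m" "bP + k < bH" "bH + k < bK" using k NW layout by linarith+
        have "J (Suc k) (R1(48 := real bH + real k, 40 := real k + 1)) M2 (f1 - 6)"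
          unfolding J_def
        proof (intro conjI)
          have "bP + j \<noteq> bP + k" "bP + j \<noteq> bH + k" "bH + j \<noteq> bP + k" if "j < k" for j
            using that adr by linarith+
          then show "\<forall>j<Suc k. M2 (bP + j) = sse x a (a + j)" "\<forall>j<Suc k. M2 (bH + j) = real j"
            using J(2,3) adr by (auto simp: M2_def less_Suc_eq)
          show "\<forall>i. i < bP \<or> bK \<le> i \<longrightarrow> M2 i = M i" using J(6) adr by (auto simp: M2_def)
          show "f1 - 6 \<ge> f - 23 * real (Suc k)" using 9(3) J(7) by simp
        qed (use 9(1) J k in auto)
        moreover have "R1 6 = real bP" "R1 7 = real bH" "R1 40 = real k" "R1 2 = 1"
          using 9(1) J gr by auto
        ultimately show ?case using adr 9(2)
          by (intro wp_Block) (auto simp: I_def M2_def)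
      qed (use J gr k in auto)
    qed
    ultimately show "wp m (Block []) (\<lambda>R M Y f. (R 19 \<le> R 40 \<longrightarrow> Q R M Y (f - 1)) \<and>
           (R 40 < R 19 \<longrightarrow> wp m (sse_code 40 3 ;;
       Block [Add 48 6 40, Store 48 50, Add 48 7 40, Store 48 40, Add 40 40 2])
       (\<lambda>R M Y f. I R M Y (f - 1)) R M Y (f - 1))) R' M' Y' f'"
      unfolding Y by (intro wp_Block) simp
  qed
qed

lemma wp_layers:
  assumes gl: "glob R M" "seg a N R" "dp 0 a N M" and H: "\<forall>j\<le>N. M (bH + j) = real j"
    and h: "0 < h" "h < q"
    and R: "R 22 = real h" "R 23 = 2" "R 24 = real q + 1" and f: "f \<ge> 1044 * (real q * real (N + 1))"
    and Q: "\<And>R' M' f' c. cut x h (q - 1) a N c \<Longrightarrow> M' (bH + N) = real c \<Longrightarrow> \<forall>r<23. R' r = R r \<Longrightarrow>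
      \<forall>i. i < bP \<or> bK \<le> i \<and> i < bC \<longrightarrow> M' i = M i \<Longrightarrow> f' \<ge> f - 1044 * (real q * real (N + 1)) \<Longrightarrow>
      Q R' M' Y f'"
  shows "wp m layers_code Q R M Y f"
proof -
  have aN: "a + N \<le> n" using gl(2) by (simp add: seg_def)
  have gr: "R 2 = 1" using gl by (auto simp: glob_def)
  define J where "J k H R' M' f' \<longleftrightarrow> k < q \<and> dp k a N M' \<and> (\<forall>j\<le>N. M' (bH + j) = real (H j) \<and> cut x h k a j (H j)) \<and>
    (\<forall>r<23. R' r = R r) \<and> R' 23 = real k + 2 \<and> R' 24 = real q + 1 \<and>
    (\<forall>i. i < bP \<or> bK \<le> i \<and> i < bC \<longrightarrow> M' i = M i) \<and> f' \<ge> f - 1043 * (real k * real (N + 1))"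
    for k H R' M' f'
  define I where "I = (\<lambda>R' M' Y' f'. Y' = Y \<and> (\<exists>k H. J k H R' M' f'))"
  have bound: "real k * real (N + 1) \<le> real q * real (N + 1)" if "k \<le> q" for k
    using that by (intro mult_right_mono) auto
  have q1: "real q * real (N + 1) \<ge> 1" using mult_mono[of 1 "real q" 1 "real (N + 1)"] h(2) by simp
  show ?thesis unfolding layers_code_def
  proof (rule wp_Loop[where I = I])
    have "J 0 (\<lambda>j. j) R M f" unfolding J_def cut_def using gl(3) H R h by auto
    then show "I R M Y f" unfolding I_def by blast
  next
    fix R' M' Y' f' assume "I R' M' Y' f'"
    then obtain k H where "J k H R' M' f'" unfolding I_def by blast
    then have "k \<le> q" "f' \<ge> f - 1043 * (real k * real (N + 1))" unfolding J_def by auto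
    then show "0 \<le> f'" using bound[of k] q1 f by linarith
  next
    fix R' M' Y' f' assume "I R' M' Y' f'"
    then obtain k H where "J k H R' M' f'" and Y: "Y' = Y" unfolding I_def by blast
    then have J: "k < q" "dp k a N M'" "\<forall>j\<le>N. M' (bH + j) = real (H j) \<and> cut x h k a j (H j)"
      "\<forall>r<23. R' r = R r" "R' 23 = real k + 2" "R' 24 = real q + 1"
      "\<forall>i. i < bP \<or> bK \<le> i \<and> i < bC \<longrightarrow> M' i = M i" "f' \<ge> f - 1043 * (real k * real (N + 1))"
      unfolding J_def by blast+
    have "Q R' M' Y (f' - 1)" if "R' 24 \<le> R' 23"
    proof -
      have "k = q - 1" using that J(1,5,6) by linarith
      moreover have "f' - 1 \<ge> f - 1044 * (real q * real (N + 1))"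
        using J(8) bound[of k] J(1) q1 by linarith
      ultimately show ?thesis using J by (intro Q[of "H N"]) auto
    qed
    moreover have "wp m (layer_code ;; Block [Add 23 23 2]) (\<lambda>R M Y f. I R M Y (f - 1)) R' M' Y (f' - 1)"
      if cont: "R' 23 < R' 24"
    proof -
      have "real (k + 1) < real q" using cont J(5,6) by simp
      then have k: "k + 1 < q" unfolding of_nat_less_iff .
      \<comment> \<open>The matrix changes with the layer, so the results on row minima are
        instantiated anew in every round.\<close>
      interpret S: kmeans_seg x n W bQ bP bH bT bK bC m k a N
        by unfold_locales (rule aN)
      show ?thesis
      proof (rule wp_Seq, rule S.wp_layer[where H = H and h = h and i = "k + 2"], goal_cases)
        case 1
        have "glob R' M'" by (rule glob_frame[OF gl(1)]) (use J(4,7) in auto)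
        moreover have "seg a N R'" by (rule seg_frame[OF gl(2)]) (use J(4) in auto)
        ultimately show ?case using J(2) by (simp add: S.ok_def)
      next
        case 5
        have "real (k + 1) * real (N + 1) = real k * real (N + 1) + real (N + 1)"
          by (simp add: algebra_simps)
        moreover have "k + 1 \<le> q" "real (N + 1) \<ge> 0" using k by auto
        ultimately show ?case using J(8) bound[of "k + 1"] f q1 by argo
      next
        case (6 R1 M1 f1 t)
        define H' where "H' j = (if k + 2 \<le> h then H j else H (t j))" for j
        have "J (Suc k) H' (R1(23 := 3 + real k)) M1 (f1 - 2)"
          unfolding J_def
        proof (intro conjI)
          show "\<forall>j\<le>N. M1 (bH + j) = real (H' j) \<and> cut x h (Suc k) a j (H' j)"
          proof (intro allI impI conjI)
            fix j assume j: "j \<le> N"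
            show "M1 (bH + j) = real (H' j)" using 6(2) j unfolding H'_def by blast
            have tj: "t j \<le> j"
                "opt x (Suc k) a (a + j) = opt x k a (a + t j) + sse x (a + t j) (a + j)"
              using 6(2) j by blast+
            show "cut x h (Suc k) a j (H' j)"
            proof (cases "k + 2 \<le> h")
              case True
              then show ?thesis using J(3) j by (auto simp: H'_def cut_def)
            next
              case False
              have "cut x h k a (t j) (H (t j))" using J(3) tj(1) j by simp
              then show ?thesis using cut_Suc[OF h(1) _ tj(1) _ tj(2)] False by (simp add: H'_def)
            qed
          qed
          show "f1 - 2 \<ge> f - 1043 * (real (Suc k) * real (N + 1))"
            using 6(5) J(8) by (simp add: algebra_simps)
        qed (use 6 J k in auto)
        moreover have "R1 23 = real k + 2" "R1 2 = 1" using 6(3) J gr by auto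
        ultimately show ?case using Y
          by (intro wp_Block) (auto simp: I_def)
      qed (use J R in auto)
    qed
    ultimately show "wp m (Block []) (\<lambda>R M Y f. (R 24 \<le> R 23 \<longrightarrow> Q R M Y (f - 1)) \<and>
           (R 23 < R 24 \<longrightarrow> wp m (layer_code ;; Block [Add 23 23 2])
       (\<lambda>R M Y f. I R M Y (f - 1)) R M Y (f - 1))) R' M' Y' f'"
      unfolding Y by (intro wp_Block) simp
  qed
qed

lemma wp_split:
  assumes gl: "glob R M" and aN: "a + N \<le> n" and q: "2 \<le> q"
    and R: "R 15 = real a" "R 16 = real q" "R 17 = real (a + N)"
    and f: "f \<ge> 1100 * real q * real (N + 1)"
    and Q: "\<And>R' M' f' c. c \<le> N \<Longrightarrow> opt x (q - 1) a (a + N) =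
        opt x (q div 2 - 1) a (a + c) + opt x (q - q div 2 - 1) (a + c) (a + N) \<Longrightarrow>
      R' 22 = real (q div 2) \<Longrightarrow> R' 25 = real c \<Longrightarrow> \<forall>r<18. R' r = R r \<Longrightarrow>
      \<forall>i. i < bP \<or> bK \<le> i \<and> i < bC \<longrightarrow> M' i = M i \<Longrightarrow>
      f' \<ge> f - 1100 * real q * real (N + 1) \<Longrightarrow> Q R' M' Y f'"
  shows "wp m split_code Q R M Y f"
proof -
  have NW: "N < W" using aN layout(1) by simp
  have gr: "R 2 = 1" "R 4 = real W" "R 5 = real bQ" "R 7 = real bH" using gl by (auto simp: glob_def)
  define R0 where "R0 = R(18 := real N, 19 := real N + 1, 20 := real W + real a,
    21 := real bQ + real a, 24 := real q + 1, 22 := 1)"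
  have R0: "\<forall>r<18. R0 r = R r" "R0 24 = real q + 1" "R0 22 = 1" "seg a N R0" "R0 16 = real q"
    using R aN by (auto simp: R0_def seg_def)
  \<comment> \<open>\<open>s\<close> dominates the halving loop of order q, the first layer of order
    N + 1 and the constant overhead, so that everything is charged to one quantity.\<close>
  define s where "s = real q * real (N + 1)"
  have sq: "s \<ge> real q" "s \<ge> real (N + 1)"
    using mult_mono[of "real q" "real q" 1 "real (N + 1)"] mult_mono[of 1 "real q" "real (N + 1)" "real (N + 1)"] q
    by (auto simp: s_def)
  have s2: "s \<ge> 2" using sq(1) q by linarith
  have f': "f \<ge> 1100 * s" using f by (simp add: s_def)
  have hq: "0 < q div 2" "q div 2 < q" using q by auto
  have "wp m (half_code ;; Block [Const 40 0] ;; first_layer_code ;; Block [Const 23 2] ;; layers_code ;;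
    Block [Add 48 7 18, Load 25 48]) Q R0 M Y (f - 6)"
  proof (rule wp_Seq, rule wp_half[where q = q], goal_cases)
    case 5 show ?case using f' sq s2 by simp
  next
    case (6 R1 f1)
    have g1: "glob (R1(40 := 0)) M" by (rule glob_frame[OF gl]) (use 6 R0 in auto)
    have s1: "seg a N (R1(40 := 0))" by (rule seg_frame[OF R0(4)]) (use 6 in auto)
    show ?case
    proof (rule wp_Seq, rule wp_Block, simp, rule wp_Seq,
        rule wp_first_layer[where a = a and N = N, OF g1 s1], goal_cases)
      case 2 show ?case using 6(4) f' sq s2 by simp
    next
      case L: (3 R2 M2 f2)
      have g2: "glob (R2(23 := 2)) M2" by (rule glob_frame[OF g1]) (use L in auto)
      have s2': "seg a N (R2(23 := 2))" by (rule seg_frame[OF s1]) (use L in auto)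
      show ?case
      proof (rule wp_Seq, rule wp_Block, simp, rule wp_Seq,
          rule wp_layers[where h = "q div 2" and q = q, OF g2 s2' L(1,2) hq], goal_cases)
        case 1 show ?case using L(3) 6(1) by simp
      next
        case 2 show ?case by simp
      next
        case 3 show ?case using L(3) 6(3) R0 by simp
      next
        case 4 show ?case using L(5) 6(4) f' sq s2 unfolding s_def[symmetric] by argo
      next
        case (5 R3 M3 f3 c)
        have R3: "\<forall>r<18. R3 r = R r" "R3 22 = real (q div 2)" "R3 7 = real bH" "R3 18 = real N"
          using 5(3) L(3) 6(1,2) R0 gr by (auto simp: R0_def)
        have "\<not> q - 1 < q div 2" using q by auto
        then have c: "c \<le> N" "opt x (q - 1) a (a + N) =
            opt x (q div 2 - 1) a (a + c) + opt x (q - 1 - q div 2) (a + c) (a + N)"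
          using 5(1) by (auto simp: cut_def)
        have "Q (R3(48 := real bH + real N, 25 := real c)) M3 Y (f3 - 2)"
        proof (rule Q[of c])
          show "f3 - 2 \<ge> f - 1100 * real q * real (N + 1)"
            using 5(5) L(5) 6(4) sq s2 unfolding mult.assoc s_def[symmetric] by argo
          show "\<forall>i. i < bP \<or> bK \<le> i \<and> i < bC \<longrightarrow> M3 i = M i" using 5(4) L(4) by simp
          have "q - 1 - q div 2 = q - q div 2 - 1" by simp
          then show "opt x (q - 1) a (a + N) =
            opt x (q div 2 - 1) a (a + c) + opt x (q - q div 2 - 1) (a + c) (a + N)"
            using c(2) by metis
        qed (use c R3 in auto)
        moreover have "bH + N < m" using NW layout by linarith
        ultimately show ?case using R3 5(2) by (intro wp_Block) simp
      qed
    qed simp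
  qed (use R0 q gr in auto)
  then show ?thesis unfolding split_code_def
    using R gr by (intro wp_Seq[of _ "Block _"] wp_Block) (simp add: R0_def)
qed

end

section \<open>The main loop\<close>

definition near :: "real list \<Rightarrow> real \<Rightarrow> real" where
  "near ys v = (MIN \<mu>\<in>set ys. (v - \<mu>)\<^sup>2)"

lemma near_append_le:
  assumes "ys \<noteq> []"
  shows "near (ys @ zs) v \<le> near ys v"
  unfolding near_def using assms by (intro Min_antimono) auto

lemma near_le: "\<mu> \<in> set ys \<Longrightarrow> near ys v \<le> (v - \<mu>)\<^sup>2"
  unfolding near_def by (intro Min_le) auto

text \<open>Further centroids never make an earlier point more expensive, and the new block pays at
  most its distances to the new centroid. Earlier points require \<open>ys \<noteq> []\<close>,
  since a minimum over the empty set is unspecified.\<close>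

lemma near_snoc_sum:
  assumes "a \<le> b" "0 < a \<longrightarrow> ys \<noteq> []" and \<mu>: "(\<Sum>i=a..<b. (x i - \<mu>)\<^sup>2) = sse x a b"
  shows "(\<Sum>i<b. near (ys @ [\<mu>]) (x i)) \<le> (\<Sum>i<a. near ys (x i)) + sse x a b"
proof -
  have "(\<Sum>i<b. near (ys @ [\<mu>]) (x i)) =
      (\<Sum>i<a. near (ys @ [\<mu>]) (x i)) + (\<Sum>i=a..<b. near (ys @ [\<mu>]) (x i))"
    unfolding lessThan_atLeast0 using assms(1) by (intro sum.atLeastLessThan_concat[symmetric]) auto
  also have "(\<Sum>i<a. near (ys @ [\<mu>]) (x i)) \<le> (\<Sum>i<a. near ys (x i))"
    using assms(2) by (intro sum_mono near_append_le) auto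
  also have "(\<Sum>i=a..<b. near (ys @ [\<mu>]) (x i)) \<le> (\<Sum>i=a..<b. (x i - \<mu>)\<^sup>2)"
    by (intro sum_mono near_le) auto
  finally show ?thesis using \<mu> by simp
qed

fun pending :: "(nat \<Rightarrow> real) \<Rightarrow> nat \<Rightarrow> (nat \<times> nat) list \<Rightarrow> real" where
  "pending x a [] = 0"
| "pending x a ((q, e) # st) = opt x (q - 1) a e + pending x e st"

text \<open>A piece is stored with its right end only. Pieces are finished from left to right, so
  the left end of the topmost one is the current position \<open>a\<close> and every other piece
  starts where its predecessor ends.\<close>

fun chain :: "nat \<Rightarrow> nat \<Rightarrow> (nat \<times> nat) list \<Rightarrow> bool" where
  "chain n a [] \<longleftrightarrow> a = n"
| "chain n a ((q, e) # st) \<longleftrightarrow> 1 \<le> q \<and> a \<le> e \<and> e \<le> n \<and> chain n e st"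

fun potential :: "nat \<Rightarrow> (nat \<times> nat) list \<Rightarrow> real" where
  "potential a [] = 0"
| "potential a ((q, e) # st) = 4 * real q * (real e - real a) + (real q)\<^sup>2 + potential e st"

text \<open>The head of the list is the top of the stack. Indexing a cell by the number of entries
  below it keeps the rest in place under pushing and popping.\<close>

fun stack_at :: "nat \<Rightarrow> nat \<Rightarrow> (nat \<Rightarrow> real) \<Rightarrow> (nat \<times> nat) list \<Rightarrow> bool" where
  "stack_at b w M [] \<longleftrightarrow> True"
| "stack_at b w M ((q, e) # st) \<longleftrightarrow>
    M (b + length st) = real q \<and> M (b + w + length st) = real e \<and> stack_at b w M st"

text \<open>Every piece has at least one cluster, so the height of the stack is bounded by the
  number of clusters; this is why the stack fits into its cells.\<close>

lemma chain_length: "chain n a st \<Longrightarrow> length st \<le> sum_list (map fst st)"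
  by (induction st arbitrary: a) force+

lemma potential_nonneg: "chain n a st \<Longrightarrow> 0 \<le> potential a st"
  by (induction a st rule: potential.induct) auto

lemma stack_at_frame:
  assumes "stack_at b w M st" "\<And>i. i < length st \<Longrightarrow> M' (b + i) = M (b + i)"
    "\<And>i. i < length st \<Longrightarrow> M' (b + w + i) = M (b + w + i)"
  shows "stack_at b w M' st"
  using assms by (induction b w M st rule: stack_at.induct) auto

text \<open>With g = q - h and d = N - c, the left-hand potential falls short of the original one by
  4 (h d + g c) + 2 g h. As h \<le> g and q \<le> 4 h, the first term is at least 4 h N \<ge> q N;
  the second is at least q, because h \<ge> 1 and q \<le> 2 g. Together they pay for q (N +
  1).\<close>

lemma split_potential:
  fixes q h c N :: nat
  assumes "2 \<le> q" "h = q div 2" "c \<le> N"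
  shows "4 * real h * real c + (real h)\<^sup>2 + (4 * (real q - real h) * (real N - real c) + (real q - real h)\<^sup>2)
    + real q * (real N + 1) \<le> 4 * real q * real N + (real q)\<^sup>2"
proof -
  define g where "g = q - h"
  have g: "real q = real h + real g" "h \<le> g" "1 \<le> h" "q \<le> 2 * g" "q \<le> 4 * h"
    using assms(1,2) by (auto simp: g_def)
  define d where "d = N - c"
  have N: "real N = real c + real d" using assms(3) by (simp add: d_def)
  have "real h * real c \<le> real g * real c" using g(2) by (intro mult_right_mono) auto
  moreover have "real q * (real c + real d) \<le> 4 * real h * (real c + real d)"
    using g(5) by (intro mult_right_mono) auto
  moreover have "1 * real q \<le> real h * (2 * real g)" using g(3,4) by (intro mult_mono) auto
  ultimately show ?thesis unfolding N g(1) by (simp add: power2_eq_square algebra_simps)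
qed

text \<open>An empty piece still has to deliver a centroid for the count to be right. Any number
  will do, and the content of cell 0 is taken; a nonempty piece delivers its mean.\<close>

definition emit_code :: com where
  "emit_code =
    Cond 17 15 (Block [Load 48 3, Output 48])
      (Block [Add 48 4 17, Load 48 48, Add 49 4 15, Load 49 49, Sub 48 48 49, Sub 49 17 15,
        Div 48 48 49, Output 48]) ;;
    Block [Move 15 17, Sub 10 10 2]"

text \<open>After a split the right part stays in the cell of the old piece, whose end it shares,
  and only its cluster number is changed. The left part is pushed above it and so is treated
  first.\<close>

definition work_code :: com where
  "work_code = Loop (Block []) 10 11
    (Block [Sub 48 10 2, Load 16 48, Add 48 48 4, Load 17 48] ;;
     Cond 16 2 emit_code
       (split_code ;; Block [Sub 48 10 2, Sub 49 16 22, Store 48 49, Store 10 22, Add 48 10 4,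
         Add 49 15 25, Store 48 49, Add 10 10 2]))"

context kmeans_ram begin

lemma wp_work:
  assumes gl: "glob R M" and K: "1 \<le> K" "K \<le> n"
    and st: "stack_at bK W M [(K, n)]"
    and R: "R 10 = real bK + 1" "R 11 = real bK" "R 15 = 0"
    and f: "f \<ge> 6000 * real K * real n + 1"
    and Q: "\<And>R' M' Y f'. length Y = K \<Longrightarrow> (\<Sum>i<n. near Y (x i)) \<le> opt x (K - 1) 0 n \<Longrightarrow>
      glob R' M' \<Longrightarrow> R' 12 = R 12 \<Longrightarrow> R' 1 = R 1 \<Longrightarrow> f' \<ge> f - 6000 * real K * real n - 1 \<Longrightarrow> Q R' M' Y f'"
  shows "wp m work_code Q R M [] f"
proof -
  define F where "F = f - 6000 * real K * real n"
  define J where "J st a R' M' Y f' \<longleftrightarrow> glob R' M' \<and> stack_at bK W M' st \<and> chain n a st \<and>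
    length Y + sum_list (map fst st) = K \<and> (0 < a \<longrightarrow> Y \<noteq> []) \<and>
    (\<Sum>i<a. near Y (x i)) + pending x a st \<le> opt x (K - 1) 0 n \<and>
    R' 10 = real bK + real (length st) \<and> R' 11 = real bK \<and> R' 15 = real a \<and> R' 12 = R 12 \<and> R' 1 = R 1 \<and>
    f' \<ge> F + 1200 * potential a st" for st a R' M' Y f'
  define I where "I = (\<lambda>R' M' Y' f'. \<exists>st a. J st a R' M' Y' f')"
  \<comment> \<open>The initial potential is 4 K n + K^2, which is at most 5 K n because K \<le> n.
    At 1200 units of fuel per unit of potential this gives the factor 6000.\<close>
  have "real K * real K \<le> real K * real n" using K by (intro mult_left_mono) auto
  then have "J [(K, n)] 0 R M [] f"
    unfolding J_def F_def using gl K st R f by (auto simp: power2_eq_square)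
  then have I0: "I R M [] f" unfolding I_def by blast
  have nonneg: "0 \<le> f'" if I: "I R' M' Y' f'" for R' M' Y' f'
  proof -
    obtain st a where "J st a R' M' Y' f'" using I unfolding I_def by blast
    then have "chain n a st" "f' \<ge> F + 1200 * potential a st" unfolding J_def by blast+
    then show ?thesis using potential_nonneg[of n a st] f unfolding F_def by linarith
  qed
  have exit: "Q R' M' Y' (f' - 1)" if I: "I R' M' Y' f'" and ex: "R' 10 \<le> R' 11" for R' M' Y' f'
  proof -
    obtain st a where J: "J st a R' M' Y' f'" using I unfolding I_def by blast
    have "st = []" using J ex unfolding J_def by simp
    then show ?thesis using J unfolding J_def F_def by (intro Q) auto
  qed
  have body: "wp m (Block [Sub 48 10 2, Load 16 48, Add 48 48 4, Load 17 48] ;;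
     Cond 16 2 emit_code
       (split_code ;; Block [Sub 48 10 2, Sub 49 16 22, Store 48 49, Store 10 22, Add 48 10 4,
         Add 49 15 25, Store 48 49, Add 10 10 2])) (\<lambda>R M Y f. I R M Y (f - 1)) R' M' Y' (f' - 1)"
    if I: "I R' M' Y' f'" and cont: "R' 11 < R' 10" for R' M' Y' f'
  proof -
    obtain st0 a where "J st0 a R' M' Y' f'" using I unfolding I_def by blast
    then have J: "glob R' M'" "stack_at bK W M' st0" "chain n a st0"
      "length Y' + sum_list (map fst st0) = K" "0 < a \<longrightarrow> Y' \<noteq> []"
      "(\<Sum>i<a. near Y' (x i)) + pending x a st0 \<le> opt x (K - 1) 0 n"
      "R' 10 = real bK + real (length st0)" "R' 11 = real bK" "R' 15 = real a" "R' 12 = R 12"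
      "R' 1 = R 1" "f' \<ge> F + 1200 * potential a st0"
      unfolding J_def by blast+
    have "st0 \<noteq> []" using cont J(7,8) by auto
    then obtain q e st where st0: "st0 = (q, e) # st" by (metis list.exhaust prod.exhaust)
    have gr: "R' 2 = 1" "R' 3 = 0" "R' 4 = real W" using J(1) by (auto simp: glob_def)
    have ch: "1 \<le> q" "a \<le> e" "e \<le> n" "chain n e st" using J(3) by (auto simp: st0)
    have len: "length st < n" using chain_length[OF J(3)] J(4) K st0 by simp
    have adr: "bK + length st < m" "bK + W + length st < m" "bK + length st < bK + W"
        "bK + W + length st < bC" "W + e < m" "W + a < m" "0 < m"
      using len ch layout by linarith+
    have top: "M' (bK + length st) = real q" "M' (bK + W + length st) = real e" "stack_at bK W M' st"
      using J(2) by (auto simp: st0)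
    define R1 where "R1 = R'(16 := real q, 48 := real bK + real (length st) + real W, 17 := real e)"
    have R1: "\<forall>r<16. R1 r = R' r" "R1 16 = real q" "R1 17 = real e" by (auto simp: R1_def)
    have g1: "glob R2 M'" if "\<forall>r<10. R2 r = R' r" for R2
      using J(1) that by (rule glob_frame) auto
    have "wp m (Cond 16 2 emit_code
       (split_code ;; Block [Sub 48 10 2, Sub 49 16 22, Store 48 49, Store 10 22, Add 48 10 4,
         Add 49 15 25, Store 48 49, Add 10 10 2])) (\<lambda>R M Y f. I R M Y (f - 1)) R1 M' Y' (f' - 5)"
    proof (rule wp_Cond, goal_cases)
      case 1
      then have q1: "q = 1" using R1 gr ch(1) by simp
      have fin: "wp m (Block [Move 15 17, Sub 10 10 2]) (\<lambda>R M Y f. I R M Y (f - 1)) R2 M' (Y' @ [\<mu>]) f2"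
        if R2: "\<forall>r<18. R2 r = R1 r" and f2: "f2 \<ge> f' - 16" and \<mu>: "(\<Sum>i=a..<e. (x i - \<mu>)\<^sup>2) = sse x a e"
        for R2 f2 \<mu>
      proof -
        have "J st e (R2(15 := real e, 10 := real bK + real (length st))) M' (Y' @ [\<mu>]) (f2 - 3)"
          unfolding J_def
        proof (intro conjI)
          show "glob (R2(15 := real e, 10 := real bK + real (length st))) M'"
            by (rule g1) (use R2 R1 in auto)
          show "(\<Sum>i<e. near (Y' @ [\<mu>]) (x i)) + pending x e st \<le> opt x (K - 1) 0 n"
            using near_snoc_sum[OF ch(2) J(5) \<mu>] J(6) by (simp add: st0 q1)
          have "0 \<le> 4 * (real e - real a)" using ch(2) by simp
          then show "f2 - 3 \<ge> F + 1200 * potential e st" using J(12) f2 by (simp add: st0 q1)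
        qed (use R2 R1 J ch top st0 q1 in auto)
        then show ?thesis using R2 R1 J gr by (intro wp_Block) (auto simp: I_def st0)
      qed
      show ?case unfolding emit_code_def
      proof (rule wp_Seq, rule wp_Cond, goal_cases)
        case 1
        then have "e = a" using R1 J(9) ch(2) by simp
        then show ?case using R1 gr adr
          by (intro wp_Block) (auto intro!: fin)
      next
        case 2
        then have ae: "a < e" using R1 J(9) by simp
        have S: "M' (W + e) = psum x e" "M' (W + a) = psum x a"
          using J(1) ch by (auto simp: glob_def)
        show ?case using R1 gr adr ae S J(9)
          by (intro wp_Block) (auto intro!: fin simp: sse_mean)
      qed
    next
      case 2
      then have "real 1 < real q" using R1 gr by simp
      then have q2: "2 \<le> q" by simp
      define N where "N = e - a"
      have N: "e = a + N" using ch(2) by (simp add: N_def)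
      define z where "z = real q * (real N + 1)"
      have z2: "z \<ge> 2" using mult_mono[of 2 "real q" 1 "real N + 1"] q2 by (simp add: z_def)
      have pot: "potential a st0 \<ge> z"
      proof -
        have "real q * real N \<ge> 0" "real q * real q \<ge> 1 * real q" using q2 by (auto intro: mult_right_mono)
        then have "z \<le> 4 * real q * real N + (real q)\<^sup>2"
          unfolding z_def power2_eq_square distrib_left mult.assoc by argo
        then show ?thesis using potential_nonneg[OF ch(4)] by (simp add: st0 N)
      qed
      show ?case
      proof (rule wp_Seq, rule wp_split[where a = a and q = q and N = N], goal_cases)
        case 1 show ?case by (rule g1) (use R1 in auto)
      next
        case 7
        show ?case using J(12) pot f z2 unfolding F_def z_def[symmetric] mult.assoc of_nat_add of_nat_1
          by argo
      next
        case (8 R2 M2 f2 c)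
        define h where "h = q div 2"
        define l where "l = length st"
        define L where "L = Suc l"
        have L: "length st0 = L" by (simp add: st0 l_def L_def)
        have h: "1 \<le> h" "h < q" using q2 by (auto simp: h_def)
        have R2: "\<forall>r<16. R2 r = R' r" "R2 16 = real q" "R2 22 = real h" "R2 25 = real c"
          using 8(3,4,5) R1 by (auto simp: h_def)
        have R2': "R2 10 = real bK + real L" "R2 2 = 1" "R2 4 = real W" "R2 15 = real a"
          using R2(1) J(7,9) gr L by auto
        define M3 where "M3 = M2(bK + l := real q - real h, bK + L := real h,
          bK + L + W := real a + real c)"
        have adr3: "bK + L < m" "bK + L + W < m" "bK + L < bK + W" "bK + L + W < bC"
            "bK + l < m"
          using len layout unfolding L_def l_def by linarith+
        have M2: "M2 i = M' i" if "i < bP \<or> bK \<le> i \<and> i < bC" for i using 8(6) that by blast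
        have "J ((h, a + c) # (q - h, e) # st) a
            (R2(48 := real bK + real L + real W, 49 := real a + real c, 10 := real bK + real L + 1))
            M3 Y' (f2 - 10)"
          unfolding J_def
        proof (intro conjI)
          show "glob (R2(48 := real bK + real L + real W, 49 := real a + real c,
              10 := real bK + real L + 1)) M3"
            by (rule glob_frame[OF J(1)]) (use R2 M2 adr3 layout in \<open>auto simp: M3_def\<close>)
          have "stack_at bK W M3 st"
            by (rule stack_at_frame[OF top(3)]) (use M2 adr3 layout in \<open>auto simp: M3_def l_def L_def\<close>)
          moreover have "M3 (bK + l) = real (q - h)" "M3 (bK + W + l) = real e"
            using adr3 top(2) M2[of "bK + W + l"] h by (auto simp: M3_def l_def L_def)
          moreover have "M3 (bK + L) = real h" "M3 (bK + W + L) = real (a + c)"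
            using adr3 by (auto simp: M3_def add.assoc add.commute[of W])
          ultimately show "stack_at bK W M3 ((h, a + c) # (q - h, e) # st)"
            by (simp add: l_def L_def)
          show "chain n a ((h, a + c) # (q - h, e) # st)" using ch h 8(1) N by auto
          show "length Y' + sum_list (map fst ((h, a + c) # (q - h, e) # st)) = K"
            using J(4) h by (simp add: st0)
          show "(\<Sum>i<a. near Y' (x i)) + pending x a ((h, a + c) # (q - h, e) # st) \<le> opt x (K - 1) 0 n"
            using J(6) 8(2) by (simp add: st0 N h_def)
          have "potential a ((h, a + c) # (q - h, e) # st) + z \<le> potential a st0"
            using split_potential[OF q2 h_def 8(1)] h by (simp add: st0 N z_def algebra_simps)
          moreover have "f2 \<ge> f' - 5 - 1 - 1100 * z" using 8(7) by (simp add: z_def algebra_simps)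
          ultimately show "f2 - 10 \<ge> F + 1200 * potential a ((h, a + c) # (q - h, e) # st)"
            using J(12) z2 by argo
        qed (use R2 R2' J in \<open>auto simp: l_def L_def\<close>)
        moreover have "address m (real bK + real L - 1) = Some (bK + l)"
          using adr3(5) by (simp add: L_def)
        ultimately show ?case using R2 R2' adr3
          by (intro wp_Block) (auto simp: I_def M3_def fun_upd_twist)
      qed (use q2 N ch R1 J in auto)
    qed
    moreover have "M' (bK + length st + W) = real e" using top(2) by (simp add: ac_simps)
    ultimately show ?thesis
      by (intro wp_Seq[of _ "Block _"] wp_Block)
        (use gr J(7) top adr st0 in \<open>simp add: R1_def\<close>)
  qed
  show ?thesis unfolding work_code_def
    apply (rule wp_Loop[where I = I], rule I0, erule nonneg)
    apply (rule wp_Block, simp only: block_wp.simps, intro conjI impI)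
     apply (erule (1) exit)
    apply (erule (1) body)
    done
qed

end

section \<open>Prefix sums, padding and the complete program\<close>

definition prefix_code :: com where
  "prefix_code = Loop (Block []) 0 40 (Block [Load 43 40, Add 41 41 43, Mul 43 43 43, Add 42 42 43,
    Add 40 40 2, Add 48 4 40, Store 48 41, Add 48 5 40, Store 48 42])"

definition pad_code :: com where
  "pad_code = Loop (Block []) 1 12 (Block [Load 48 3, Output 48, Add 12 12 2])"

definition main_code :: com where
  "main_code =
    Block [Const 2 1, Const 3 0, Add 4 0 2, Add 5 4 4, Add 6 5 4, Add 7 6 4, Add 8 7 4, Add 11 8 4,
      Add 9 11 4, Add 9 9 4, Const 40 0, Const 41 0, Const 42 0] ;;
    prefix_code ;;
    Cond 1 0 (Block [Move 12 1]) (Block [Move 12 0]) ;;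
    Block [Store 11 12, Add 48 11 4, Store 48 0, Add 10 11 2, Const 15 0] ;;
    work_code ;; pad_code"

lemma psum_0: "psum x 0 = 0"
  and psum_Suc: "psum x (Suc i) = psum x i + x i"
  by (simp_all add: psum_def)

context kmeans_ram begin

lemma wp_prefix:
  assumes R: "R 0 = real n" "R 2 = 1" "R 4 = real W" "R 5 = real bQ" "R 40 = 0" "R 41 = 0" "R 42 = 0"
    and M: "\<forall>j<n. M j = x j" "M W = 0" "M bQ = 0"
    and f: "f \<ge> 11 * real n"
    and Q: "\<And>R' M' f'. \<forall>r<40. R' r = R r \<Longrightarrow> \<forall>j<n. M' j = x j \<Longrightarrow> \<forall>j\<le>n. M' (W + j) = psum x j \<Longrightarrow>
      \<forall>j\<le>n. M' (bQ + j) = psum (\<lambda>i. (x i)\<^sup>2) j \<Longrightarrow> f' \<ge> f - 11 * real n - 1 \<Longrightarrow> Q R' M' Y f'"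
  shows "wp m prefix_code Q R M Y f"
proof -
  define J where "J i R' M' f' \<longleftrightarrow> i \<le> n \<and> (\<forall>r<40. R' r = R r) \<and> R' 40 = real i \<and> R' 41 = psum x i \<and>
    R' 42 = psum (\<lambda>i. (x i)\<^sup>2) i \<and> (\<forall>j<n. M' j = x j) \<and> (\<forall>j\<le>i. M' (W + j) = psum x j) \<and>
    (\<forall>j\<le>i. M' (bQ + j) = psum (\<lambda>i. (x i)\<^sup>2) j) \<and> f' \<ge> f - 11 * real i" for i R' M' f'
  define I where "I = (\<lambda>R' M' Y' f'. Y' = Y \<and> (\<exists>i. J i R' M' f'))"
  show ?thesis unfolding prefix_code_def
  proof (rule wp_Loop[where I = I])
    have "J 0 R M f" unfolding J_def using R M by (auto simp: psum_0)
    then show "I R M Y f" unfolding I_def by blast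
  next
    fix R' M' Y' f' assume "I R' M' Y' f'"
    then show "0 \<le> f'" unfolding I_def J_def using f by auto
  next
    fix R' M' Y' f' assume "I R' M' Y' f'"
    then obtain i where "J i R' M' f'" and Y: "Y' = Y" unfolding I_def by blast
    then have J: "i \<le> n" "\<forall>r<40. R' r = R r" "R' 40 = real i" "R' 41 = psum x i"
      "R' 42 = psum (\<lambda>i. (x i)\<^sup>2) i" "\<forall>j<n. M' j = x j" "\<forall>j\<le>i. M' (W + j) = psum x j"
      "\<forall>j\<le>i. M' (bQ + j) = psum (\<lambda>i. (x i)\<^sup>2) j" "f' \<ge> f - 11 * real i"
      unfolding J_def by blast+
    have "Q R' M' Y (f' - 1)" if "R' 0 \<le> R' 40"
    proof -
      have "i = n" using that J R by simp
      then show ?thesis using J by (intro Q) auto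
    qed
    moreover have "block_wp m [Load 43 40, Add 41 41 43, Mul 43 43 43, Add 42 42 43,
        Add 40 40 2, Add 48 4 40, Store 48 41, Add 48 5 40, Store 48 42]
        (\<lambda>R M Y f. I R M Y (f - 1)) R' M' Y (f' - 1)" if "R' 40 < R' 0"
    proof -
      have i: "i < n" using that J R by simp
      have adr: "i < m" "W + Suc i < m" "bQ + Suc i < m" "W + Suc i < bQ" "n < W"
        using i layout by linarith+
      define M2 where "M2 = M'(Suc (W + i) := psum x (Suc i),
        Suc (bQ + i) := psum (\<lambda>i. (x i)\<^sup>2) (Suc i))"
      define R2 where "R2 = R'(43 := x i * x i, 41 := psum x (Suc i), 42 := psum (\<lambda>i. (x i)\<^sup>2) (Suc i),
        40 := real i + 1, 48 := real bQ + (real i + 1))"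
      have "J (Suc i) R2 M2 (f' - 11)"
        unfolding J_def
      proof (intro conjI)
        show "\<forall>j<n. M2 j = x j" using J(6) adr by (auto simp: M2_def)
        show "\<forall>j\<le>Suc i. M2 (W + j) = psum x j" "\<forall>j\<le>Suc i. M2 (bQ + j) = psum (\<lambda>i. (x i)\<^sup>2) j"
          using J(7,8) adr by (auto simp: M2_def le_Suc_eq)
      qed (use J i in \<open>auto simp: R2_def\<close>)
      then have "I R2 M2 Y (f' - 11)" unfolding I_def by blast
      moreover have "address m (real W + (real i + 1)) = Some (Suc (W + i))"
          "address m (real bQ + (real i + 1)) = Some (Suc (bQ + i))"
        using address_of_nat[of m "Suc (W + i)"] address_of_nat[of m "Suc (bQ + i)"] adr
        by (simp_all add: ac_simps)
      ultimately show ?thesis using J R i adr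
        by (simp add: R2_def M2_def psum_Suc power2_eq_square fun_upd_twist)
    qed
    ultimately show "wp m (Block []) (\<lambda>R M Y f. (R 0 \<le> R 40 \<longrightarrow> Q R M Y (f - 1)) \<and>
        (R 40 < R 0 \<longrightarrow> wp m (Block [Load 43 40, Add 41 41 43, Mul 43 43 43, Add 42 42 43,
        Add 40 40 2, Add 48 4 40, Store 48 41, Add 48 5 40, Store 48 42])
        (\<lambda>R M Y f. I R M Y (f - 1)) R M Y (f - 1))) R' M' Y' f'"
      unfolding Y by (intro wp_Block) (simp add: wp_Block del: block_wp.simps(2))
  qed
qed

lemma wp_pad:
  assumes gl: "glob R M" and n: "1 \<le> n" and R: "R 1 = real k" "R 12 = real K" "K \<le> k"
    and f: "f \<ge> 5 * real k"
    and Q: "\<And>R' f'. f' \<ge> f - 5 * real k - 1 \<Longrightarrow> Q R' M (Y @ replicate (k - K) (x 0)) f'"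
  shows "wp m pad_code Q R M Y f"
proof -
  have gr: "R 2 = 1" "R 3 = 0" "M 0 = x 0" "0 < m" using gl n layout by (auto simp: glob_def)
  define I where "I = (\<lambda>(R' :: reg \<Rightarrow> real) M' Y' f'. M' = M \<and> (\<exists>i. K + i \<le> k \<and> Y' = Y @ replicate i (x 0) \<and>
    R' 1 = real k \<and> R' 2 = 1 \<and> R' 3 = 0 \<and> R' 12 = real (K + i) \<and> f' \<ge> f - 5 * real i))"
  show ?thesis unfolding pad_code_def
  proof (rule wp_Loop[where I = I])
    show "I R M Y f" unfolding I_def using R gr by (intro conjI refl exI[of _ 0]) auto
  next
    fix R' M' Y' f' assume "I R' M' Y' f'"
    then show "0 \<le> f'" unfolding I_def using f by auto
  next
    fix R' M' Y' f' assume "I R' M' Y' f'"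
    then obtain i where M': "M' = M" and i: "K + i \<le> k" "Y' = Y @ replicate i (x 0)" "R' 1 = real k"
        "R' 2 = 1" "R' 3 = 0" "R' 12 = real (K + i)" "f' \<ge> f - 5 * real i"
      unfolding I_def by blast
    have "Q R' M Y' (f' - 1)" if "R' 1 \<le> R' 12"
    proof -
      have "i = k - K" using that i by simp
      then have "Q R' M (Y @ replicate (k - K) (x 0)) (f' - 1)" using i(1,7) by (intro Q) auto
      then show ?thesis using \<open>i = k - K\<close> by (simp add: i(2))
    qed
    moreover have "I (R'(48 := x 0, 12 := real (K + i) + 1)) M (Y' @ [x 0]) (f' - 5)"
      if "R' 12 < R' 1"
      unfolding I_def
      using i that by (intro conjI refl exI[of _ "Suc i"]) (auto simp: replicate_append_same)
    ultimately show "wp m (Block []) (\<lambda>R M Y f. (R 1 \<le> R 12 \<longrightarrow> Q R M Y (f - 1)) \<and>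
        (R 12 < R 1 \<longrightarrow> wp m (Block [Load 48 3, Output 48, Add 12 12 2])
        (\<lambda>R M Y f. I R M Y (f - 1)) R M Y (f - 1))) R' M' Y' f'"
      unfolding M' using gr i by (intro wp_Block) (auto intro!: wp_Block)
  qed
qed

lemma wp_main:
  assumes lay: "W = n + 1" "bQ = 2 * W" "bP = 3 * W" "bH = 4 * W" "bT = 5 * W" "bK = 6 * W" "bC = 8 * W"
    and n: "1 \<le> n" "1 \<le> k"
    and R: "R 0 = real n" "R 1 = real k" and M: "\<forall>i. M i = (if i < n then x i else 0)"
    and f: "f \<ge> 6100 * (real k * real n)"
  shows "wp m main_code (\<lambda>R' M' Y' f'. 0 \<le> f' \<and> (\<exists>Y. Y' = Y @ replicate (k - min k n) (x 0) \<and>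
    length Y = min k n \<and> (\<Sum>i<n. near Y (x i)) \<le> opt x (min k n - 1) 0 n)) R M [] f"
    (is "wp m main_code ?Q R M [] f")
proof -
  define K where "K = min k n"
  \<comment> \<open>\<open>z\<close> dominates 1, \<open>n\<close>, \<open>k\<close> and
    \<open>K * n\<close>. So the prefix sums, the padding and the fixed instructions all fit into
    the 100 units by which 6100 exceeds the factor of the main loop.\<close>
  define z where "z = real k * real n"
  have z: "real k \<le> z" "real n \<le> z" "1 \<le> z" "real K * real n \<le> z"
    using mult_mono[of "real k" "real k" 1 "real n"] mult_mono[of 1 "real k" "real n" "real n"]
      mult_mono[of 1 "real k" 1 "real n"] mult_mono[of "real K" "real k" "real n" "real n"] n
    by (auto simp: z_def K_def)
  have f': "f \<ge> 6100 * z" using f by (simp add: z_def)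
  have e: "real n + 1 = real W" "real W + real W = real bQ" "real bQ + real W = real bP"
      "real bP + real W = real bH" "real bH + real W = real bT" "real bT + real W = real bK"
      "real bK + real W + real W = real bC"
    unfolding lay by simp_all
  define R1 where "R1 = R(2 := 1, 3 := 0, 4 := real W, 5 := real bQ, 6 := real bP, 7 := real bH,
    8 := real bT, 11 := real bK, 9 := real bC, 40 := 0, 41 := 0, 42 := 0)"
  have R1: "R1 0 = real n" "R1 1 = real k" "R1 2 = 1" "R1 3 = 0" "R1 4 = real W" "R1 5 = real bQ"
    "R1 6 = real bP" "R1 7 = real bH" "R1 8 = real bT" "R1 9 = real bC" "R1 11 = real bK"
    "R1 40 = 0" "R1 41 = 0" "R1 42 = 0"
    using R by (simp_all add: R1_def)
  have work: "wp m (Block [Store 11 12, Add 48 11 4, Store 48 0, Add 10 11 2, Const 15 0] ;;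
      work_code ;; pad_code) ?Q (R2(12 := real K)) M2 [] f2"
    if R2: "\<forall>r<40. R2 r = R1 r" and M2: "\<forall>j<n. M2 j = x j" "\<forall>j\<le>n. M2 (W + j) = psum x j"
      "\<forall>j\<le>n. M2 (bQ + j) = psum (\<lambda>i. (x i)\<^sup>2) j" and f2: "f2 \<ge> f - 11 * real n - 17" for R2 M2 f2
  proof -
    define M3 where "M3 = M2(bK := real K, bK + W := real n)"
    define R3 where "R3 = R2(12 := real K, 48 := real bK + real W, 10 := real bK + 1, 15 := 0)"
    have adr: "bK < m" "bK + W < m" "W + n < bK" "bQ + n < bK" "n < bK" using layout by linarith+
    have g: "glob R3 M3"
      unfolding glob_def using R2 R1 M2 adr by (auto simp: R3_def M3_def)
    have W0: "0 < W" using lay by simp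
    have "wp m (work_code ;; pad_code) ?Q R3 M3 [] (f2 - 5)"
    proof (rule wp_Seq, rule wp_work[where K = K], goal_cases)
      case 1 show ?case by (rule g)
    next
      case 4 show ?case using W0 by (simp add: M3_def)
    next
      case 8 show ?case using f2 f' z unfolding mult.assoc by argo
    next
      case (9 R4 M4 Y f4)
      show ?case
      proof (rule wp_pad[where k = k and K = K], goal_cases)
        case 1 show ?case by (rule 9(3))
      next
        case 3 show ?case using 9(5) R2 R1 by (simp add: R3_def)
      next
        case 4 show ?case using 9(4) R2 R1 by (simp add: R3_def)
      next
        case 6 show ?case using 9(6) f2 f' z unfolding mult.assoc by argo
      next
        case (7 R5 f5)
        have "0 \<le> f5" using 7 9(6) f2 f' z unfolding mult.assoc by argo
        then show ?case using 9(1,2) unfolding K_def by blast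
      qed (use n in \<open>auto simp: K_def\<close>)
    qed (use n in \<open>auto simp: K_def R3_def\<close>, use R2 R1 in auto)
    then show ?thesis using R2 R1 adr
      by (intro wp_Seq[of _ "Block _"] wp_Block) (simp add: R3_def M3_def)
  qed
  have "wp m (prefix_code ;; Cond 1 0 (Block [Move 12 1]) (Block [Move 12 0]) ;;
    Block [Store 11 12, Add 48 11 4, Store 48 0, Add 10 11 2, Const 15 0] ;;
    work_code ;; pad_code) ?Q R1 M [] (f - 13)"
  proof (rule wp_Seq, rule wp_prefix, goal_cases)
    case 11 show ?case using f' z by argo
  next
    case (12 R2 M2 f2)
    have R2: "R2 0 = real n" "R2 1 = real k" using 12(1) R1 by auto
    show ?case
    proof (rule wp_Seq, rule wp_Cond, goal_cases)
      case 1
      then have "R2 1 = real K" using R2 by (simp add: K_def)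
      moreover have "f2 - 1 - 1 \<ge> f - 11 * real n - 17" using 12(5) by simp
      ultimately show ?case using work[OF 12(1-4)] by (intro wp_Block) simp
    next
      case 2
      then have "R2 0 = real K" using R2 by (simp add: K_def)
      moreover have "f2 - 1 - 1 - 1 \<ge> f - 11 * real n - 17" using 12(5) by simp
      ultimately show ?case using work[OF 12(1-4)] by (intro wp_Block) simp
    qed
  qed (use R1 M layout in auto)
  then show ?thesis unfolding main_code_def
    using R e by (intro wp_Seq[of _ "Block _"] wp_Block) (simp add: R1_def)
qed

end

section \<open>Optimality of the output and the final bounds\<close>

lemma near_nonneg: "ys \<noteq> [] \<Longrightarrow> 0 \<le> near ys v"
  unfolding near_def by (intro Min.boundedI) auto

lemma kmeans_cost_near: "kmeans_cost xs (set ys) = (\<Sum>i<length xs. near ys (xs ! i))"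
  unfolding kmeans_cost_def near_def by (simp add: sum_list_sum_nth lessThan_atLeast0)

text \<open>Padding can only lower the cost, so the output costs at most \<open>opt\<close>, while
  \<open>opt_le_cost\<close> bounds every competitor from below. For \<open>k\<close> above the
  number of points the competitor on that side is the list of points itself, which costs 0.\<close>

lemma optimal_kmeans_padded:
  assumes xs: "sorted xs" "length xs \<ge> 1" and k: "k \<ge> 1"
    and Y: "length Y = min k (length xs)"
      "(\<Sum>i<length xs. near Y (xs ! i)) \<le> opt ((!) xs) (min k (length xs) - 1) 0 (length xs)"
  shows "optimal_kmeans xs k (Y @ replicate (k - min k (length xs)) c)"
  unfolding optimal_kmeans_def
proof (intro conjI allI impI)
  let ?n = "length xs" and ?Y = "Y @ replicate (k - min k (length xs)) c"
  show "length ?Y = k" using Y(1) by simp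
  fix ms :: "real list" assume ms: "length ms = k"
  have sorted: "xs ! i \<le> xs ! j" if "i \<le> j" "j < ?n" for i j
    using xs(1) that by (rule sorted_nth_mono)
  have bound: "opt ((!) xs) (l - 1) 0 ?n \<le> kmeans_cost xs (set zs)" if zs: "length zs = l" "l \<ge> 1" for zs l
  proof -
    have "opt ((!) xs) (l - 1) 0 ?n \<le> (\<Sum>i=0..<?n. MIN \<mu>\<in>set zs. (xs ! i - \<mu>)\<^sup>2)"
    proof (rule opt_le_cost[where n = ?n])
      show "card (set zs) \<le> Suc (l - 1)" using card_length[of zs] zs by simp
      show "set zs \<noteq> {}" using zs by auto
    qed (use sorted in auto)
    then show ?thesis unfolding kmeans_cost_near near_def lessThan_atLeast0 .
  qed
  have "Y \<noteq> []" using Y(1) xs(2) k by auto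
  then have "kmeans_cost xs (set ?Y) \<le> kmeans_cost xs (set Y)"
    unfolding kmeans_cost_near by (intro sum_mono near_append_le)
  also have "\<dots> \<le> opt ((!) xs) (min k ?n - 1) 0 ?n" using Y(2) unfolding kmeans_cost_near .
  also have "\<dots> \<le> kmeans_cost xs (set ms)"
  proof (cases "k \<le> ?n")
    case True
    then show ?thesis using bound[OF ms k] by (simp add: min_def)
  next
    case False
    have "near xs (xs ! i) \<le> 0" if "i < ?n" for i using near_le[of "xs ! i" xs "xs ! i"] that by simp
    then have "kmeans_cost xs (set xs) \<le> 0" unfolding kmeans_cost_near by (intro sum_nonpos) auto
    then have "opt ((!) xs) (min k ?n - 1) 0 ?n \<le> 0" using bound[OF refl xs(2)] False by simp
    also have "0 \<le> kmeans_cost xs (set ms)"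
      unfolding kmeans_cost_near using ms k by (intro sum_nonneg near_nonneg) auto
    finally show ?thesis .
  qed
  finally show "kmeans_cost xs (set ?Y) \<le> kmeans_cost xs (set ms)" .
qed

theorem mainTheorem4:
  "\<exists>(p :: program) (C :: nat).
     \<forall>(xs :: real list) (k :: nat). sorted xs \<and> length xs \<ge> 1 \<and> k \<ge> 1 \<longrightarrow>
       (\<exists>ms t s. computes_in p xs k ms t s \<and> optimal_kmeans xs k ms \<and>
          t \<le> C * (k * length xs) \<and> s \<le> C * length xs)"
proof -
  define p where "p = compile 0 main_code @ [Halt]"
  have "\<exists>ms t s. computes_in p xs k ms t s \<and> optimal_kmeans xs k ms \<and>
      t \<le> (num_regs p + 6101) * (k * length xs) \<and> s \<le> (num_regs p + 6101) * length xs"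
    if xs: "sorted xs" "length xs \<ge> 1" and k: "k \<ge> 1" for xs k
  proof -
    define n where "n = length xs"
    \<comment> \<open>Eight blocks of n + 1 cells precede the column lists: points, two arrays of
      prefix sums, layer, crossing positions, row minima and two stack arrays. The column lists take
      five more.\<close>
    define m where "m = 13 * (n + 1)"
    interpret kmeans_ram "(!) xs" n "n + 1" "2 * (n + 1)" "3 * (n + 1)" "4 * (n + 1)" "5 * (n + 1)"
      "6 * (n + 1)" "8 * (n + 1)" m
      by unfold_locales (use sorted_nth_mono[OF xs(1)] in \<open>auto simp: m_def n_def\<close>)
    define R where "R = (\<lambda>_ :: reg. 0 :: real)(0 := real n, 1 := real k)"
    define M where "M = (\<lambda>i. if i < n then xs ! i else 0)"
    have init: "init_config xs k = cfg 0 R M []"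
      by (simp add: init_config_def cfg_def R_def M_def n_def)
    have "wp m main_code (\<lambda>R' M' Y' f'. 0 \<le> f' \<and> (\<exists>Y. Y' = Y @ replicate (k - min k n) (xs ! 0) \<and>
        length Y = min k n \<and> (\<Sum>i<n. near Y (xs ! i)) \<le> opt ((!) xs) (min k n - 1) 0 n)) R M []
        (6100 * (real k * real n))"
      by (rule wp_main) (use xs(2) k in \<open>auto simp: R_def M_def n_def\<close>)
    then obtain t R' M' Y' Y where
        run: "\<forall>p l. code_at p l (compile l main_code) \<longrightarrow>
          (step m p ^^ t) (cfg l R M []) (cfg (l + len main_code) R' M' Y')"
        and t: "0 \<le> 6100 * (real k * real n) - real t"
        and Y': "Y' = Y @ replicate (k - min k n) (xs ! 0)" "length Y = min k n"
          "(\<Sum>i<n. near Y (xs ! i)) \<le> opt ((!) xs) (min k n - 1) 0 n"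
      unfolding wp_def by blast
    have "code_at p 0 (compile 0 main_code)"
      unfolding code_at_def p_def by (intro exI[of _ "[]"] exI[of _ "[Halt]"]) simp
    with run have "(step m p ^^ t) (init_config xs k) (cfg (len main_code) R' M' Y')"
      unfolding init by (metis add_0)
    moreover have "halted p (cfg (len main_code) R' M' Y')"
      by (simp add: halted_def p_def cfg_def nth_append)
    ultimately have "computes_in p xs k Y' (Suc t) (num_regs p + m)"
      unfolding computes_in_def by (intro exI[of _ m] exI[of _ t]) (auto simp: m_def n_def cfg_def)
    moreover have "optimal_kmeans xs k Y'"
      unfolding Y'(1) n_def using xs k Y'(2,3) unfolding n_def by (intro optimal_kmeans_padded)
    \<comment> \<open>One unit beyond 6100 pays for the final \<open>Halt\<close>, as the product of
      both sizes is at least 1. The term \<open>num_regs p\<close> serves the space bound.\<close>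
    moreover have "Suc t \<le> (num_regs p + 6101) * (k * length xs)"
    proof -
      have "real t \<le> real (6100 * (k * n))" using t by simp
      then have "t \<le> 6100 * (k * n)" unfolding of_nat_le_iff .
      moreover have "1 \<le> k * n" using xs(2) k by (simp add: n_def Suc_le_eq)
      ultimately show ?thesis unfolding n_def add_mult_distrib by linarith
    qed
    moreover have "num_regs p + m \<le> (num_regs p + 6101) * length xs"
    proof -
      have "1 \<le> n" using xs(2) by (simp add: n_def)
      then have "num_regs p \<le> num_regs p * n" "m \<le> 26 * n" "26 * n \<le> 6101 * n"
        unfolding m_def by auto
      then show ?thesis unfolding n_def add_mult_distrib by (meson add_mono le_trans)
    qed
    ultimately show ?thesis by blast
  qed
  then show ?thesis by blast
qed

end
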